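(* Let $G=\mathrm{SL}(4,\mathbb{C})$, let $w_0=s_{i_1}s_{i_2}\cdots s_{i_6}$ be a reduced expression of the longest element $w_0$ of the Weyl group, and let $\underline{i}=(i_1,i_2,\dots,i_6)$. Then the anti-canonical line bundle on $Z(w_0,\underline{i})$ is globally generated.
   Context: $T$ is a maximal torus of $G$, $W=N_G(T)/T$, $B^+\supset T$ a Borel subgroup with simple roots $\alpha_1,\alpha_2,\alpha_3$, $s_i$ the simple reflection of $\alpha_i$, and $B$ the Borel subgroup opposite to $B^+$ with respect to $T$. $P_\alpha$ is the minimal parabolic subgroup generated by $B$ and a representative of $s_\alpha$. BSDH variety: for a reduced expression $w=s_{i_1}\cdots s_{i_r}$ and $\underline{i}=(i_1,\dots,i_r)$, $Z(w,\underline{i})=(P_{\alpha_{i_1}}\times\cdots\times P_{\alpha_{i_r}})/B^r$, where $(p_1,\dots,p_r)(b_1,\dots,b_r)=(p_1b_1,\,b_1^{-1}p_2b_2,\dots,b_{r-1}^{-1}p_rb_r)$; it is a smooth projective variety of dimension $r$. *)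

theory Defs
  imports
    "HOL-Analysis.Analysis"
    "HOL-Algebra.Group_Action"
    "HOL-Algebra.Generated_Groups"
begin

section \<open>The group, its Borel subgroups and its Weyl group\<close>

definition SL4 :: "(complex^4^4) monoid" where
  "SL4 = \<lparr>carrier = {A. det A = 1}, mult = (**), one = mat 1\<rparr>"

lemma group_SL4: "group SL4"
proof (rule groupI)
  fix A assume "A \<in> carrier SL4"
  then have A: "det A = 1" by (simp add: SL4_def)
  then obtain A' where A': "A ** A' = mat 1" "A' ** A = mat 1"
    by (metis invertible_def invertible_det_nz zero_neq_one)
  then have "det A' = 1"
    by (metis A det_I det_mul mult_1)
  then show "\<exists>B\<in>carrier SL4. B \<otimes>\<^bsub>SL4\<^esub> A = \<one>\<^bsub>SL4\<^esub>"
    using A' by (auto simp: SL4_def)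
qed (auto simp: SL4_def det_mul matrix_mul_assoc)

definition conjugate :: "complex^4^4 \<Rightarrow> (complex^4^4) set \<Rightarrow> (complex^4^4) set" where
  "conjugate g S = (\<lambda>A. g ** A ** matrix_inv g) ` S"

text \<open>
  All pairs consisting of a maximal torus of \<open>SL(4,\<complex>)\<close> and a Borel subgroup containing it are
  conjugate. An arbitrary such pair is therefore given by some \<open>g \<in> SL(4,\<complex>)\<close> as
  \<open>(torus g, borel_pos g)\<close>, with the standard pair at \<open>g = 1\<close>. The indices of type \<^typ>\<open>4\<close> are
  ordered as \<open>0 < 1 < 2 < 3\<close>.
\<close>

definition torus :: "complex^4^4 \<Rightarrow> (complex^4^4) set" where
  "torus g = conjugate g {A \<in> carrier SL4. \<forall>a b. a \<noteq> b \<longrightarrow> A $ a $ b = 0}"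

definition borel_pos :: "complex^4^4 \<Rightarrow> (complex^4^4) set" where
  "borel_pos g = conjugate g {A \<in> carrier SL4. \<forall>a b. b < a \<longrightarrow> A $ a $ b = 0}"

text \<open>The Borel subgroup opposite to \<open>borel_pos g\<close> with respect to \<open>torus g\<close>.\<close>

definition borel_opp :: "complex^4^4 \<Rightarrow> (complex^4^4) set" where
  "borel_opp g = conjugate g {A \<in> carrier SL4. \<forall>a b. a < b \<longrightarrow> A $ a $ b = 0}"

definition weyl_group :: "complex^4^4 \<Rightarrow> (complex^4^4) set monoid" where
  "weyl_group g = (SL4\<lparr>carrier := normalizer SL4 (torus g)\<rparr>) Mod (torus g)"

text \<open>
  The simple roots of \<open>borel_pos g\<close> send \<open>g diag(t\<^sub>0,t\<^sub>1,t\<^sub>2,t\<^sub>3) g\<^sup>-\<^sup>1\<close> to \<open>t\<^sub>k\<^sub>-\<^sub>1 / t\<^sub>k\<close>, for \<open>k = 1,2,3\<close>.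
  The reflection in the \<open>k\<close>-th one exchanges \<open>t\<^sub>k\<^sub>-\<^sub>1\<close> and \<open>t\<^sub>k\<close>. The sign in its representative
  makes the determinant equal to 1.
\<close>

definition swap_matrix :: "nat \<Rightarrow> complex^4^4" where
  "swap_matrix k = (\<chi> a b.
     if a = of_nat (k - 1) \<and> b = of_nat k then 1
     else if a = of_nat k \<and> b = of_nat (k - 1) then - 1
     else if a = b \<and> a \<noteq> of_nat (k - 1) \<and> a \<noteq> of_nat k then 1
     else 0)"

definition simple_reflection :: "complex^4^4 \<Rightarrow> nat \<Rightarrow> (complex^4^4) set" where
  "simple_reflection g k = torus g #>\<^bsub>SL4\<^esub> (g ** swap_matrix k ** matrix_inv g)"

definition weyl_word :: "complex^4^4 \<Rightarrow> nat list \<Rightarrow> (complex^4^4) set" where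
  "weyl_word g ks = foldr (\<lambda>k w. simple_reflection g k \<otimes>\<^bsub>weyl_group g\<^esub> w) ks \<one>\<^bsub>weyl_group g\<^esub>"

definition weyl_length :: "complex^4^4 \<Rightarrow> (complex^4^4) set \<Rightarrow> nat" where
  "weyl_length g w = (LEAST n. \<exists>ks. set ks \<subseteq> {1,2,3} \<and> length ks = n \<and> weyl_word g ks = w)"

definition reduced_expression :: "complex^4^4 \<Rightarrow> nat list \<Rightarrow> (complex^4^4) set \<Rightarrow> bool" where
  "reduced_expression g ks w \<longleftrightarrow>
     set ks \<subseteq> {1,2,3} \<and> weyl_word g ks = w \<and> length ks = weyl_length g w"

definition longest_element :: "complex^4^4 \<Rightarrow> (complex^4^4) set \<Rightarrow> bool" where
  "longest_element g w \<longleftrightarrow>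
     w \<in> carrier (weyl_group g) \<and> (\<forall>v\<in>carrier (weyl_group g). weyl_length g v \<le> weyl_length g w)"

text \<open>
  A Weyl group element is a coset of \<open>torus g\<close>, and \<open>torus g \<subseteq> borel_opp g\<close>; adjoining the whole
  coset is thus the same as adjoining any one representative.
\<close>

definition minimal_parabolic :: "complex^4^4 \<Rightarrow> nat \<Rightarrow> (complex^4^4) set" where
  "minimal_parabolic g k = generate SL4 (borel_opp g \<union> simple_reflection g k)"


section \<open>Varieties as spaces with functions\<close>

text \<open>
  A complex variety is encoded by its Zariski topology and, for every open set \<open>U\<close>, the set of
  regular functions on \<open>U\<close>. These are total functions, of which only the values on \<open>U\<close> matter.
\<close>

record 'a function_space =
  topo :: "'a topology"
  regular :: "'a set \<Rightarrow> ('a \<Rightarrow> complex) set"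

text \<open>Polynomials in the entries of a tuple of matrices.\<close>

inductive_set polynomials :: "((nat \<Rightarrow> complex^4^4) \<Rightarrow> complex) set" where
  const: "(\<lambda>_. c) \<in> polynomials"
| entry: "(\<lambda>p. p k $ a $ b) \<in> polynomials"
| add: "f \<in> polynomials \<Longrightarrow> h \<in> polynomials \<Longrightarrow> (\<lambda>p. f p + h p) \<in> polynomials"
| mult: "f \<in> polynomials \<Longrightarrow> h \<in> polynomials \<Longrightarrow> (\<lambda>p. f p * h p) \<in> polynomials"

definition zariski :: "(nat \<Rightarrow> complex^4^4) topology" where
  "zariski = topology_generated_by {{p. f p \<noteq> 0} | f. f \<in> polynomials}"

definition subvariety :: "(nat \<Rightarrow> complex^4^4) set \<Rightarrow> (nat \<Rightarrow> complex^4^4) function_space" where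
  "subvariety X =
     \<lparr>topo = subtopology zariski X,
      regular = (\<lambda>U. {\<phi>. \<forall>x\<in>U. \<exists>V. openin (subtopology zariski X) V \<and> x \<in> V \<and> V \<subseteq> U \<and>
        (\<exists>f\<in>polynomials. \<exists>h\<in>polynomials. \<forall>y\<in>V. h y \<noteq> 0 \<and> \<phi> y = f y / h y)})\<rparr>"

text \<open>
  The quotient by an equivalence relation: a set of classes is open iff its preimage is, and a
  function is regular iff its pullback is.
\<close>

definition quotient_space :: "'a function_space \<Rightarrow> ('a \<times> 'a) set \<Rightarrow> 'a set function_space" where
  "quotient_space S R =
     \<lparr>topo = topology (\<lambda>U. U \<subseteq> topspace (topo S) // R \<and>
        openin (topo S) {x \<in> topspace (topo S). R `` {x} \<in> U}),
      regular = (\<lambda>U. {\<phi>. (\<lambda>x. \<phi> (R `` {x})) \<in>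
        regular S {x \<in> topspace (topo S). R `` {x} \<in> U}})\<rparr>"

lemma openin_quotient_space:
  "openin (topo (quotient_space S R)) U \<longleftrightarrow>
     U \<subseteq> topspace (topo S) // R \<and> openin (topo S) {x \<in> topspace (topo S). R `` {x} \<in> U}"
proof -
  let ?pre = "\<lambda>U. {x \<in> topspace (topo S). R `` {x} \<in> U}"
  have "?pre (U \<inter> V) = ?pre U \<inter> ?pre V" for U V
    by auto
  moreover have "?pre (\<Union>\<K>) = \<Union>(?pre ` \<K>)" for \<K>
    by auto
  ultimately have "istopology (\<lambda>U. U \<subseteq> topspace (topo S) // R \<and> openin (topo S) (?pre U))"
    unfolding istopology_def by (auto simp: openin_Int le_infI1 intro!: openin_Union)
  then show ?thesis
    by (simp add: quotient_space_def topology_inverse')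
qed


section \<open>The anti-canonical line bundle\<close>

record ('a, 'v) vector_bundle =
  base :: "'a set"
  fibre :: "'a \<Rightarrow> 'v set"
  global_sections :: "('a \<Rightarrow> 'v) set"

text \<open>Every fibre is spanned by the values of global sections: evaluation is surjective.\<close>

definition globally_generated :: "('a, 'v) vector_bundle \<Rightarrow> bool" where
  "globally_generated E \<longleftrightarrow>
     (\<forall>z\<in>base E. \<forall>v\<in>fibre E z. \<exists>s\<in>global_sections E. s z = v)"

definition regular_at :: "'a function_space \<Rightarrow> 'a \<Rightarrow> ('a \<Rightarrow> complex) set" where
  "regular_at S z = {f. \<exists>U. openin (topo S) U \<and> z \<in> U \<and> f \<in> regular S U}"

text \<open>
  Let \<open>S\<close> be smooth of dimension \<open>n\<close>. The anti-canonical bundle is the dual of \<open>\<Lambda>\<^sup>n \<Omega>\<close>. By the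
  universal property of \<open>\<Omega>\<close>, a linear form \<open>\<Lambda>\<^sup>n \<Omega> \<rightarrow> \<complex>\<close> on the fibre at \<open>z\<close> is the same as an
  alternating map \<open>D\<close> on \<open>n\<close>-tuples of germs of regular functions that is a \<open>\<complex>\<close>-linear
  derivation at \<open>z\<close> in each argument; \<open>D [f\<^sub>1,\<dots>,f\<^sub>n]\<close> is its value on \<open>df\<^sub>1 \<and> \<dots> \<and> df\<^sub>n\<close>.
  Such a \<open>D\<close> is extended by 0 to the lists that are not such tuples.
\<close>

definition anticanonical_fibre ::
    "nat \<Rightarrow> 'a function_space \<Rightarrow> 'a \<Rightarrow> (('a \<Rightarrow> complex) list \<Rightarrow> complex) set" where
  "anticanonical_fibre n S z = {D.
     (\<forall>fs. \<not> (length fs = n \<and> set fs \<subseteq> regular_at S z) \<longrightarrow> D fs = 0) \<and>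
     (\<forall>fs k f h c. length fs = n \<and> set fs \<subseteq> regular_at S z \<and> k < n \<and>
        f \<in> regular_at S z \<and> h \<in> regular_at S z \<longrightarrow>
          D (fs[k := (\<lambda>x. f x + h x)]) = D (fs[k := f]) + D (fs[k := h]) \<and>
          D (fs[k := (\<lambda>x. c * f x)]) = c * D (fs[k := f]) \<and>
          D (fs[k := (\<lambda>x. f x * h x)]) = f z * D (fs[k := h]) + h z * D (fs[k := f]) \<and>
          ((\<exists>U. openin (topo S) U \<and> z \<in> U \<and> (\<forall>x\<in>U. f x = h x)) \<longrightarrow>
             D (fs[k := f]) = D (fs[k := h]))) \<and>
     (\<forall>fs j k. j < k \<and> k < n \<and> length fs = n \<and> set fs \<subseteq> regular_at S z \<and> fs ! j = fs ! k \<longrightarrow>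
        D fs = 0)}"

text \<open>
  A section is regular iff its contraction with \<open>df\<^sub>1 \<and> \<dots> \<and> df\<^sub>n\<close> is a regular function on \<open>U\<close>
  for all \<open>f\<^sub>1,\<dots>,f\<^sub>n\<close> regular on an open set \<open>U\<close>.
\<close>

definition anticanonical_bundle ::
    "nat \<Rightarrow> 'a function_space \<Rightarrow> ('a, ('a \<Rightarrow> complex) list \<Rightarrow> complex) vector_bundle" where
  "anticanonical_bundle n S =
     \<lparr>base = topspace (topo S),
      fibre = anticanonical_fibre n S,
      global_sections = {s.
        (\<forall>z\<in>topspace (topo S). s z \<in> anticanonical_fibre n S z) \<and>
        (\<forall>U fs. openin (topo S) U \<and> length fs = n \<and> set fs \<subseteq> regular S U \<longrightarrow>
           (\<lambda>z. s z fs) \<in> regular S U)}\<rparr>"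


section \<open>Bott-Samelson-Demazure-Hansen varieties\<close>

text \<open>
  The \<open>j\<close>-th factors of a tuple, \<open>j = 1,\<dots>,r\<close>, are stored at the positions \<open>0,\<dots>,r - 1\<close>.
\<close>

definition parabolic_product :: "complex^4^4 \<Rightarrow> nat list \<Rightarrow> (nat \<Rightarrow> complex^4^4) set" where
  "parabolic_product g ks = (\<Pi>\<^sub>E j\<in>{..<length ks}. minimal_parabolic g (ks ! j))"

definition borel_action ::
    "nat \<Rightarrow> (nat \<Rightarrow> complex^4^4) \<Rightarrow> (nat \<Rightarrow> complex^4^4) \<Rightarrow> (nat \<Rightarrow> complex^4^4)" where
  "borel_action r p b = (\<lambda>j\<in>{..<r}.
     if j = 0 then p 0 ** b 0 else matrix_inv (b (j - 1)) ** p j ** b j)"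

definition orbit_relation ::
    "complex^4^4 \<Rightarrow> nat list \<Rightarrow> ((nat \<Rightarrow> complex^4^4) \<times> (nat \<Rightarrow> complex^4^4)) set" where
  "orbit_relation g ks = {(p, borel_action (length ks) p b) | p b.
     p \<in> parabolic_product g ks \<and> b \<in> (\<Pi>\<^sub>E j\<in>{..<length ks}. borel_opp g)}"

definition BSDH :: "complex^4^4 \<Rightarrow> nat list \<Rightarrow> (nat \<Rightarrow> complex^4^4) set function_space" where
  "BSDH g ks = quotient_space (subvariety (parabolic_product g ks)) (orbit_relation g ks)"

end

theory Submission
  imports Defs "HOL-Library.Sublist"
begin

text \<open>
  Write \<open>Z\<close> for the variety of the word and \<open>P\<close> for the product of minimal parabolics, of which \<open>Z\<close> is the
  quotient by a power of the Borel subgroup. On \<open>P\<close>, let \<open>X\<^sub>j\<close> be the left-invariant vector field of the root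
  vector of the \<open>j\<close>-th letter in the \<open>j\<close>-th factor. The polyvector \<open>X\<^sub>0 \<and> \<dots> \<and> X\<^sub>n\<^sub>-\<^sub>1\<close>, applied to functions
  pulled back from \<open>Z\<close>, is semi-invariant: a representative changed by \<open>b\<close> changes it by the product of the
  values of the simple roots of the letters at the components of \<open>b\<close> (lemma \<open>det_form_act\<close>). Multiplied by a
  function \<open>F\<close> on \<open>P\<close> of the inverse weight it becomes a section of the anti-canonical bundle of \<open>Z\<close>. The
  fibres of this bundle are at most one-dimensional, because every point has a system of \<open>n\<close> coordinates that span its
  cotangent space (\<open>fibre_eqI\<close>, \<open>derivation_eq_sum\<close>). So it suffices to find, for every point, such an \<open>F\<close> that
  does not vanish there (\<open>globally_generated_if_semi_invariants\<close>).
  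
  Such functions are products of minors. A simple root is twice its fundamental weight minus the adjacent ones. The
  fundamental weight of \<open>k\<close> at position \<open>j\<close> has enough semi-invariants, namely minors of the partial product
  of the first factors, and if \<open>k\<close> is not the \<open>j\<close>-th letter it can be moved to position \<open>j - 1\<close>, since its
  character then extends to an invertible function on the \<open>j\<close>-th factor. After all weights of \<open>k\<close> have been
  moved left to the nearest letter \<open>k\<close>, or to the left end, where they disappear, the exponent of the weight at such
  a letter is \<open>2\<close> minus the number of neighbours of \<open>k\<close> that occur before the next \<open>k\<close>
  (\<open>weight_nonvanishing_cartan\<close>). In a reduced word in \<open>s\<^sub>1, s\<^sub>2, s\<^sub>3\<close> there are at most two such neighbours
  (\<open>neighbours_before_le_2\<close>), as more of them would force a factor that can be shortened by the Coxeter
  relations. Hence all exponents are nonnegative.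
\<close>

section \<open>Four by four matrices\<close>

type_synonym mat4 = "complex^4^4"

text \<open>
  Root vectors of \<open>\<alpha>\<^sub>k\<close> live in row \<open>lo k\<close> and column \<open>hi k\<close>.
\<close>

abbreviation lo :: "nat \<Rightarrow> 4" where "lo k \<equiv> of_nat (k - 1)"
abbreviation hi :: "nat \<Rightarrow> 4" where "hi k \<equiv> of_nat k"

lemma four_eq_zero: "(4::4) = 0"
  by simp

lemma order_4:
  "(0::4) < 1" "(0::4) < 2" "(0::4) < 3" "(1::4) < 2" "(1::4) < 3" "(2::4) < 3"
  "\<not> (1::4) < 0" "\<not> (2::4) < 0" "\<not> (3::4) < 0" "\<not> (2::4) < 1" "\<not> (3::4) < 1" "\<not> (3::4) < 2"
  by (auto simp: less_bit0_def bit0.Rep_numeral bit0.Rep_1 bit0.Rep_0)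

lemma less_4_iff:
  "(a::4) < b \<longleftrightarrow> (a, b) \<in> {(0,1), (0,2), (0,3), (1,2), (1,3), (2,3)}"
  using exhaust_4[of a] exhaust_4[of b] unfolding four_eq_zero
  by (elim disjE) (simp_all add: order_4)

lemma all_4: "(\<forall>a::4. P a) \<longleftrightarrow> P 0 \<and> P 1 \<and> P 2 \<and> P 3"
  unfolding forall_4 four_eq_zero by blast

lemma sum_4': "sum f (UNIV::4 set) = f 0 + f 1 + f 2 + f 3"
  unfolding sum_4 four_eq_zero by (simp add: ac_simps)

lemma prod_4': "prod f (UNIV::4 set) = f 0 * f 1 * f 2 * f 3"
  unfolding UNIV_4 four_eq_zero by (simp add: ac_simps)

text \<open>
  Claims about a single simple root are settled by going through the three values of its index
  and, via \<open>all_4\<close> and \<open>sum_4'\<close>, through all matrix entries.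
\<close>

lemma lo_hi_cases:
  assumes "k \<in> {1,2,3}"
  obtains "k = 1" "lo k = 0" "hi k = 1" | "k = 2" "lo k = 1" "hi k = 2" | "k = 3" "lo k = 2" "hi k = 3"
  using assms by fastforce

lemma lo_less_hi: "k \<in> {1,2,3} \<Longrightarrow> lo k < hi k"
  by (erule lo_hi_cases) (simp_all add: order_4)

lemma hi_le_iff: "k \<in> {1,2,3} \<Longrightarrow> hi k \<le> a \<longleftrightarrow> lo k < a"
  using exhaust_4[of a] unfolding four_eq_zero
  by (elim lo_hi_cases disjE) (simp_all add: less_4_iff linorder_not_less[symmetric])

lemma le_lo_iff: "k \<in> {1,2,3} \<Longrightarrow> a \<le> lo k \<longleftrightarrow> a < hi k"
  using hi_le_iff[of k a] by (metis linorder_not_less)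

definition lower :: "mat4 \<Rightarrow> bool" where
  "lower A \<longleftrightarrow> (\<forall>a b. a < b \<longrightarrow> A $ a $ b = 0)"

text \<open>
  The matrix shape of the minimal parabolic subgroup of \<open>\<alpha>\<^sub>k\<close>: lower triangular except for one entry
  just above the diagonal.
\<close>

definition almost_lower :: "nat \<Rightarrow> mat4 \<Rightarrow> bool" where
  "almost_lower k A \<longleftrightarrow> (\<forall>a b. a < b \<and> \<not> (a = lo k \<and> b = hi k) \<longrightarrow> A $ a $ b = 0)"

lemma mult_nth: "((A::'a::semiring_1^'n^'m) ** B) $ a $ b = (\<Sum>c\<in>UNIV. A $ a $ c * B $ c $ b)"
  by (simp add: matrix_matrix_mult_def)

lemma mat_nth: "(mat x :: 'a::zero^'n^'n) $ a $ b = (if a = b then x else 0)"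
  by (simp add: mat_def)

lemma lower_mat: "lower (mat x)"
  by (auto simp: lower_def mat_nth)

lemma lower_mult:
  assumes "lower A" "lower B"
  shows "lower (A ** B)"
  unfolding lower_def mult_nth
proof (intro allI impI sum.neutral ballI)
  fix a b c :: 4 assume "a < b"
  then have "a < c \<or> c < b" by (meson le_less_trans linorder_not_less)
  then show "A $ a $ c * B $ c $ b = 0"
    using assms by (auto simp: lower_def)
qed

text \<open>
  Row by row: once the earlier rows of \<open>B\<close> are known to be lower triangular, row \<open>a\<close> of \<open>A ** B = 1\<close>
  only involves the diagonal entry of \<open>A\<close>, which the diagonal of the product shows to be invertible.
\<close>

lemma lower_right_inverse:
  assumes A: "lower A" and AB: "A ** B = mat 1"
  shows "lower B"
proof -
  have "\<forall>b>a. B $ a $ b = 0" for a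
  proof (induction a rule: less_induct)
    case (less a)
    have eq: "(A ** B) $ a $ b = A $ a $ a * B $ a $ b" if "a \<le> b" for b
    proof -
      have "A $ a $ c * B $ c $ b = 0" if "c \<noteq> a" for c
        using A less that \<open>a \<le> b\<close> by (auto simp: lower_def neq_iff)
      then have "(\<Sum>c\<in>UNIV. A $ a $ c * B $ c $ b) = (\<Sum>c\<in>{a}. A $ a $ c * B $ c $ b)"
        by (intro sum.mono_neutral_right) auto
      then show ?thesis by (simp add: mult_nth)
    qed
    have "A $ a $ a * B $ a $ a = 1"
      using eq[of a] by (simp add: AB mat_nth)
    then have "A $ a $ a \<noteq> 0" by auto
    moreover have "A $ a $ a * B $ a $ b = 0" if "a < b" for b
      using eq[OF less_imp_le[OF that]] less_imp_neq[OF that] by (simp add: AB mat_nth)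
    ultimately show ?case by simp
  qed
  then show ?thesis by (simp add: lower_def)
qed

lemma det_lower: "lower A \<Longrightarrow> det A = (\<Prod>a\<in>UNIV. A $ a $ a)"
  by (rule det_lowerdiagonal) (simp add: lower_def)

lemma lower_diag_nonzero: "lower A \<Longrightarrow> det A \<noteq> 0 \<Longrightarrow> A $ a $ a \<noteq> 0"
  by (auto simp: det_lower)

lemma lower_imp_almost_lower: "lower A \<Longrightarrow> almost_lower k A"
  by (simp add: lower_def almost_lower_def)

text \<open>
  There is no index strictly between \<open>lo k\<close> and \<open>hi k\<close>, so on the way from row \<open>a\<close> to column \<open>b\<close> every
  intermediate index \<open>c\<close> meets a vanishing entry unless the pair is \<open>(lo k, hi k)\<close>.
\<close>

lemma almost_lower_mult:
  assumes k: "k \<in> {1,2,3}" and AB: "almost_lower k A" "almost_lower k B"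
  shows "almost_lower k (A ** B)"
  unfolding almost_lower_def mult_nth
proof (intro allI impI sum.neutral ballI)
  fix a b c :: 4 assume ab: "a < b \<and> \<not> (a = lo k \<and> b = hi k)"
  have "(a < c \<and> \<not> (a = lo k \<and> c = hi k)) \<or> (c < b \<and> \<not> (c = lo k \<and> b = hi k))"
  proof (cases "a < c")
    case True
    have "c < b" if "a = lo k" "c = hi k"
      using that ab hi_le_iff[OF k, of b] by (metis order_less_le)
    then show ?thesis
      using True lo_less_hi[OF k] by auto
  next
    case False
    then have "c < b" using ab by auto
    moreover have "a = lo k" if "c = lo k" "b = hi k"
      using that ab False le_lo_iff[OF k, of a] by auto
    ultimately show ?thesis using ab by blast
  qed
  then show "A $ a $ c * B $ c $ b = 0"
    using AB by (auto simp: almost_lower_def)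
qed

definition unip :: "nat \<Rightarrow> complex \<Rightarrow> mat4" where
  "unip k t = (\<chi> a b. if a = b then 1 else if a = lo k \<and> b = hi k then t else 0)"

definition lower_unip :: "nat \<Rightarrow> complex \<Rightarrow> mat4" where
  "lower_unip k t = transpose (unip k t)"

lemma unip_nth: "unip k t $ a $ b = (if a = b then 1 else if a = lo k \<and> b = hi k then t else 0)"
  by (simp add: unip_def)

lemma unip_zero [simp]: "unip k 0 = mat 1"
  by (simp add: vec_eq_iff unip_nth mat_nth)

lemma unip_mult:
  assumes "k \<in> {1,2,3}"
  shows "unip k s ** unip k t = unip k (s + t)"
  using assms by (elim lo_hi_cases) (simp_all add: vec_eq_iff all_4 mult_nth sum_4' unip_nth)

lemma almost_lower_unip: "almost_lower k (unip k t)"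
  by (auto simp: almost_lower_def unip_nth)

lemma det_unip:
  assumes "k \<in> {1,2,3}"
  shows "det (unip k t) = 1"
proof -
  have "det (unip k t) = (\<Prod>a\<in>UNIV. unip k t $ a $ a)"
    using lo_less_hi[OF assms] by (intro det_upperdiagonal) (auto simp: unip_nth)
  then show ?thesis by (simp add: unip_nth)
qed

lemma det_lower_unip: "k \<in> {1,2,3} \<Longrightarrow> det (lower_unip k t) = 1"
  by (simp add: lower_unip_def det_transpose det_unip)

lemma lower_lower_unip: "k \<in> {1,2,3} \<Longrightarrow> lower (lower_unip k t)"
  using lo_less_hi[of k] by (auto simp: lower_def lower_unip_def transpose_def unip_nth)

text \<open>
  The usual factorisation in \<open>SL\<^sub>2\<close>; it yields the determinant, the shape and the inverse of the
  reflection matrix without touching its entries again.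
\<close>

lemma swap_matrix_eq:
  assumes "k \<in> {1,2,3}"
  shows "swap_matrix k = unip k 1 ** lower_unip k (- 1) ** unip k 1"
  using assms
  by (elim lo_hi_cases)
    (simp_all add: vec_eq_iff all_4 mult_nth sum_4' unip_nth lower_unip_def transpose_def swap_matrix_def)

lemma det_swap_matrix: "k \<in> {1,2,3} \<Longrightarrow> det (swap_matrix k) = 1"
  by (simp add: swap_matrix_eq det_mul det_unip det_lower_unip)

lemma almost_lower_swap_matrix:
  assumes "k \<in> {1,2,3}"
  shows "almost_lower k (swap_matrix k)"
  unfolding swap_matrix_eq[OF assms]
  by (intro almost_lower_mult[OF assms] almost_lower_unip lower_imp_almost_lower lower_lower_unip[OF assms])

text \<open>
  The reflection carries the negative root subgroup to the positive one. This places the positive root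
  subgroup inside the minimal parabolic, whose generators only contain the negative one.
\<close>

lemma unip_swap_matrix:
  assumes "k \<in> {1,2,3}"
  shows "unip k t ** swap_matrix k = swap_matrix k ** lower_unip k (- t)"
  using assms
  by (elim lo_hi_cases)
    (simp_all add: vec_eq_iff all_4 mult_nth sum_4' unip_nth lower_unip_def transpose_def swap_matrix_def)

section \<open>Reduced words in the Weyl group\<close>

lemma SL4_inverse:
  assumes "g \<in> carrier SL4"
  shows "g ** matrix_inv g = mat 1" "matrix_inv g ** g = mat 1" "det (matrix_inv g) = 1"
proof -
  have "det g = 1" using assms by (simp add: SL4_def)
  then have "invertible g" by (simp add: invertible_det_nz)
  then show *: "g ** matrix_inv g = mat 1" "matrix_inv g ** g = mat 1"
    unfolding invertible_def matrix_inv_def by (auto dest!: someI_ex)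
  have "det (g ** matrix_inv g) = 1" unfolding * by simp
  then show "det (matrix_inv g) = 1"
    by (simp add: det_mul \<open>det g = 1\<close>)
qed

lemma conjugate_mult:
  assumes "g \<in> carrier SL4"
  shows "(g ** A ** matrix_inv g) ** (g ** B ** matrix_inv g) = g ** (A ** B) ** matrix_inv g"
proof -
  have "(g ** A ** matrix_inv g) ** (g ** B ** matrix_inv g) =
      g ** A ** (matrix_inv g ** g) ** B ** matrix_inv g"
    by (simp only: matrix_mul_assoc)
  then show ?thesis
    by (simp add: SL4_inverse[OF assms] matrix_mul_assoc)
qed

lemma conjugate_set_mult:
  fixes X Y :: "'a \<Rightarrow> mat4"
  assumes "g \<in> carrier SL4"
  shows "{g ** X D ** matrix_inv g | D. P D} <#>\<^bsub>SL4\<^esub> {g ** Y D ** matrix_inv g | D. P D} =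
    {g ** (X D1 ** Y D2) ** matrix_inv g | D1 D2. P D1 \<and> P D2}"
proof -
  have "x \<otimes>\<^bsub>SL4\<^esub> y = x ** y" for x y :: mat4
    by (simp add: SL4_def)
  then show ?thesis
    unfolding set_mult_def conjugate_mult[OF assms, symmetric] by auto
qed

definition diagonal :: "mat4 \<Rightarrow> bool" where
  "diagonal A \<longleftrightarrow> (\<forall>a b. a \<noteq> b \<longrightarrow> A $ a $ b = 0)"

lemma diagonal_iff: "diagonal A \<longleftrightarrow> lower A \<and> lower (transpose A)"
  by (auto simp: diagonal_def lower_def transpose_def neq_iff)

lemma diagonal_mult: "diagonal A \<Longrightarrow> diagonal B \<Longrightarrow> diagonal (A ** B)"
  by (simp add: diagonal_iff lower_mult matrix_transpose_mul)

lemma diagonal_mat: "diagonal (mat x)"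
  by (simp add: diagonal_def mat_nth)

lemma torus_eq: "torus g = {g ** A ** matrix_inv g | A. diagonal A \<and> det A = 1}"
  by (auto simp: torus_def conjugate_def SL4_def diagonal_def)

text \<open>
  The reflection matrices normalise the torus, so that torus elements can be collected on the left of
  a product of reflection matrices.
\<close>

lemma swap_matrix_diagonal:
  assumes k: "k \<in> {1,2,3}" and D: "diagonal D" "det D = 1"
  obtains D' where "diagonal D'" "det D' = 1" "swap_matrix k ** D = D' ** swap_matrix k"
proof -
  define D' :: mat4 where "D' = (\<chi> a b. if a \<noteq> b then 0
    else if a = lo k then D $ hi k $ hi k else if a = hi k then D $ lo k $ lo k else D $ a $ a)"
  have eq: "swap_matrix k ** D = D' ** swap_matrix k"
    using k D(1)
    by (elim lo_hi_cases)
      (simp_all add: vec_eq_iff all_4 mult_nth sum_4' diagonal_def D'_def swap_matrix_def)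
  have "diagonal D'"
    by (simp add: diagonal_def D'_def)
  moreover have "det D' = 1"
    using arg_cong[OF eq, of det] D(2) by (simp add: det_mul det_swap_matrix[OF k])
  ultimately show ?thesis using eq that by blast
qed

definition word_matrix :: "nat list \<Rightarrow> mat4" where
  "word_matrix ks = foldr (\<lambda>k M. swap_matrix k ** M) ks (mat 1)"

lemma word_matrix_simps [simp]:
  "word_matrix [] = mat 1" "word_matrix (k # ks) = swap_matrix k ** word_matrix ks"
  by (simp_all add: word_matrix_def)

lemma word_matrix_append: "word_matrix (ks @ ls) = word_matrix ks ** word_matrix ls"
  by (induction ks) (simp_all add: matrix_mul_assoc)

lemma word_matrix_diagonal:
  assumes "set ks \<subseteq> {1,2,3}" "diagonal D" "det D = 1"
  obtains D' where "diagonal D'" "det D' = 1" "word_matrix ks ** D = D' ** word_matrix ks"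
  using assms
proof (induction ks arbitrary: thesis)
  case Nil
  then show ?case by (metis word_matrix_simps(1) matrix_mul_lid matrix_mul_rid)
next
  case (Cons k ks)
  obtain D1 where D1: "diagonal D1" "det D1 = 1" "word_matrix ks ** D = D1 ** word_matrix ks"
    using Cons.IH Cons.prems by auto
  obtain D2 where D2: "diagonal D2" "det D2 = 1" "swap_matrix k ** D1 = D2 ** swap_matrix k"
    using swap_matrix_diagonal[OF _ D1(1,2)] Cons.prems(2) by (metis insert_subset list.simps(15))
  have "word_matrix (k # ks) ** D = D2 ** word_matrix (k # ks)"
    by (metis D1(3) D2(3) word_matrix_simps(2) matrix_mul_assoc)
  then show ?case using Cons.prems(1) D2 by blast
qed

lemma simple_reflection_eq:
  assumes g: "g \<in> carrier SL4"
  shows "simple_reflection g k =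
    {g ** (D ** swap_matrix k) ** matrix_inv g | D. diagonal D \<and> det D = 1}"
  by (auto simp: simple_reflection_def r_coset_def torus_eq SL4_def conjugate_mult[OF g])

text \<open>
  The group operation on cosets becomes the multiplication of matrices, up to the torus.
\<close>

lemma weyl_word_eq:
  assumes g: "g \<in> carrier SL4" and ks: "set ks \<subseteq> {1,2,3}"
  shows "weyl_word g ks =
    {g ** (D ** word_matrix ks) ** matrix_inv g | D. diagonal D \<and> det D = 1}"
  using ks
proof (induction ks)
  case Nil
  then show ?case
    by (simp add: weyl_word_def weyl_group_def FactGroup_def torus_eq)
next
  case (Cons k ks)
  then have k: "k \<in> {1,2,3}" by simp
  let ?c = "\<lambda>A. g ** A ** matrix_inv g"
  note refl = simple_reflection_eq[OF g, of k]
  have "weyl_word g (k # ks) = simple_reflection g k <#>\<^bsub>SL4\<^esub> weyl_word g ks"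
    by (simp add: weyl_word_def weyl_group_def FactGroup_def set_mult_def)
  also have "\<dots> = {?c (D1 ** swap_matrix k ** (D2 ** word_matrix ks)) | D1 D2.
      (diagonal D1 \<and> det D1 = 1) \<and> (diagonal D2 \<and> det D2 = 1)}"
    using Cons.IH Cons.prems unfolding refl by (simp add: conjugate_set_mult[OF g])
  also have "\<dots> = {?c (D ** word_matrix (k # ks)) | D. diagonal D \<and> det D = 1}"
  proof (intro subset_antisym subsetI)
    fix x assume "x \<in> {?c (D1 ** swap_matrix k ** (D2 ** word_matrix ks)) | D1 D2.
      (diagonal D1 \<and> det D1 = 1) \<and> (diagonal D2 \<and> det D2 = 1)}"
    then obtain D1 D2 where D: "diagonal D1" "det D1 = 1" "diagonal D2" "det D2 = 1"
      and x: "x = ?c (D1 ** swap_matrix k ** (D2 ** word_matrix ks))" by blast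
    obtain D3 where D3: "diagonal D3" "det D3 = 1" "swap_matrix k ** D2 = D3 ** swap_matrix k"
      using swap_matrix_diagonal[OF k D(3,4)] by blast
    have "D1 ** swap_matrix k ** (D2 ** word_matrix ks) = (D1 ** D3) ** word_matrix (k # ks)"
      by (metis D3(3) matrix_mul_assoc word_matrix_simps(2))
    then show "x \<in> {?c (D ** word_matrix (k # ks)) | D. diagonal D \<and> det D = 1}"
      using D D3 x diagonal_mult[of D1 D3] by (auto simp: det_mul)
  next
    fix x assume "x \<in> {?c (D ** word_matrix (k # ks)) | D. diagonal D \<and> det D = 1}"
    then obtain D where "diagonal D" "det D = 1"
      "x = ?c (D ** swap_matrix k ** (mat 1 ** word_matrix ks))"
      by (auto simp: matrix_mul_assoc)
    then show "x \<in> {?c (D1 ** swap_matrix k ** (D2 ** word_matrix ks)) | D1 D2.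
      (diagonal D1 \<and> det D1 = 1) \<and> (diagonal D2 \<and> det D2 = 1)}"
      using diagonal_mat[of 1] det_I by blast
  qed
  finally show ?case .
qed

text \<open>
  If a factor of a word has the same matrix as another word up to the torus, replacing it leaves the Weyl
  group element unchanged. A reduced expression therefore has no factor that can be replaced by a
  shorter word.
\<close>

lemma reduced_expression_factor_length:
  assumes g: "g \<in> carrier SL4" and red: "reduced_expression g (as @ u @ bs) w"
    and v: "set v \<subseteq> {1,2,3}" and D: "diagonal D" "det D = 1" "word_matrix u = D ** word_matrix v"
  shows "length u \<le> length v"
proof -
  have set: "set (as @ u @ bs) \<subseteq> {1,2,3}" and w: "w = weyl_word g (as @ u @ bs)"
    and len: "length (as @ u @ bs) = weyl_length g w"
    using red by (auto simp: reduced_expression_def)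
  then have set': "set (as @ v @ bs) \<subseteq> {1,2,3}" using v by auto
  \<comment> \<open>The torus element met in the middle of the word is carried to its left end.\<close>
  obtain D' where D': "diagonal D'" "det D' = 1" "word_matrix as ** D = D' ** word_matrix as"
    using word_matrix_diagonal[OF _ D(1,2)] set by (metis set_append Un_subset_iff)
  have eq: "word_matrix (as @ u @ bs) = D' ** word_matrix (as @ v @ bs)"
    by (metis word_matrix_append matrix_mul_assoc D(3) D'(3))
  have "w \<subseteq> weyl_word g (as @ v @ bs)"
  proof
    fix x assume "x \<in> w"
    then obtain E where E: "diagonal E" "det E = 1"
      "x = g ** (E ** word_matrix (as @ u @ bs)) ** matrix_inv g"
      using weyl_word_eq[OF g set] w by auto
    then have "x = g ** ((E ** D') ** word_matrix (as @ v @ bs)) ** matrix_inv g"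
      by (simp add: eq matrix_mul_assoc)
    moreover have "diagonal (E ** D')" "det (E ** D') = 1"
      using E D' by (simp_all add: diagonal_mult det_mul)
    ultimately show "x \<in> weyl_word g (as @ v @ bs)"
      using weyl_word_eq[OF g set'] by blast
  qed
  moreover have "weyl_word g (as @ v @ bs) \<subseteq> w"
  proof
    define D'' where "D'' = matrix_inv D'"
    have inv: "D'' ** D' = mat 1" "D' ** D'' = mat 1" "det D'' = 1"
      using SL4_inverse[of D'] D' by (auto simp: D''_def SL4_def)
    have "diagonal D''"
      using inv D'(1) lower_right_inverse[of D' D''] lower_right_inverse[of "transpose D'" "transpose D''"]
      by (simp add: diagonal_iff matrix_transpose_mul[symmetric] transpose_mat)
    fix x assume "x \<in> weyl_word g (as @ v @ bs)"
    then obtain E where E: "diagonal E" "det E = 1"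
      "x = g ** (E ** word_matrix (as @ v @ bs)) ** matrix_inv g"
      using weyl_word_eq[OF g set'] by auto
    have "(E ** D'') ** word_matrix (as @ u @ bs) = E ** (D'' ** D') ** word_matrix (as @ v @ bs)"
      by (simp only: eq matrix_mul_assoc)
    then have "x = g ** ((E ** D'') ** word_matrix (as @ u @ bs)) ** matrix_inv g"
      using E(3) inv by simp
    moreover have "diagonal (E ** D'')" "det (E ** D'') = 1"
      using E inv \<open>diagonal D''\<close> by (simp_all add: diagonal_mult det_mul)
    ultimately show "x \<in> w"
      using weyl_word_eq[OF g set] w by blast
  qed
  ultimately have "weyl_word g (as @ v @ bs) = w" by blast
  then have "weyl_length g w \<le> length (as @ v @ bs)"
    unfolding weyl_length_def using set' by (intro Least_le) blast
  then show ?thesis using len by simp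
qed

definition sign_matrix :: "complex \<Rightarrow> complex \<Rightarrow> complex \<Rightarrow> complex \<Rightarrow> mat4" where
  "sign_matrix s t u v = (\<chi> a b. if a \<noteq> b then 0 else if a = 0 then s else if a = 1 then t
     else if a = 2 then u else v)"

lemma sign_matrix: "diagonal (sign_matrix s t u v)" "det (sign_matrix s t u v) = s * t * u * v"
  by (simp_all add: diagonal_def sign_matrix_def det_diagonal prod_4')

text \<open>
  Instances of \<open>s\<^sub>k\<^sup>2 = 1\<close>, of \<open>s\<^sub>1 s\<^sub>3 = s\<^sub>3 s\<^sub>1\<close> and of the braid relations. For the chosen
  representatives they hold up to a sign matrix, which lies in the torus.
\<close>

lemma word_matrix_relations:
  "word_matrix [1,1] = sign_matrix (-1) (-1) 1 1 ** word_matrix []"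
  "word_matrix [2,2] = sign_matrix 1 (-1) (-1) 1 ** word_matrix []"
  "word_matrix [3,3] = sign_matrix 1 1 (-1) (-1) ** word_matrix []"
  "word_matrix [1,3,1] = sign_matrix (-1) (-1) 1 1 ** word_matrix [3]"
  "word_matrix [3,1,3] = sign_matrix 1 1 (-1) (-1) ** word_matrix [1]"
  "word_matrix [2,3,2,3,2] = sign_matrix 1 1 (-1) (-1) ** word_matrix [3]"
  "word_matrix [2,1,2,1,2] = sign_matrix (-1) (-1) 1 1 ** word_matrix [1]"
  by (simp_all add: vec_eq_iff all_4 mult_nth sum_4' swap_matrix_def sign_matrix_def mat_nth)

text \<open>
  By the relations above, each of these patterns is equivalent to a shorter word.
\<close>

lemma reduced_expression_avoids:
  assumes g: "g \<in> carrier SL4" and red: "reduced_expression g ks w"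
    and u: "u \<in> {[1,1], [2,2], [3,3], [1,3,1], [3,1,3], [2,3,2,3,2], [2,1,2,1,2]}"
  shows "\<not> sublist u ks"
proof
  assume "sublist u ks"
  then obtain as bs where ks: "ks = as @ u @ bs"
    by (auto simp: sublist_def)
  obtain D v where "diagonal D" "det D = 1" "set v \<subseteq> {1,2,3}" "word_matrix u = D ** word_matrix v"
    and "length v < length u"
  proof -
    have "\<exists>D v. diagonal D \<and> det D = 1 \<and> set v \<subseteq> {1,2,3} \<and> word_matrix u = D ** word_matrix v \<and>
      length v < length u"
      using u
      apply (elim insertE emptyE)
      subgoal by (rule exI[of _ "sign_matrix (-1) (-1) 1 1"], rule exI[of _ "[]"])
          (simp only: sign_matrix word_matrix_relations, simp)
      subgoal by (rule exI[of _ "sign_matrix 1 (-1) (-1) 1"], rule exI[of _ "[]"])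
          (simp only: sign_matrix word_matrix_relations, simp)
      subgoal by (rule exI[of _ "sign_matrix 1 1 (-1) (-1)"], rule exI[of _ "[]"])
          (simp only: sign_matrix word_matrix_relations, simp)
      subgoal by (rule exI[of _ "sign_matrix (-1) (-1) 1 1"], rule exI[of _ "[3]"])
          (simp only: sign_matrix word_matrix_relations, simp)
      subgoal by (rule exI[of _ "sign_matrix 1 1 (-1) (-1)"], rule exI[of _ "[1]"])
          (simp only: sign_matrix word_matrix_relations, simp)
      subgoal by (rule exI[of _ "sign_matrix 1 1 (-1) (-1)"], rule exI[of _ "[3]"])
          (simp only: sign_matrix word_matrix_relations, simp)
      subgoal by (rule exI[of _ "sign_matrix (-1) (-1) 1 1"], rule exI[of _ "[1]"])
          (simp only: sign_matrix word_matrix_relations, simp)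
      done
    then show ?thesis using that by blast
  qed
  then show False
    using reduced_expression_factor_length[OF g, of as u bs w v D] red ks by simp
qed

text \<open>
  The number of letters adjacent to \<open>k\<close> in the Dynkin diagram that precede the next occurrence of \<open>k\<close>.
  Two minus this number, for the suffix behind a position with letter \<open>k\<close>, is the degree in which the
  fundamental weight of \<open>k\<close> at this position enters the anti-canonical weight.
\<close>

fun neighbours_before :: "nat \<Rightarrow> nat list \<Rightarrow> nat" where
  "neighbours_before k [] = 0"
| "neighbours_before k (x # xs) =
    (if x = k then 0 else (if k = x + 1 \<or> x = k + 1 then 1 else 0) + neighbours_before k xs)"

text \<open>
  Up to the next \<open>2\<close>, the letters \<open>1\<close> and \<open>3\<close> cannot occur more than once each. Up to the next \<open>1\<close>
  (or \<open>3\<close>), the remaining two letters alternate, and three occurrences of \<open>2\<close> would produce one of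
  the patterns of length five.
\<close>

lemma neighbours_before_le_2:
  assumes "set xs \<subseteq> {1,2,3}" "k \<in> {1,2,3}"
    and "\<And>u. u \<in> {[1,1], [2,2], [3,3], [1,3,1], [3,1,3], [2,3,2,3,2], [2,1,2,1,2]} \<Longrightarrow> \<not> sublist u xs"
  shows "neighbours_before k xs \<le> 2"
proof -
  have "\<not> sublist [1,1] xs" "\<not> sublist [2,2] xs" "\<not> sublist [3,3] xs" "\<not> sublist [1,3,1] xs"
    "\<not> sublist [3,1,3] xs" "\<not> sublist [2,3,2,3,2] xs" "\<not> sublist [2,1,2,1,2] xs"
    using assms(3) by simp_all
  then show ?thesis
    using assms(1,2)
    \<comment> \<open>Letters are split off one at a time; after at most six of them the avoided patterns decide.\<close>
    apply (elim insertE emptyE; cases xs; clarsimp simp: sublist_Cons_right; elim disjE; clarsimp)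
    apply (((rename_tac ys; case_tac ys; clarsimp simp: sublist_Cons_right);
        (elim disjE)?; clarsimp?)+)
    done
qed

section \<open>Regular functions and their derivatives\<close>

lemma polynomials_sum:
  assumes "\<And>a. a \<in> A \<Longrightarrow> f a \<in> polynomials"
  shows "(\<lambda>p. \<Sum>a\<in>A. f a p) \<in> polynomials"
  using assms
proof (induction A rule: infinite_finite_induct)
  case (insert a A)
  then show ?case using polynomials.add[of "f a"] by simp
qed (simp_all add: polynomials.const)

lemma polynomials_prod:
  assumes "\<And>a. a \<in> A \<Longrightarrow> f a \<in> polynomials"
  shows "(\<lambda>p. \<Prod>a\<in>A. f a p) \<in> polynomials"
  using assms
proof (induction A rule: infinite_finite_induct)
  case (insert a A)
  then show ?case using polynomials.mult[of "f a"] by simp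
qed (simp_all add: polynomials.const)

lemma polynomials_diff:
  assumes "f \<in> polynomials" "h \<in> polynomials"
  shows "(\<lambda>p. f p - h p) \<in> polynomials"
  using polynomials.add[OF assms(1) polynomials.mult[OF polynomials.const[of "- 1"] assms(2)]]
  by simp

lemma openin_zariski_basic:
  assumes "openin zariski U" "p \<in> U"
  obtains f where "f \<in> polynomials" "f p \<noteq> 0" "{q. f q \<noteq> 0} \<subseteq> U"
proof -
  have "generate_topology_on {{p. f p \<noteq> 0} | f. f \<in> polynomials} U"
    using assms(1) by (simp add: zariski_def openin_topology_generated_by_iff)
  then have "\<exists>f\<in>polynomials. f p \<noteq> 0 \<and> {q. f q \<noteq> 0} \<subseteq> U"
    using assms(2)
  proof (induction arbitrary: p)
    case (Int a b)
    obtain f where f: "f \<in> polynomials" "f p \<noteq> 0" "{q. f q \<noteq> 0} \<subseteq> a"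
      using Int.IH(1)[of p] Int.prems by blast
    obtain h where h: "h \<in> polynomials" "h p \<noteq> 0" "{q. h q \<noteq> 0} \<subseteq> b"
      using Int.IH(2)[of p] Int.prems by blast
    have "(\<lambda>q. f q * h q) \<in> polynomials"
      using f(1) h(1) by (rule polynomials.mult)
    then show ?case
      using f(2,3) h(2,3) by (intro bexI[of _ "\<lambda>q. f q * h q"]) auto
  next
    case (UN K)
    then obtain k where k: "k \<in> K" "p \<in> k" by blast
    show ?case using UN.IH[OF k] k(1) by blast
  qed auto
  then show ?thesis using that by blast
qed

lemma openin_zariski_nonzero: "f \<in> polynomials \<Longrightarrow> openin zariski {p. f p \<noteq> 0}"
  unfolding zariski_def by (intro topology_generated_by_Basis) auto

lemma topspace_zariski [simp]: "topspace zariski = UNIV"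
  using openin_subset[OF openin_zariski_nonzero[OF polynomials.const[of 1]]]
  by (intro subset_antisym) auto

lemma openin_subvariety_iff:
  "openin (topo (subvariety X)) V \<longleftrightarrow>
     V \<subseteq> X \<and> (\<forall>x\<in>V. \<exists>h\<in>polynomials. h x \<noteq> 0 \<and> (\<forall>y\<in>X. h y \<noteq> 0 \<longrightarrow> y \<in> V))"
proof
  assume "openin (topo (subvariety X)) V"
  then obtain T where T: "openin zariski T" "V = T \<inter> X"
    by (auto simp: subvariety_def openin_subtopology)
  show "V \<subseteq> X \<and> (\<forall>x\<in>V. \<exists>h\<in>polynomials. h x \<noteq> 0 \<and> (\<forall>y\<in>X. h y \<noteq> 0 \<longrightarrow> y \<in> V))"
  proof (intro conjI ballI)
    fix x assume "x \<in> V"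
    then obtain f where "f \<in> polynomials" "f x \<noteq> 0" "{q. f q \<noteq> 0} \<subseteq> T"
      using openin_zariski_basic[OF T(1), of x] T(2) by blast
    then show "\<exists>h\<in>polynomials. h x \<noteq> 0 \<and> (\<forall>y\<in>X. h y \<noteq> 0 \<longrightarrow> y \<in> V)"
      using T(2) by blast
  qed (use T in auto)
next
  assume *: "V \<subseteq> X \<and> (\<forall>x\<in>V. \<exists>h\<in>polynomials. h x \<noteq> 0 \<and> (\<forall>y\<in>X. h y \<noteq> 0 \<longrightarrow> y \<in> V))"
  show "openin (topo (subvariety X)) V"
  proof (subst openin_subopen, intro ballI)
    fix x assume "x \<in> V"
    then obtain h where "h \<in> polynomials" "h x \<noteq> 0" "\<forall>y\<in>X. h y \<noteq> 0 \<longrightarrow> y \<in> V"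
      using * by blast
    then show "\<exists>T. openin (topo (subvariety X)) T \<and> x \<in> T \<and> T \<subseteq> V"
      using * \<open>x \<in> V\<close> openin_zariski_nonzero[of h]
      by (intro exI[of _ "{p. h p \<noteq> 0} \<inter> X"])
        (auto simp: subvariety_def openin_subtopology)
  qed
qed

lemma topspace_subvariety [simp]: "topspace (topo (subvariety X)) = X"
  by (simp add: subvariety_def)

text \<open>
  Multiplying numerator and denominator by a function that cuts out a small neighbourhood, the
  denominator alone can be made to delimit the domain of the fraction. All closure properties of regular
  functions are read off from this form.
\<close>

lemma regular_subvariety_iff:
  assumes "V \<subseteq> X"
  shows "\<phi> \<in> regular (subvariety X) V \<longleftrightarrow>
    (\<forall>x\<in>V. \<exists>f\<in>polynomials. \<exists>h\<in>polynomials. h x \<noteq> 0 \<and>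
      (\<forall>y\<in>X. h y \<noteq> 0 \<longrightarrow> y \<in> V \<and> \<phi> y = f y / h y))"
proof -
  have "(\<exists>W. openin (subtopology zariski X) W \<and> x \<in> W \<and> W \<subseteq> V \<and>
        (\<exists>f\<in>polynomials. \<exists>h\<in>polynomials. \<forall>y\<in>W. h y \<noteq> 0 \<and> \<phi> y = f y / h y)) \<longleftrightarrow>
      (\<exists>f\<in>polynomials. \<exists>h\<in>polynomials. h x \<noteq> 0 \<and>
        (\<forall>y\<in>X. h y \<noteq> 0 \<longrightarrow> y \<in> V \<and> \<phi> y = f y / h y))" (is "?L \<longleftrightarrow> ?R") if "x \<in> V" for x
  proof
    assume ?L
    then obtain W f h where W: "openin (topo (subvariety X)) W" "x \<in> W" "W \<subseteq> V"
      and fh: "f \<in> polynomials" "h \<in> polynomials" "\<forall>y\<in>W. h y \<noteq> 0 \<and> \<phi> y = f y / h y"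
      by (auto simp: subvariety_def)
    obtain q where q: "q \<in> polynomials" "q x \<noteq> 0" "\<forall>y\<in>X. q y \<noteq> 0 \<longrightarrow> y \<in> W"
      using W by (auto simp: openin_subvariety_iff)
    show ?R
      using q fh W
      by (intro bexI[of _ "\<lambda>y. f y * q y"] bexI[of _ "\<lambda>y. h y * q y"])
        (auto simp: polynomials.add polynomials.mult polynomials.const)
  next
    assume ?R
    then obtain f h where fh: "f \<in> polynomials" "h \<in> polynomials" "h x \<noteq> 0"
      "\<forall>y\<in>X. h y \<noteq> 0 \<longrightarrow> y \<in> V \<and> \<phi> y = f y / h y" by blast
    have "openin (subtopology zariski X) ({y. h y \<noteq> 0} \<inter> X)"
      using openin_zariski_nonzero[OF fh(2)] by (auto simp: openin_subtopology)
    moreover have "x \<in> {y. h y \<noteq> 0} \<inter> X" "{y. h y \<noteq> 0} \<inter> X \<subseteq> V"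
      "\<forall>y\<in>{y. h y \<noteq> 0} \<inter> X. h y \<noteq> 0 \<and> \<phi> y = f y / h y"
      using fh that assms by auto
    ultimately show ?L using fh by blast
  qed
  then show ?thesis by (simp add: subvariety_def)
qed

lemma regular_subvarietyE:
  assumes "\<phi> \<in> regular (subvariety X) V" "V \<subseteq> X" "x \<in> V"
  obtains f h where "f \<in> polynomials" "h \<in> polynomials" "h x \<noteq> 0"
    "\<And>y. y \<in> X \<Longrightarrow> h y \<noteq> 0 \<Longrightarrow> y \<in> V \<and> \<phi> y = f y / h y"
  using assms by (auto simp: regular_subvariety_iff)

lemma regular_cong:
  assumes "\<And>y. y \<in> V \<Longrightarrow> \<phi> y = \<psi> y" "\<phi> \<in> regular (subvariety X) V"
  shows "\<psi> \<in> regular (subvariety X) V"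
proof -
  have "\<exists>W. openin (subtopology zariski X) W \<and> x \<in> W \<and> W \<subseteq> V \<and>
      (\<exists>f\<in>polynomials. \<exists>h\<in>polynomials. \<forall>y\<in>W. h y \<noteq> 0 \<and> \<psi> y = f y / h y)" if x: "x \<in> V" for x
  proof -
    obtain W f h where "openin (subtopology zariski X) W" "x \<in> W" and W: "W \<subseteq> V"
      and "f \<in> polynomials" "h \<in> polynomials" and eq: "\<forall>y\<in>W. h y \<noteq> 0 \<and> \<phi> y = f y / h y"
      using assms(2) x by (auto simp: subvariety_def)
    moreover have "\<forall>y\<in>W. h y \<noteq> 0 \<and> \<psi> y = f y / h y"
      using eq W assms(1) by (metis subsetD)
    ultimately show ?thesis by blast
  qed
  then show ?thesis by (simp add: subvariety_def)
qed

lemma regular_restrict: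
  assumes "\<phi> \<in> regular (subvariety X) V" "openin (topo (subvariety X)) V'" "V' \<subseteq> V" "V \<subseteq> X"
  shows "\<phi> \<in> regular (subvariety X) V'"
proof -
  have V': "V' \<subseteq> X" using assms by blast
  show ?thesis
    unfolding regular_subvariety_iff[OF V']
  proof
    fix x assume x: "x \<in> V'"
    then obtain f h where fh: "f \<in> polynomials" "h \<in> polynomials" "h x \<noteq> 0"
      "\<And>y. y \<in> X \<Longrightarrow> h y \<noteq> 0 \<Longrightarrow> y \<in> V \<and> \<phi> y = f y / h y"
      using regular_subvarietyE[OF assms(1,4)] assms(3) by blast
    obtain q where q: "q \<in> polynomials" "q x \<noteq> 0" "\<forall>y\<in>X. q y \<noteq> 0 \<longrightarrow> y \<in> V'"
      using assms(2) x by (auto simp: openin_subvariety_iff)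
    show "\<exists>f\<in>polynomials. \<exists>h\<in>polynomials. h x \<noteq> 0 \<and>
        (\<forall>y\<in>X. h y \<noteq> 0 \<longrightarrow> y \<in> V' \<and> \<phi> y = f y / h y)"
      using fh q
      by (intro bexI[of _ "\<lambda>y. f y * q y"] bexI[of _ "\<lambda>y. h y * q y"])
        (auto simp: polynomials.add polynomials.mult polynomials.const)
  qed
qed

lemma regular_polynomial:
  assumes V: "openin (topo (subvariety X)) V" and f: "f \<in> polynomials"
  shows "f \<in> regular (subvariety X) V"
proof -
  have VX: "V \<subseteq> X" using V by (simp add: openin_subvariety_iff)
  show ?thesis
    unfolding regular_subvariety_iff[OF VX]
  proof
    fix x assume x: "x \<in> V"
    obtain q where q: "q \<in> polynomials" "q x \<noteq> 0" "\<forall>y\<in>X. q y \<noteq> 0 \<longrightarrow> y \<in> V"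
      using V x by (auto simp: openin_subvariety_iff)
    show "\<exists>f'\<in>polynomials. \<exists>h\<in>polynomials. h x \<noteq> 0 \<and>
        (\<forall>y\<in>X. h y \<noteq> 0 \<longrightarrow> y \<in> V \<and> f y = f' y / h y)"
      using f q
      by (intro bexI[of _ "\<lambda>y. f y * q y"] bexI[of _ q]) (auto simp: polynomials.add polynomials.mult polynomials.const)
  qed
qed

lemma regular_add:
  assumes "\<phi> \<in> regular (subvariety X) V" "\<psi> \<in> regular (subvariety X) V" "V \<subseteq> X"
  shows "(\<lambda>p. \<phi> p + \<psi> p) \<in> regular (subvariety X) V"
  unfolding regular_subvariety_iff[OF assms(3)]
proof
  fix x assume x: "x \<in> V"
  obtain f h where fh: "f \<in> polynomials" "h \<in> polynomials" "h x \<noteq> 0"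
    "\<And>y. y \<in> X \<Longrightarrow> h y \<noteq> 0 \<Longrightarrow> y \<in> V \<and> \<phi> y = f y / h y"
    using regular_subvarietyE[OF assms(1,3) x] by blast
  obtain f' h' where fh': "f' \<in> polynomials" "h' \<in> polynomials" "h' x \<noteq> 0"
    "\<And>y. y \<in> X \<Longrightarrow> h' y \<noteq> 0 \<Longrightarrow> y \<in> V \<and> \<psi> y = f' y / h' y"
    using regular_subvarietyE[OF assms(2,3) x] by blast
  have "y \<in> V \<and> \<phi> y + \<psi> y = (f y * h' y + f' y * h y) / (h y * h' y)" if "y \<in> X" "h y * h' y \<noteq> 0" for y
    using fh(4)[OF that(1)] fh'(4)[OF that(1)] that(2) by (simp add: add_frac_eq)
  moreover have "(\<lambda>y. (f y * h' y + f' y * h y)) \<in> polynomials" "(\<lambda>y. (h y * h' y)) \<in> polynomials"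
    using fh(1,2) fh'(1,2) by (simp_all add: polynomials.add polynomials.mult)
  ultimately show "\<exists>f\<in>polynomials. \<exists>h\<in>polynomials. h x \<noteq> 0 \<and>
      (\<forall>y\<in>X. h y \<noteq> 0 \<longrightarrow> y \<in> V \<and> \<phi> y + \<psi> y = f y / h y)"
    using fh(3) fh'(3)
    by (intro bexI[of _ "\<lambda>y. (f y * h' y + f' y * h y)"] bexI[of _ "\<lambda>y. (h y * h' y)"] conjI ballI impI) simp_all
qed

lemma regular_mult:
  assumes "\<phi> \<in> regular (subvariety X) V" "\<psi> \<in> regular (subvariety X) V" "V \<subseteq> X"
  shows "(\<lambda>p. \<phi> p * \<psi> p) \<in> regular (subvariety X) V"
  unfolding regular_subvariety_iff[OF assms(3)]
proof
  fix x assume x: "x \<in> V"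
  obtain f h where fh: "f \<in> polynomials" "h \<in> polynomials" "h x \<noteq> 0"
    "\<And>y. y \<in> X \<Longrightarrow> h y \<noteq> 0 \<Longrightarrow> y \<in> V \<and> \<phi> y = f y / h y"
    using regular_subvarietyE[OF assms(1,3) x] by blast
  obtain f' h' where fh': "f' \<in> polynomials" "h' \<in> polynomials" "h' x \<noteq> 0"
    "\<And>y. y \<in> X \<Longrightarrow> h' y \<noteq> 0 \<Longrightarrow> y \<in> V \<and> \<psi> y = f' y / h' y"
    using regular_subvarietyE[OF assms(2,3) x] by blast
  have "y \<in> V \<and> \<phi> y * \<psi> y = (f y * f' y) / (h y * h' y)" if "y \<in> X" "h y * h' y \<noteq> 0" for y
    using fh(4)[OF that(1)] fh'(4)[OF that(1)] that(2) by (simp add: times_divide_times_eq)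
  moreover have "(\<lambda>y. (f y * f' y)) \<in> polynomials" "(\<lambda>y. (h y * h' y)) \<in> polynomials"
    using fh(1,2) fh'(1,2) by (simp_all add: polynomials.add polynomials.mult)
  ultimately show "\<exists>f\<in>polynomials. \<exists>h\<in>polynomials. h x \<noteq> 0 \<and>
      (\<forall>y\<in>X. h y \<noteq> 0 \<longrightarrow> y \<in> V \<and> \<phi> y * \<psi> y = f y / h y)"
    using fh(3) fh'(3)
    by (intro bexI[of _ "\<lambda>y. (f y * f' y)"] bexI[of _ "\<lambda>y. (h y * h' y)"] conjI ballI impI) simp_all
qed

lemma regular_inverse:
  assumes "\<phi> \<in> regular (subvariety X) V" "V \<subseteq> X" "\<And>y. y \<in> V \<Longrightarrow> \<phi> y \<noteq> 0"
  shows "(\<lambda>p. inverse (\<phi> p)) \<in> regular (subvariety X) V"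
  unfolding regular_subvariety_iff[OF assms(2)]
proof
  fix x assume x: "x \<in> V"
  obtain f h where fh: "f \<in> polynomials" "h \<in> polynomials" "h x \<noteq> 0"
    "\<And>y. y \<in> X \<Longrightarrow> h y \<noteq> 0 \<Longrightarrow> y \<in> V \<and> \<phi> y = f y / h y"
    using regular_subvarietyE[OF assms(1,2) x] by blast
  have "f x \<noteq> 0"
    using fh(4)[of x] fh(3) assms(2) assms(3)[OF x] x by auto
  have "y \<in> V \<and> inverse (\<phi> y) = (h y * h y) / (f y * h y)" if "y \<in> X" "f y * h y \<noteq> 0" for y
    using fh(4)[OF that(1)] that(2) by (simp add: inverse_eq_divide)
  moreover have "(\<lambda>y. (h y * h y)) \<in> polynomials" "(\<lambda>y. (f y * h y)) \<in> polynomials"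
    using fh(1,2) by (simp_all add: polynomials.mult)
  ultimately show "\<exists>f\<in>polynomials. \<exists>h\<in>polynomials. h x \<noteq> 0 \<and>
      (\<forall>y\<in>X. h y \<noteq> 0 \<longrightarrow> y \<in> V \<and> inverse (\<phi> y) = f y / h y)"
    using fh(3) \<open>f x \<noteq> 0\<close>
    by (intro bexI[of _ "\<lambda>y. (h y * h y)"] bexI[of _ "\<lambda>y. (f y * h y)"] conjI ballI impI) simp_all
qed

lemma openin_regular_nonzero:
  assumes "\<phi> \<in> regular (subvariety X) V" "V \<subseteq> X"
  shows "openin (topo (subvariety X)) {x \<in> V. \<phi> x \<noteq> 0}"
  unfolding openin_subvariety_iff
proof (intro conjI ballI)
  fix x assume x: "x \<in> {x \<in> V. \<phi> x \<noteq> 0}"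
  obtain f h where fh: "f \<in> polynomials" "h \<in> polynomials" "h x \<noteq> 0"
    "\<And>y. y \<in> X \<Longrightarrow> h y \<noteq> 0 \<Longrightarrow> y \<in> V \<and> \<phi> y = f y / h y"
    using regular_subvarietyE[OF assms] x by blast
  have "f x \<noteq> 0"
    using fh(4)[of x] fh(3) assms(2) x by auto
  then show "\<exists>h\<in>polynomials. h x \<noteq> 0 \<and> (\<forall>y\<in>X. h y \<noteq> 0 \<longrightarrow> y \<in> {x \<in> V. \<phi> x \<noteq> 0})"
    using fh by (intro bexI[of _ "\<lambda>y. f y * h y"]) (auto simp: polynomials.add polynomials.mult polynomials.const)
qed (use assms in auto)

lemma regular_sum:
  assumes "openin (topo (subvariety X)) V" "\<And>a. a \<in> A \<Longrightarrow> \<phi> a \<in> regular (subvariety X) V"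
  shows "(\<lambda>p. \<Sum>a\<in>A. \<phi> a p) \<in> regular (subvariety X) V"
  using assms(2)
proof (induction A rule: infinite_finite_induct)
  case (insert a A)
  then show ?case
    using regular_add[of "\<phi> a" X V] assms(1) by (simp add: openin_subvariety_iff)
qed (simp_all add: regular_polynomial[OF assms(1)] polynomials.const)

lemma regular_prod:
  assumes "openin (topo (subvariety X)) V" "\<And>a. a \<in> A \<Longrightarrow> \<phi> a \<in> regular (subvariety X) V"
  shows "(\<lambda>p. \<Prod>a\<in>A. \<phi> a p) \<in> regular (subvariety X) V"
  using assms(2)
proof (induction A rule: infinite_finite_induct)
  case (insert a A)
  then show ?case
    using regular_mult[of "\<phi> a" X V] assms(1) by (simp add: openin_subvariety_iff)
qed (simp_all add: regular_polynomial[OF assms(1)] polynomials.const)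

text \<open>
  The curve \<open>t \<mapsto> 1 + t N\<close>. For a root vector \<open>N\<close> it is the one-parameter subgroup of \<open>N\<close>, because
  \<open>N\<^sup>2 = 0\<close>.
\<close>

definition line :: "mat4 \<Rightarrow> complex \<Rightarrow> mat4" where
  "line N t = (\<chi> a b. mat 1 $ a $ b + t * N $ a $ b)"

definition move :: "nat \<Rightarrow> mat4 \<Rightarrow> complex \<Rightarrow> (nat \<Rightarrow> mat4) \<Rightarrow> nat \<Rightarrow> mat4" where
  "move j N t p = p(j := p j ** line N t)"

text \<open>
  The derivative along the left-invariant vector field \<open>N\<close> in the \<open>j\<close>-th factor. It is the complex
  derivative along a curve inside the variety, hence does not depend on how the function is written as a
  fraction near the point.
\<close>

definition derivative_along :: "nat \<Rightarrow> mat4 \<Rightarrow> ((nat \<Rightarrow> mat4) \<Rightarrow> complex) \<Rightarrow> (nat \<Rightarrow> mat4) \<Rightarrow> complex"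
  where "derivative_along j N \<phi> p = deriv (\<lambda>t. \<phi> (move j N t p)) 0"

lemma line_zero [simp]: "line N 0 = mat 1"
  by (simp add: line_def vec_eq_iff)

lemma move_zero [simp]: "move j N 0 p = p"
  by (simp add: move_def)

text \<open>
  The entries of a moved tuple are affine in \<open>t\<close> with polynomial coefficients.
\<close>

lemma polynomial_derivative_along:
  assumes "f \<in> polynomials"
  obtains f' where "f' \<in> polynomials"
    "\<And>p. ((\<lambda>t. f (move j N t p)) has_field_derivative f' p) (at 0)"
proof -
  have "\<exists>f'\<in>polynomials. \<forall>p. ((\<lambda>t. f (move j N t p)) has_field_derivative f' p) (at 0)"
    using assms
  proof induction
    case (const c)
    then show ?case by (intro bexI[of _ "\<lambda>_. 0"]) (auto simp: polynomials.add polynomials.mult polynomials.const)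
  next
    case (entry k a b)
    show ?case
    proof (cases "k = j")
      case True
      have "((\<lambda>t. move j N t p k $ a $ b) has_field_derivative (\<Sum>c\<in>UNIV. p j $ a $ c * N $ c $ b)) (at 0)"
        for p
        unfolding True move_def fun_upd_same mult_nth line_def vec_lambda_beta
        by (auto intro!: derivative_eq_intros simp: mult.commute)
      moreover have "(\<lambda>p. \<Sum>c\<in>UNIV. p j $ a $ c * N $ c $ b) \<in> polynomials"
        by (intro polynomials_sum polynomials.mult polynomials.entry polynomials.const)
      ultimately show ?thesis
        by (intro bexI[of _ "\<lambda>p. \<Sum>c\<in>UNIV. p j $ a $ c * N $ c $ b"]) auto
    next
      case False
      then show ?thesis
        by (intro bexI[of _ "\<lambda>_. 0"]) (auto simp: polynomials.const move_def)
    qed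
  next
    case (add f h)
    then obtain f' h' where "f' \<in> polynomials" "h' \<in> polynomials"
      "\<forall>p. ((\<lambda>t. f (move j N t p)) has_field_derivative f' p) (at 0)"
      "\<forall>p. ((\<lambda>t. h (move j N t p)) has_field_derivative h' p) (at 0)" by blast
    then show ?case
      by (intro bexI[of _ "\<lambda>p. f' p + h' p"]) (auto simp: polynomials.add intro!: DERIV_add)
  next
    case (mult f h)
    then obtain f' h' where *: "f' \<in> polynomials" "h' \<in> polynomials"
      "\<forall>p. ((\<lambda>t. f (move j N t p)) has_field_derivative f' p) (at 0)"
      "\<forall>p. ((\<lambda>t. h (move j N t p)) has_field_derivative h' p) (at 0)" by blast
    have "((\<lambda>t. f (move j N t p) * h (move j N t p)) has_field_derivative f' p * h p + h' p * f p) (at 0)" for p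
      using DERIV_mult[OF *(3)[rule_format, of p] *(4)[rule_format, of p]] by simp
    moreover have "(\<lambda>p. f' p * h p + h' p * f p) \<in> polynomials"
      using * mult by (auto simp: polynomials.add polynomials.mult polynomials.const)
    ultimately show ?case
      by (intro bexI[of _ "\<lambda>p. f' p * h p + h' p * f p"]) auto
  qed
  then show ?thesis using that by blast
qed

lemma quotient_derivative_along:
  assumes X: "\<And>t. move j N t p \<in> X"
    and f: "((\<lambda>t. f (move j N t p)) has_field_derivative f') (at 0)"
    and h: "((\<lambda>t. h (move j N t p)) has_field_derivative h') (at 0)"
    and p: "h p \<noteq> 0" and eq: "\<And>y. y \<in> X \<Longrightarrow> h y \<noteq> 0 \<Longrightarrow> \<phi> y = f y / h y"
  shows "((\<lambda>t. \<phi> (move j N t p)) has_field_derivative (f' * h p - f p * h') / (h p * h p)) (at 0)"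
    and "eventually (\<lambda>t. h (move j N t p) \<noteq> 0) (nhds 0)"
proof -
  have "isCont (\<lambda>t. h (move j N t p)) 0"
    using h by (rule DERIV_isCont)
  then have "((\<lambda>t. h (move j N t p)) \<longlongrightarrow> h p) (nhds 0)"
    by (simp add: continuous_within tendsto_nhds_iff)
  then show ev: "eventually (\<lambda>t. h (move j N t p) \<noteq> 0) (nhds 0)"
    using p by (rule tendsto_imp_eventually_ne)
  have "eventually (\<lambda>t. f (move j N t p) / h (move j N t p) = \<phi> (move j N t p)) (nhds 0)"
    using ev by eventually_elim (simp add: eq X)
  moreover have "((\<lambda>t. f (move j N t p) / h (move j N t p)) has_field_derivative
      (f' * h p - f p * h') / (h p * h p)) (at 0)"
    using DERIV_divide[OF f h] p by simp
  ultimately show "((\<lambda>t. \<phi> (move j N t p)) has_field_derivative (f' * h p - f p * h') / (h p * h p)) (at 0)"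
    by (subst (asm) DERIV_cong_ev) auto
qed

context
  fixes X :: "(nat \<Rightarrow> mat4) set" and j :: nat and N :: mat4
  assumes X: "\<And>p t. p \<in> X \<Longrightarrow> move j N t p \<in> X"
begin

lemma regular_has_derivative_along:
  assumes "\<phi> \<in> regular (subvariety X) V" "V \<subseteq> X" "p \<in> V"
  shows "((\<lambda>t. \<phi> (move j N t p)) has_field_derivative derivative_along j N \<phi> p) (at 0)"
proof -
  obtain f h where fh: "f \<in> polynomials" "h \<in> polynomials" "h p \<noteq> 0"
    "\<And>y. y \<in> X \<Longrightarrow> h y \<noteq> 0 \<Longrightarrow> y \<in> V \<and> \<phi> y = f y / h y"
    using regular_subvarietyE[OF assms] by blast
  obtain f' h' where
    "\<And>p. ((\<lambda>t. f (move j N t p)) has_field_derivative f' p) (at 0)"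
    "\<And>p. ((\<lambda>t. h (move j N t p)) has_field_derivative h' p) (at 0)"
    using polynomial_derivative_along fh(1,2) by metis
  then have "\<exists>d. ((\<lambda>t. \<phi> (move j N t p)) has_field_derivative d) (at 0)"
    using quotient_derivative_along(1)[of j N p X f _ h _ \<phi>] X fh assms(2,3) by blast
  then show ?thesis
    using DERIV_imp_deriv derivative_along_def by metis
qed

lemma eventually_move_in_open:
  assumes V: "openin (topo (subvariety X)) V" and p: "p \<in> V"
  shows "eventually (\<lambda>t. move j N t p \<in> V) (nhds 0)"
proof -
  obtain h where h: "h \<in> polynomials" "h p \<noteq> 0" "\<forall>y\<in>X. h y \<noteq> 0 \<longrightarrow> y \<in> V"
    using V p by (auto simp: openin_subvariety_iff)
  obtain h' where h': "\<And>p. ((\<lambda>t. h (move j N t p)) has_field_derivative h' p) (at 0)"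
    using polynomial_derivative_along h(1) by metis
  have pX: "p \<in> X" using V p by (auto simp: openin_subvariety_iff)
  have "eventually (\<lambda>t. h (move j N t p) \<noteq> 0) (nhds 0)"
    using quotient_derivative_along(2)[of j N p X h _ h _ "\<lambda>y. h y / h y", OF X[OF pX] h' h' h(2)]
    by simp
  then show ?thesis
    by eventually_elim (use h(3) X[OF pX] in blast)
qed

text \<open>
  The quotient rule turns a local fraction into a local fraction, so the vector field acts on the sheaf
  of regular functions.
\<close>

lemma regular_derivative_along:
  assumes \<phi>: "\<phi> \<in> regular (subvariety X) V" and V: "V \<subseteq> X"
  shows "derivative_along j N \<phi> \<in> regular (subvariety X) V"
  unfolding regular_subvariety_iff[OF V]
proof
  fix x assume x: "x \<in> V"
  obtain f h where fh: "f \<in> polynomials" "h \<in> polynomials" "h x \<noteq> 0"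
    "\<And>y. y \<in> X \<Longrightarrow> h y \<noteq> 0 \<Longrightarrow> y \<in> V \<and> \<phi> y = f y / h y"
    using regular_subvarietyE[OF \<phi> V x] by blast
  obtain f' where f': "f' \<in> polynomials"
    "\<And>p. ((\<lambda>t. f (move j N t p)) has_field_derivative f' p) (at 0)"
    using polynomial_derivative_along[OF fh(1)] by metis
  obtain h' where h': "h' \<in> polynomials"
    "\<And>p. ((\<lambda>t. h (move j N t p)) has_field_derivative h' p) (at 0)"
    using polynomial_derivative_along[OF fh(2)] by metis
  have "derivative_along j N \<phi> y = (f' y * h y - f y * h' y) / (h y * h y)"
    if "y \<in> X" "h y \<noteq> 0" for y
    using quotient_derivative_along(1)[of j N y X f _ h _ \<phi>, OF X[OF that(1)] f'(2) h'(2) that(2)] fh(4)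
    by (simp add: derivative_along_def DERIV_imp_deriv)
  moreover have "(\<lambda>y. f' y * h y - f y * h' y) \<in> polynomials" "(\<lambda>y. h y * h y) \<in> polynomials"
    using polynomials_diff[OF polynomials.mult[OF f'(1) fh(2)] polynomials.mult[OF fh(1) h'(1)]]
      polynomials.mult[OF fh(2) fh(2)] by simp_all
  ultimately show "\<exists>f\<in>polynomials. \<exists>h\<in>polynomials. h x \<noteq> 0 \<and>
      (\<forall>y\<in>X. h y \<noteq> 0 \<longrightarrow> y \<in> V \<and> derivative_along j N \<phi> y = f y / h y)"
    using fh(3,4)
    by (intro bexI[of _ "\<lambda>y. f' y * h y - f y * h' y"] bexI[of _ "\<lambda>y. h y * h y"]) auto
qed

lemma derivative_along_cong:
  assumes "openin (topo (subvariety X)) V" "p \<in> V" "\<And>y. y \<in> V \<Longrightarrow> \<phi> y = \<psi> y"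
  shows "derivative_along j N \<phi> p = derivative_along j N \<psi> p"
proof -
  have "eventually (\<lambda>t. \<phi> (move j N t p) = \<psi> (move j N t p)) (nhds 0)"
    using eventually_move_in_open[OF assms(1,2)] by eventually_elim (simp add: assms(3))
  then show ?thesis
    unfolding derivative_along_def by (intro deriv_cong_ev) auto
qed

lemma derivative_along_rules:
  assumes "\<phi> \<in> regular (subvariety X) V" "\<psi> \<in> regular (subvariety X) V" "V \<subseteq> X" "p \<in> V"
  shows derivative_along_add: "derivative_along j N (\<lambda>q. \<phi> q + \<psi> q) p =
      derivative_along j N \<phi> p + derivative_along j N \<psi> p"
    and derivative_along_mult: "derivative_along j N (\<lambda>q. \<phi> q * \<psi> q) p =
      \<phi> p * derivative_along j N \<psi> p + \<psi> p * derivative_along j N \<phi> p"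
    and derivative_along_scale: "derivative_along j N (\<lambda>q. c * \<phi> q) p = c * derivative_along j N \<phi> p"
proof -
  note D = regular_has_derivative_along[OF assms(1,3,4)] regular_has_derivative_along[OF assms(2,3,4)]
  show "derivative_along j N (\<lambda>q. \<phi> q + \<psi> q) p =
      derivative_along j N \<phi> p + derivative_along j N \<psi> p"
    using DERIV_imp_deriv[OF DERIV_add[OF D]] unfolding derivative_along_def by simp
  show "derivative_along j N (\<lambda>q. \<phi> q * \<psi> q) p =
      \<phi> p * derivative_along j N \<psi> p + \<psi> p * derivative_along j N \<phi> p"
    using DERIV_imp_deriv[OF DERIV_mult[OF D]] unfolding derivative_along_def by simp
  show "derivative_along j N (\<lambda>q. c * \<phi> q) p = c * derivative_along j N \<phi> p"
    using DERIV_imp_deriv[OF DERIV_cmult[OF D(1)]] unfolding derivative_along_def by simp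
qed

end

section \<open>Minimal parabolic subgroups and the quotient\<close>

lemma matrix_inv_cancel:
  fixes A :: mat4
  assumes "det A = 1"
  shows "A ** matrix_inv A = mat 1" "matrix_inv A ** A = mat 1" "det (matrix_inv A) = 1"
    "A ** (matrix_inv A ** B) = B" "matrix_inv A ** (A ** B) = B"
proof -
  have "A \<in> carrier SL4" using assms by (simp add: SL4_def)
  note * = SL4_inverse[OF this]
  show "A ** matrix_inv A = mat 1" "matrix_inv A ** A = mat 1" "det (matrix_inv A) = 1"
    by (fact *)+
  show "A ** (matrix_inv A ** B) = B" "matrix_inv A ** (A ** B) = B"
    by (simp_all add: matrix_mul_assoc *)
qed

lemma matrix_inv_unique:
  fixes A :: mat4
  assumes "det A = 1" "A ** B = mat 1"
  shows "matrix_inv A = B"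
  using matrix_inv_cancel(5)[OF assms(1), of B] assms(2) by simp

lemma matrix_inv_one [simp]: "matrix_inv (mat 1 :: mat4) = mat 1"
  by (rule matrix_inv_unique) simp_all

lemma matrix_inv_mult:
  fixes A B :: mat4
  assumes "det A = 1" "det B = 1"
  shows "matrix_inv (A ** B) = matrix_inv B ** matrix_inv A"
proof (rule matrix_inv_unique)
  have "A ** B ** (matrix_inv B ** matrix_inv A) = A ** (B ** (matrix_inv B ** matrix_inv A))"
    by (simp only: matrix_mul_assoc)
  then show "A ** B ** (matrix_inv B ** matrix_inv A) = mat 1"
    by (simp add: matrix_inv_cancel assms)
qed (simp add: det_mul assms)

lemma m_inv_SL4:
  assumes "det A = 1"
  shows "inv\<^bsub>SL4\<^esub> A = matrix_inv A"
  by (rule group.inv_equality[OF group_SL4]) (auto simp: SL4_def matrix_inv_cancel assms)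

text \<open>
  The minimal parabolic is generated as a group, so the shape has to be checked for the inverses of the
  generators as well.
\<close>

lemma almost_lower_inverse_swap:
  assumes k: "k \<in> {1,2,3}" and D: "diagonal D" "det D = 1"
  shows "almost_lower k (matrix_inv (D ** swap_matrix k))"
proof -
  define S where "S = unip k (- 1) ** (lower_unip k 1 ** unip k (- 1))"
  have lu: "lower_unip k s ** lower_unip k t = lower_unip k (s + t)" for s t
    by (simp add: lower_unip_def matrix_transpose_mul[symmetric] unip_mult[OF k] add.commute)
  have [simp]: "lower_unip k 0 = mat 1"
    by (simp add: lower_unip_def transpose_mat)
  have "S ** swap_matrix k =
      unip k (- 1) ** (lower_unip k 1 ** ((unip k (- 1) ** unip k 1) ** (lower_unip k (- 1) ** unip k 1)))"
    by (simp only: S_def swap_matrix_eq[OF k] matrix_mul_assoc)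
  also have "\<dots> = unip k (- 1) ** ((lower_unip k 1 ** lower_unip k (- 1)) ** unip k 1)"
    by (simp only: unip_mult[OF k]) (simp add: matrix_mul_assoc)
  also have "\<dots> = mat 1"
    by (simp add: lu unip_mult[OF k])
  finally have "S ** swap_matrix k = mat 1" .
  then have "matrix_inv (swap_matrix k) = S"
    using matrix_left_right_inverse[of S "swap_matrix k"]
    by (intro matrix_inv_unique det_swap_matrix[OF k]) simp
  moreover have "lower (matrix_inv D)"
    using D matrix_inv_cancel(1)[OF D(2)] lower_right_inverse by (auto simp: diagonal_iff)
  ultimately show ?thesis
    unfolding S_def using D
    by (simp add: matrix_inv_mult det_swap_matrix[OF k] almost_lower_mult[OF k] almost_lower_unip
        lower_imp_almost_lower lower_lower_unip[OF k])
qed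

locale bsdh_word =
  fixes g :: mat4 and ks :: "nat list"
  assumes g: "g \<in> carrier SL4" and ks: "set ks \<subseteq> {1,2,3}"
begin

abbreviation n :: nat where "n \<equiv> length ks"

lemma nth_ks: "j < n \<Longrightarrow> ks ! j \<in> {1,2,3}"
  using ks nth_mem by blast

text \<open>
  Conjugation back to the standard pair of torus and Borel subgroup.
\<close>

definition hat :: "mat4 \<Rightarrow> mat4" where
  "hat A = matrix_inv g ** A ** g"

lemma det_g: "det g = 1"
  using g by (simp add: SL4_def)

lemma hat_mult: "hat (A ** B) = hat A ** hat B"
proof -
  have "hat A ** hat B = matrix_inv g ** A ** (g ** (matrix_inv g ** (B ** g)))"
    by (simp only: hat_def matrix_mul_assoc)
  then show ?thesis
    by (simp add: hat_def matrix_inv_cancel det_g matrix_mul_assoc)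
qed

lemma hat_one [simp]: "hat (mat 1) = mat 1"
  by (simp add: hat_def matrix_inv_cancel det_g)

lemma det_hat [simp]: "det (hat A) = det A"
  by (simp add: hat_def det_mul det_g matrix_inv_cancel)

lemma hat_conjugate [simp]: "hat (g ** A ** matrix_inv g) = A"
proof -
  have "hat (g ** A ** matrix_inv g) = (matrix_inv g ** g) ** A ** (matrix_inv g ** g)"
    by (simp only: hat_def matrix_mul_assoc)
  then show ?thesis by (simp add: matrix_inv_cancel det_g)
qed

lemma conjugate_hat: "g ** hat A ** matrix_inv g = A"
proof -
  have "g ** hat A ** matrix_inv g = (g ** matrix_inv g) ** A ** (g ** matrix_inv g)"
    by (simp only: hat_def matrix_mul_assoc)
  then show ?thesis by (simp add: matrix_inv_cancel det_g)
qed

lemma hat_matrix_inv: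
  assumes "det A = 1"
  shows "hat (matrix_inv A) = matrix_inv (hat A)"
  by (rule matrix_inv_unique[symmetric])
    (simp_all add: assms hat_mult[symmetric] matrix_inv_cancel)

lemma borel_opp_iff: "b \<in> borel_opp g \<longleftrightarrow> det b = 1 \<and> lower (hat b)"
proof
  assume "b \<in> borel_opp g"
  then obtain A where A: "lower A" "det A = 1" "b = g ** A ** matrix_inv g"
    by (auto simp: borel_opp_def conjugate_def SL4_def lower_def)
  then have "hat b = A" by simp
  then show "det b = 1 \<and> lower (hat b)" using A det_hat[of b] by simp
next
  assume *: "det b = 1 \<and> lower (hat b)"
  have "b = g ** hat b ** matrix_inv g" by (rule conjugate_hat[symmetric])
  moreover have "hat b \<in> {A \<in> carrier SL4. \<forall>a b. a < b \<longrightarrow> A $ a $ b = 0}"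
    using * by (simp add: SL4_def lower_def)
  ultimately show "b \<in> borel_opp g"
    unfolding borel_opp_def conjugate_def by (rule image_eqI)
qed

lemma borel_opp_one: "mat 1 \<in> borel_opp g"
  by (simp add: borel_opp_iff lower_mat)

lemma borel_opp_mult: "b \<in> borel_opp g \<Longrightarrow> c \<in> borel_opp g \<Longrightarrow> b ** c \<in> borel_opp g"
  by (simp add: borel_opp_iff det_mul hat_mult lower_mult)

lemma borel_opp_inv:
  assumes "b \<in> borel_opp g"
  shows "matrix_inv b \<in> borel_opp g"
proof -
  have b: "det b = 1" "lower (hat b)" using assms by (auto simp: borel_opp_iff)
  have "hat b ** hat (matrix_inv b) = mat 1"
    by (simp add: hat_mult[symmetric] matrix_inv_cancel b)
  then have "lower (hat (matrix_inv b))"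
    by (rule lower_right_inverse[OF b(2)])
  then show ?thesis by (simp add: borel_opp_iff matrix_inv_cancel b)
qed

lemma minimal_parabolic_generators:
  assumes k: "k \<in> {1,2,3}" and x: "x \<in> borel_opp g \<union> simple_reflection g k"
  shows "det x = 1" "almost_lower k (hat x)" "almost_lower k (hat (matrix_inv x))"
proof -
  have "det x = 1 \<and> almost_lower k (hat x) \<and> almost_lower k (hat (matrix_inv x))"
  proof (cases "x \<in> borel_opp g")
    case True
    then show ?thesis
      using borel_opp_inv[OF True] by (auto simp: borel_opp_iff lower_imp_almost_lower)
  next
    case False
    then obtain D where D: "diagonal D" "det D = 1" "x = g ** (D ** swap_matrix k) ** matrix_inv g"
      using x simple_reflection_eq[OF g] by auto
    then have hat: "hat x = D ** swap_matrix k" by simp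
    then have "det x = 1"
      using det_hat[of x] by (simp add: det_mul D det_swap_matrix[OF k])
    moreover have "almost_lower k (hat x)"
      unfolding hat using D(1)
      by (intro almost_lower_mult[OF k] almost_lower_swap_matrix[OF k] lower_imp_almost_lower)
        (simp add: diagonal_iff)
    ultimately show ?thesis
      using almost_lower_inverse_swap[OF k D(1,2)] by (simp add: hat_matrix_inv hat)
  qed
  then show "det x = 1" "almost_lower k (hat x)" "almost_lower k (hat (matrix_inv x))"
    by auto
qed

context
  fixes k :: nat
  assumes k: "k \<in> {1,2,3}"
begin

lemma minimal_parabolic_subgroup: "subgroup (minimal_parabolic g k) SL4"
  unfolding minimal_parabolic_def
  using minimal_parabolic_generators(1)[OF k]
  by (intro group.generate_is_subgroup[OF group_SL4]) (auto simp: SL4_def)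

lemma minimal_parabolic_det: "x \<in> minimal_parabolic g k \<Longrightarrow> det x = 1"
  using subgroup.mem_carrier[OF minimal_parabolic_subgroup] by (simp add: SL4_def)

lemma minimal_parabolic_mult:
  "x \<in> minimal_parabolic g k \<Longrightarrow> y \<in> minimal_parabolic g k \<Longrightarrow> x ** y \<in> minimal_parabolic g k"
  using subgroup.m_closed[OF minimal_parabolic_subgroup] by (simp add: SL4_def)

lemma minimal_parabolic_inv:
  "x \<in> minimal_parabolic g k \<Longrightarrow> matrix_inv x \<in> minimal_parabolic g k"
  using subgroup.m_inv_closed[OF minimal_parabolic_subgroup, of x]
  by (simp add: m_inv_SL4 minimal_parabolic_det)

lemma borel_opp_subset_minimal_parabolic: "b \<in> borel_opp g \<Longrightarrow> b \<in> minimal_parabolic g k"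
  unfolding minimal_parabolic_def by (intro generate.incl) auto

lemma minimal_parabolic_almost_lower:
  assumes "x \<in> minimal_parabolic g k"
  shows "almost_lower k (hat x)"
  using assms unfolding minimal_parabolic_def
proof induction
  case one
  then show ?case by (simp add: SL4_def lower_imp_almost_lower lower_mat)
next
  case (incl h)
  then show ?case by (rule minimal_parabolic_generators[OF k])
next
  case (inv h)
  then show ?case
    using minimal_parabolic_generators[OF k inv] by (simp add: m_inv_SL4)
next
  case (eng h1 h2)
  then show ?case by (simp add: SL4_def hat_mult almost_lower_mult[OF k])
qed

text \<open>
  The positive root subgroup is the negative one conjugated by the reflection.
\<close>

lemma unip_in_minimal_parabolic: "g ** unip k t ** matrix_inv g \<in> minimal_parabolic g k"
proof -
  let ?s = "g ** swap_matrix k ** matrix_inv g"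
  let ?l = "g ** lower_unip k (- t) ** matrix_inv g"
  have "det ?l = 1" using det_hat[of ?l] by (simp add: det_lower_unip[OF k])
  then have l: "?l \<in> minimal_parabolic g k"
    by (intro borel_opp_subset_minimal_parabolic) (simp add: borel_opp_iff lower_lower_unip[OF k])
  have "?s \<in> simple_reflection g k"
    unfolding simple_reflection_eq[OF g] using diagonal_mat[of 1] by force
  then have s: "?s \<in> minimal_parabolic g k"
    unfolding minimal_parabolic_def by (intro generate.incl) simp
  have "g ** unip k t ** matrix_inv g = ?s ** ?l ** matrix_inv ?s"
  proof -
    have "(g ** unip k t ** matrix_inv g) ** ?s = ?s ** ?l"
      by (simp add: conjugate_mult[OF g] unip_swap_matrix[OF k])
    then have "(g ** unip k t ** matrix_inv g) ** (?s ** matrix_inv ?s) = ?s ** ?l ** matrix_inv ?s"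
      by (simp only: matrix_mul_assoc)
    then show ?thesis by (simp add: matrix_inv_cancel minimal_parabolic_det[OF s])
  qed
  then show ?thesis
    by (simp only:) (intro minimal_parabolic_mult minimal_parabolic_inv s l)
qed

end

abbreviation PP :: "(nat \<Rightarrow> mat4) set" where "PP \<equiv> parabolic_product g ks"

definition borel_tuples :: "(nat \<Rightarrow> mat4) set" where "borel_tuples = (\<Pi>\<^sub>E j\<in>{..<n}. borel_opp g)"

text \<open>
  The factor \<open>b\<^sub>j\<^sub>-\<^sub>1\<close>, with \<open>b\<^sub>-\<^sub>1 = 1\<close>; it makes the formula for the action uniform in \<open>j\<close>.
\<close>

definition prev :: "(nat \<Rightarrow> mat4) \<Rightarrow> nat \<Rightarrow> mat4" where
  "prev b j = (if j = 0 then mat 1 else b (j - 1))"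

abbreviation act :: "(nat \<Rightarrow> mat4) \<Rightarrow> (nat \<Rightarrow> mat4) \<Rightarrow> nat \<Rightarrow> mat4" where
  "act \<equiv> borel_action n"

lemma act_nth: "j < n \<Longrightarrow> act p b j = matrix_inv (prev b j) ** p j ** b j"
  by (simp add: borel_action_def prev_def)

lemma PP_nth: "p \<in> PP \<Longrightarrow> j < n \<Longrightarrow> p j \<in> minimal_parabolic g (ks ! j)"
  by (auto simp: parabolic_product_def)

lemma borel_tuples_nth: "b \<in> borel_tuples \<Longrightarrow> j < n \<Longrightarrow> b j \<in> borel_opp g"
  by (auto simp: borel_tuples_def)

lemma prev_in_borel: "b \<in> borel_tuples \<Longrightarrow> j \<le> n \<Longrightarrow> prev b j \<in> borel_opp g"
  by (cases j) (auto simp: prev_def borel_opp_one borel_tuples_nth)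

lemma act_in_PP:
  assumes "p \<in> PP" "b \<in> borel_tuples"
  shows "act p b \<in> PP"
proof -
  have "act p b j \<in> minimal_parabolic g (ks ! j)" if "j < n" for j
    unfolding act_nth[OF that] using that assms
    by (intro minimal_parabolic_mult[OF nth_ks] PP_nth borel_opp_subset_minimal_parabolic[OF nth_ks]
        borel_opp_inv prev_in_borel borel_tuples_nth) auto
  then show ?thesis
    by (auto simp: parabolic_product_def PiE_iff borel_action_def extensional_def)
qed

lemma tuple_eqI:
  assumes "p \<in> PP" "q \<in> PP" "\<And>j. j < n \<Longrightarrow> p j = q j"
  shows "p = q"
  using assms unfolding parabolic_product_def by (rule PiE_ext) simp

lemma det_borel_tuples: "b \<in> borel_tuples \<Longrightarrow> j < n \<Longrightarrow> det (b j) = 1"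
  using borel_tuples_nth borel_opp_iff by blast

lemma det_prev: "b \<in> borel_tuples \<Longrightarrow> j < n \<Longrightarrow> det (prev b j) = 1"
  using prev_in_borel[of b j] borel_opp_iff by simp

lemma act_act:
  assumes "p \<in> PP" "b \<in> borel_tuples" "c \<in> borel_tuples"
  shows "(\<lambda>j\<in>{..<n}. b j ** c j) \<in> borel_tuples"
    "act (act p b) c = act p (\<lambda>j\<in>{..<n}. b j ** c j)"
proof -
  let ?d = "\<lambda>j\<in>{..<n}. b j ** c j"
  show d: "?d \<in> borel_tuples" using assms by (auto simp: borel_tuples_def intro: borel_opp_mult)
  show "act (act p b) c = act p ?d"
  proof (rule tuple_eqI)
    fix j assume j: "j < n"
    have "prev ?d j = prev b j ** prev c j" using j by (auto simp: prev_def)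
    then have "matrix_inv (prev ?d j) = matrix_inv (prev c j) ** matrix_inv (prev b j)"
      using matrix_inv_mult det_prev assms j by simp
    then show "act (act p b) c j = act p ?d j"
      using j by (simp add: act_nth matrix_mul_assoc)
  qed (use assms d act_in_PP in auto)
qed

lemma act_one:
  assumes "p \<in> PP"
  shows "(\<lambda>j\<in>{..<n}. mat 1) \<in> borel_tuples" "act p (\<lambda>j\<in>{..<n}. mat 1) = p"
proof -
  show e: "(\<lambda>j\<in>{..<n}. mat 1) \<in> borel_tuples" by (auto simp: borel_tuples_def borel_opp_one)
  show "act p (\<lambda>j\<in>{..<n}. mat 1) = p"
    by (rule tuple_eqI) (use assms e act_in_PP in \<open>auto simp: act_nth prev_def\<close>)
qed

lemma act_inverse:
  assumes "p \<in> PP" "b \<in> borel_tuples"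
  obtains c where "c \<in> borel_tuples" "act (act p b) c = p"
proof -
  define c where "c = (\<lambda>j\<in>{..<n}. matrix_inv (b j))"
  have c: "c \<in> borel_tuples" using borel_tuples_nth[OF assms(2)] by (auto simp: c_def borel_tuples_def borel_opp_inv)
  have "(\<lambda>j\<in>{..<n}. b j ** c j) = (\<lambda>j\<in>{..<n}. mat 1)"
    using det_borel_tuples[OF assms(2)] by (intro restrict_ext) (simp add: c_def matrix_inv_cancel)
  then have "act (act p b) c = p"
    using act_act(2)[OF assms c] act_one(2)[OF assms(1)] by simp
  then show ?thesis using c that by blast
qed

definition orbit_of :: "(nat \<Rightarrow> mat4) \<Rightarrow> (nat \<Rightarrow> mat4) set" where
  "orbit_of p = orbit_relation g ks `` {p}"

lemma orbit_of_eq: "p \<in> PP \<Longrightarrow> orbit_of p = {act p b | b. b \<in> borel_tuples}"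
  by (auto simp: orbit_of_def orbit_relation_def borel_tuples_def)

lemma in_orbit_of: "p \<in> PP \<Longrightarrow> p \<in> orbit_of p"
  unfolding orbit_of_eq using act_one[of p] by (intro CollectI exI[of _ "\<lambda>j\<in>{..<n}. mat 1"]) simp

lemma orbit_of_subset: "p \<in> PP \<Longrightarrow> orbit_of p \<subseteq> PP"
  by (auto simp: orbit_of_eq act_in_PP)

lemma orbit_of_act_subset:
  assumes "p \<in> PP" "b \<in> borel_tuples"
  shows "orbit_of (act p b) \<subseteq> orbit_of p"
proof
  fix q assume "q \<in> orbit_of (act p b)"
  then obtain c where c: "c \<in> borel_tuples" "q = act (act p b) c"
    using assms by (auto simp: orbit_of_eq act_in_PP)
  then show "q \<in> orbit_of p"
    using act_act[OF assms c(1)] assms by (auto simp: orbit_of_eq)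
qed

lemma orbit_of_act:
  assumes "p \<in> PP" "b \<in> borel_tuples"
  shows "orbit_of (act p b) = orbit_of p"
proof -
  obtain c where c: "c \<in> borel_tuples" "act (act p b) c = p"
    using act_inverse[OF assms] .
  have "orbit_of p \<subseteq> orbit_of (act p b)"
    using orbit_of_act_subset[OF act_in_PP[OF assms] c(1)] c(2) by simp
  then show ?thesis using orbit_of_act_subset[OF assms] by blast
qed

lemma orbit_of_cong: "p \<in> PP \<Longrightarrow> q \<in> orbit_of p \<Longrightarrow> orbit_of q = orbit_of p"
  using orbit_of_act by (auto simp: orbit_of_eq)

abbreviation Z :: "(nat \<Rightarrow> mat4) set function_space" where "Z \<equiv> BSDH g ks"
abbreviation S :: "(nat \<Rightarrow> mat4) function_space" where "S \<equiv> subvariety PP"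

text \<open>
  The saturated set of tuples above a set of points of the quotient.
\<close>

definition pre :: "(nat \<Rightarrow> mat4) set set \<Rightarrow> (nat \<Rightarrow> mat4) set" where
  "pre U = {p \<in> PP. orbit_of p \<in> U}"

lemma pre_subset: "pre U \<subseteq> PP"
  by (auto simp: pre_def)

lemma openin_Z: "openin (topo Z) U \<longleftrightarrow> U \<subseteq> orbit_of ` PP \<and> openin (topo S) (pre U)"
proof -
  have "PP // orbit_relation g ks = orbit_of ` PP"
    by (auto simp: quotient_def orbit_of_def)
  then show ?thesis
    by (simp add: BSDH_def openin_quotient_space pre_def orbit_of_def)
qed

lemma topspace_Z: "topspace (topo Z) = orbit_of ` PP"
proof -
  have "pre (orbit_of ` PP) = PP" by (auto simp: pre_def)
  then have "openin (topo Z) (orbit_of ` PP)"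
    using openin_topspace[of "topo S"] by (simp add: openin_Z)
  moreover have "topspace (topo Z) \<subseteq> orbit_of ` PP"
    using openin_topspace[of "topo Z"] openin_Z[of "topspace (topo Z)"] by blast
  ultimately show ?thesis
    by (intro subset_antisym openin_subset)
qed

lemma regular_Z: "\<phi> \<in> regular Z U \<longleftrightarrow> (\<lambda>p. \<phi> (orbit_of p)) \<in> regular S (pre U)"
  by (simp add: BSDH_def quotient_space_def pre_def orbit_of_def)

definition rep :: "(nat \<Rightarrow> mat4) set \<Rightarrow> nat \<Rightarrow> mat4" where
  "rep z = (SOME p. p \<in> z)"

lemma rep_orbit_of:
  assumes "p \<in> PP"
  shows "rep (orbit_of p) \<in> orbit_of p" "rep (orbit_of p) \<in> PP" "orbit_of (rep (orbit_of p)) = orbit_of p"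
proof -
  show "rep (orbit_of p) \<in> orbit_of p"
    unfolding rep_def using in_orbit_of[OF assms] by (rule someI[of "\<lambda>q. q \<in> orbit_of p"])
  then show "rep (orbit_of p) \<in> PP" "orbit_of (rep (orbit_of p)) = orbit_of p"
    using orbit_of_subset[OF assms] orbit_of_cong[OF assms] by auto
qed

lemma rep_topspace:
  assumes "z \<in> topspace (topo Z)"
  shows "rep z \<in> PP" "orbit_of (rep z) = z"
  using assms rep_orbit_of by (auto simp: topspace_Z)

end

section \<open>Coordinates around a point\<close>

lemma unip_mult_nth:
  assumes k: "k \<in> {1,2,3}"
  shows "(unip k t ** A) $ a $ b = A $ a $ b + (if a = lo k then t * A $ hi k $ b else 0)"
proof -
  have "\<forall>a. (unip k t ** A) $ a $ b = A $ a $ b + (if a = lo k then t * A $ hi k $ b else 0)"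
   using k by (elim lo_hi_cases) (simp_all add: all_4 mult_nth unip_nth sum_4')
  then show ?thesis by blast
qed
lemma almost_lower_mult_lower:
  assumes k: "k \<in> {1,2,3}" and A: "almost_lower k A" and b: "lower b"
  shows "(A ** b) $ hi k $ hi k = A $ hi k $ hi k * b $ hi k $ hi k"
    and "(A ** b) $ lo k $ hi k = A $ lo k $ hi k * b $ hi k $ hi k"
proof -
  show "(A ** b) $ hi k $ hi k = A $ hi k $ hi k * b $ hi k $ hi k"
    using k A b unfolding almost_lower_def lower_def
    by (elim lo_hi_cases) (simp_all add: all_4 mult_nth sum_4' order_4)
  show "(A ** b) $ lo k $ hi k = A $ lo k $ hi k * b $ hi k $ hi k"
    using k A b unfolding almost_lower_def lower_def
    by (elim lo_hi_cases) (simp_all add: all_4 mult_nth sum_4' order_4)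
qed

text \<open>
  The coordinate of \<open>P\<^sub>k / B\<close> on the open cell: \<open>A = unip k (slope k A) ** b\<close> with \<open>b\<close> lower triangular.
\<close>

definition slope :: "nat \<Rightarrow> mat4 \<Rightarrow> complex" where
  "slope k A = A $ lo k $ hi k / A $ hi k $ hi k"

lemma slope_mult_lower:
  assumes "k \<in> {1,2,3}" "almost_lower k A" "lower b" "b $ hi k $ hi k \<noteq> 0"
  shows "slope k (A ** b) = slope k A"
  using almost_lower_mult_lower[OF assms(1-3)] assms(4) by (simp add: slope_def)

text \<open>
  Subtracting a multiple of row \<open>hi k\<close> from row \<open>lo k\<close> clears the only entry above the diagonal.
\<close>

lemma lower_unip_slope:
  assumes k: "k \<in> {1,2,3}" and A: "almost_lower k A" and nz: "A $ hi k $ hi k \<noteq> 0"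
  shows "lower (unip k (- slope k A) ** A)"
  unfolding lower_def
proof (intro allI impI)
  fix a b :: 4 assume ab: "a < b"
  show "(unip k (- slope k A) ** A) $ a $ b = 0"
  proof (cases "a = lo k")
    case True
    show ?thesis
    proof (cases "b = hi k")
      case True
      then show ?thesis using \<open>a = lo k\<close> nz by (simp add: unip_mult_nth[OF k] slope_def)
    next
      case False
      have "hi k < b"
        using hi_le_iff[OF k, of b] ab False \<open>a = lo k\<close> by auto
      then have "A $ hi k $ b = 0" "A $ a $ b = 0"
        using A ab False lo_less_hi[OF k] by (auto simp: almost_lower_def)
      then show ?thesis by (simp add: unip_mult_nth[OF k])
    qed
  next
    case False
    then show ?thesis
      using A ab by (auto simp: unip_mult_nth[OF k] almost_lower_def)
  qed
qed

lemma line_conjugate: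
  assumes "g ** h = mat 1"
  shows "line (g ** N ** h) t = g ** line N t ** h"
proof -
  define L where "L = (\<chi> a b. t * N $ a $ b)"
  have "line N t = mat 1 + L"
    by (simp add: line_def L_def vec_eq_iff)
  moreover have "(A + B) ** h = A ** h + B ** h" for A B :: mat4
    by (simp add: vec_eq_iff mult_nth distrib_right sum.distrib)
  ultimately have "g ** line N t ** h = g ** h + g ** L ** h"
    by (simp add: matrix_add_ldistrib)
  moreover have "(g ** L ** h) $ a $ b = t * (g ** N ** h) $ a $ b" for a b
    by (simp add: mult_nth L_def sum_distrib_left sum_distrib_right algebra_simps)
  ultimately show ?thesis
    by (simp add: vec_eq_iff line_def assms)
qed

definition elementary :: "nat \<Rightarrow> mat4" where
  "elementary k = (\<chi> a b. if a = lo k \<and> b = hi k then 1 else 0)"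

lemma line_elementary:
  assumes "k \<in> {1,2,3}"
  shows "line (elementary k) t = unip k t"
  using lo_less_hi[OF assms] by (auto simp: vec_eq_iff line_def elementary_def unip_nth mat_nth)

context bsdh_word
begin

definition dir :: "nat \<Rightarrow> mat4" where
  "dir j = g ** elementary (ks ! j) ** matrix_inv g"

abbreviation u :: "nat \<Rightarrow> complex \<Rightarrow> mat4" where
  "u j t \<equiv> line (dir j) t"

lemma u_eq:
  assumes "j < n"
  shows "u j t = g ** unip (ks ! j) t ** matrix_inv g"
  unfolding dir_def
  by (simp add: line_conjugate matrix_inv_cancel det_g line_elementary[OF nth_ks[OF assms]])

lemma hat_u: "j < n \<Longrightarrow> hat (u j t) = unip (ks ! j) t"
  by (simp add: u_eq)

lemma det_u: "j < n \<Longrightarrow> det (u j t) = 1"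
  using det_hat[of "u j t"] by (simp add: hat_u det_unip[OF nth_ks])

lemma u_in_parabolic: "j < n \<Longrightarrow> u j t \<in> minimal_parabolic g (ks ! j)"
  by (simp add: u_eq unip_in_minimal_parabolic[OF nth_ks])

lemma u_mult: "j < n \<Longrightarrow> u j s ** u j t = u j (s + t)"
  by (simp add: u_eq conjugate_mult[OF g] unip_mult[OF nth_ks])

lemma move_in_PP:
  assumes "j < n" "p \<in> PP"
  shows "move j (dir j) t p \<in> PP"
  using assms minimal_parabolic_mult[OF nth_ks[OF assms(1)] PP_nth[OF assms(2,1)] u_in_parabolic[OF assms(1), of t]]
  by (auto simp: move_def parabolic_product_def PiE_iff extensional_def)

abbreviation X :: "nat \<Rightarrow> ((nat \<Rightarrow> mat4) \<Rightarrow> complex) \<Rightarrow> (nat \<Rightarrow> mat4) \<Rightarrow> complex" where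
  "X j \<equiv> derivative_along j (dir j)"

text \<open>
  Coordinates on the quotient around the class of \<open>p\<^sub>0\<close>. Near \<open>p\<^sub>0\<close>, the first factor of a tuple \<open>q\<close> is
  \<open>p\<^sub>0 0 ** u 0 t ** b\<close> for a unique \<open>t\<close> and \<open>b\<close> in the Borel subgroup. The residue \<open>b\<close> is pushed into the
  next factor, and so on. Stage \<open>j\<close> only involves the first \<open>j\<close> factors of \<open>q\<close>, which will make
  Jacobian matrices triangular.
\<close>

primrec residue :: "(nat \<Rightarrow> mat4) \<Rightarrow> (nat \<Rightarrow> mat4) \<Rightarrow> nat \<Rightarrow> mat4" where
  "residue p0 q 0 = mat 1"
| "residue p0 q (Suc j) =
    u j (- slope (ks ! j) (hat (matrix_inv (p0 j) ** residue p0 q j ** q j))) **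
      (matrix_inv (p0 j) ** residue p0 q j ** q j)"

definition local_factor :: "(nat \<Rightarrow> mat4) \<Rightarrow> (nat \<Rightarrow> mat4) \<Rightarrow> nat \<Rightarrow> mat4" where
  "local_factor p0 q j = matrix_inv (p0 j) ** residue p0 q j ** q j"

definition denom :: "(nat \<Rightarrow> mat4) \<Rightarrow> (nat \<Rightarrow> mat4) \<Rightarrow> nat \<Rightarrow> complex" where
  "denom p0 q j = hat (local_factor p0 q j) $ hi (ks ! j) $ hi (ks ! j)"

definition coord :: "(nat \<Rightarrow> mat4) \<Rightarrow> (nat \<Rightarrow> mat4) \<Rightarrow> nat \<Rightarrow> complex" where
  "coord p0 q j = slope (ks ! j) (hat (local_factor p0 q j))"

lemma residue_Suc: "residue p0 q (Suc j) = u j (- coord p0 q j) ** local_factor p0 q j"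
  by (simp add: coord_def local_factor_def)

text \<open>
  The tuples for which the first \<open>j\<close> stages do not divide by zero.
\<close>

definition domain_upto :: "(nat \<Rightarrow> mat4) \<Rightarrow> nat \<Rightarrow> (nat \<Rightarrow> mat4) set" where
  "domain_upto p0 j = {q \<in> PP. \<forall>i<j. denom p0 q i \<noteq> 0}"

abbreviation dom :: "(nat \<Rightarrow> mat4) \<Rightarrow> (nat \<Rightarrow> mat4) set" where
  "dom p0 \<equiv> domain_upto p0 n"

lemma domain_upto_subset: "domain_upto p0 j \<subseteq> PP"
  by (auto simp: domain_upto_def)

lemma domain_upto_mono: "i \<le> j \<Longrightarrow> domain_upto p0 j \<subseteq> domain_upto p0 i"
  by (auto simp: domain_upto_def)

lemma residue_cong: "(\<And>i. i < j \<Longrightarrow> q i = q' i) \<Longrightarrow> residue p0 q j = residue p0 q' j"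
  by (induction j) simp_all

lemma coord_cong: "(\<And>i. i \<le> j \<Longrightarrow> q i = q' i) \<Longrightarrow> coord p0 q j = coord p0 q' j"
  unfolding coord_def local_factor_def using residue_cong[of j q q' p0] by simp

lemma det_PP: "p \<in> PP \<Longrightarrow> j < n \<Longrightarrow> det (p j) = 1"
  using minimal_parabolic_det[OF nth_ks PP_nth] by blast

lemma borel_diag_nonzero: "b \<in> borel_opp g \<Longrightarrow> hat b $ a $ a \<noteq> 0"
  using lower_diag_nonzero[of "hat b"] by (simp add: borel_opp_iff)

definition regular_matrix :: "(nat \<Rightarrow> mat4) set \<Rightarrow> ((nat \<Rightarrow> mat4) \<Rightarrow> mat4) \<Rightarrow> bool" where
  "regular_matrix V M \<longleftrightarrow> (\<forall>a b. (\<lambda>q. M q $ a $ b) \<in> regular S V)"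

lemma regular_matrix_mult:
  assumes V: "openin (topo S) V" and "regular_matrix V M" "regular_matrix V N"
  shows "regular_matrix V (\<lambda>q. M q ** N q)"
  unfolding regular_matrix_def mult_nth
  using assms openin_subset[OF V]
  by (intro allI regular_sum[OF V] regular_mult) (auto simp: regular_matrix_def)

lemma regular_matrix_const: "openin (topo S) V \<Longrightarrow> regular_matrix V (\<lambda>q. M)"
  unfolding regular_matrix_def by (intro allI regular_polynomial polynomials.const)

lemma regular_matrix_entry: "openin (topo S) V \<Longrightarrow> regular_matrix V (\<lambda>q. q j)"
  unfolding regular_matrix_def by (intro allI regular_polynomial polynomials.entry)

lemma regular_matrix_hat: "openin (topo S) V \<Longrightarrow> regular_matrix V M \<Longrightarrow> regular_matrix V (\<lambda>q. hat (M q))"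
  unfolding hat_def by (intro regular_matrix_mult regular_matrix_const)

lemma regular_matrix_u:
  assumes V: "openin (topo S) V" and "\<phi> \<in> regular S V"
  shows "regular_matrix V (\<lambda>q. u j (\<phi> q))"
proof -
  have VP: "V \<subseteq> PP" using openin_subset[OF V] by simp
  note const = regular_polynomial[OF V polynomials.const]
  show ?thesis
    unfolding regular_matrix_def line_def vec_lambda_beta
    by (intro allI regular_add[OF const regular_mult[OF assms(2) const VP] VP])
qed

definition chart :: "(nat \<Rightarrow> mat4) \<Rightarrow> (nat \<Rightarrow> complex) \<Rightarrow> nat \<Rightarrow> mat4" where
  "chart p0 t = (\<lambda>j\<in>{..<n}. p0 j ** u j (t j))"

context
  fixes p0 assumes p0: "p0 \<in> PP"
begin

lemma local_factor_in_parabolic: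
  assumes "q \<in> PP" "j < n" "residue p0 q j \<in> borel_opp g"
  shows "local_factor p0 q j \<in> minimal_parabolic g (ks ! j)"
  unfolding local_factor_def using assms p0
  by (intro minimal_parabolic_mult[OF nth_ks] minimal_parabolic_inv[OF nth_ks] PP_nth
      borel_opp_subset_minimal_parabolic[OF nth_ks]) auto

lemma residue_in_borel: "j \<le> n \<Longrightarrow> q \<in> domain_upto p0 j \<Longrightarrow> residue p0 q j \<in> borel_opp g"
proof (induction j)
  case 0
  then show ?case by (simp add: borel_opp_one)
next
  case (Suc j)
  then have j: "j < n" and q: "q \<in> PP" and nz: "denom p0 q j \<noteq> 0"
    and "residue p0 q j \<in> borel_opp g"
    using domain_upto_mono[of j "Suc j" p0] by (auto simp: domain_upto_def)
  then have A: "local_factor p0 q j \<in> minimal_parabolic g (ks ! j)"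
    by (intro local_factor_in_parabolic)
  show ?case
    unfolding residue_Suc borel_opp_iff hat_mult hat_u[OF j] coord_def
    using nz minimal_parabolic_det[OF nth_ks[OF j] A] det_u[OF j]
      lower_unip_slope[OF nth_ks[OF j] minimal_parabolic_almost_lower[OF nth_ks[OF j] A]]
    by (simp add: det_mul denom_def)
qed

lemma local_factor_act_of_residue:
  assumes "q \<in> PP" "b \<in> borel_tuples" "j < n" "residue p0 (act q b) j = residue p0 q j ** prev b j"
  shows "local_factor p0 (act q b) j = local_factor p0 q j ** b j"
proof -
  have "local_factor p0 (act q b) j = matrix_inv (p0 j) ** residue p0 q j **
      (prev b j ** (matrix_inv (prev b j) ** (q j ** b j)))"
    using assms by (simp add: local_factor_def act_nth matrix_mul_assoc)
  then show ?thesis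
    using det_prev[OF assms(2,3)] by (simp add: matrix_inv_cancel local_factor_def matrix_mul_assoc)
qed

lemma coord_act_of_local_factor:
  assumes q: "q \<in> PP" "b \<in> borel_tuples" "j < n" "residue p0 q j \<in> borel_opp g"
    and eq: "local_factor p0 (act q b) j = local_factor p0 q j ** b j"
  shows "coord p0 (act q b) j = coord p0 q j" "denom p0 (act q b) j \<noteq> 0 \<longleftrightarrow> denom p0 q j \<noteq> 0"
proof -
  have A: "almost_lower (ks ! j) (hat (local_factor p0 q j))"
    using local_factor_in_parabolic[OF q(1,3,4)] q(3)
    by (intro minimal_parabolic_almost_lower[OF nth_ks])
  have b: "lower (hat (b j))" "hat (b j) $ hi (ks ! j) $ hi (ks ! j) \<noteq> 0"
    using borel_tuples_nth[OF q(2,3)] borel_diag_nonzero by (auto simp: borel_opp_iff)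
  show "coord p0 (act q b) j = coord p0 q j"
    using slope_mult_lower[OF nth_ks[OF q(3)] A b] by (simp add: coord_def eq hat_mult)
  show "denom p0 (act q b) j \<noteq> 0 \<longleftrightarrow> denom p0 q j \<noteq> 0"
    using almost_lower_mult_lower(1)[OF nth_ks[OF q(3)] A b(1)] b(2)
    by (simp add: denom_def eq hat_mult)
qed

text \<open>
  Along an orbit the residues absorb the group element, while coordinates and domain do not change: the
  coordinates descend to the quotient.
\<close>

lemma residue_act:
  "b \<in> borel_tuples \<Longrightarrow> j \<le> n \<Longrightarrow> q \<in> domain_upto p0 j \<Longrightarrow>
    act q b \<in> domain_upto p0 j \<and> residue p0 (act q b) j = residue p0 q j ** prev b j"
proof (induction j)
  case 0
  then show ?case by (auto simp: prev_def domain_upto_def act_in_PP)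
next
  case (Suc j)
  then have j: "j < n" and q: "q \<in> PP" "q \<in> domain_upto p0 j" "denom p0 q j \<noteq> 0"
    using domain_upto_mono[of j "Suc j" p0] by (auto simp: domain_upto_def)
  have IH: "act q b \<in> domain_upto p0 j" "residue p0 (act q b) j = residue p0 q j ** prev b j"
    using Suc.IH Suc.prems j q by auto
  note A = local_factor_act_of_residue[OF q(1) Suc.prems(1) j IH(2)]
  have r: "residue p0 q j \<in> borel_opp g"
    using residue_in_borel[of j q] j q by simp
  note C = coord_act_of_local_factor[OF q(1) Suc.prems(1) j r A]
  have "act q b \<in> domain_upto p0 (Suc j)"
    using IH(1) C(2) q(3) by (auto simp: domain_upto_def less_Suc_eq)
  moreover have "residue p0 (act q b) (Suc j) = residue p0 q (Suc j) ** prev b (Suc j)"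
    unfolding residue_Suc C(1) A by (simp add: prev_def matrix_mul_assoc)
  ultimately show ?case ..
qed

lemma act_in_dom: "b \<in> borel_tuples \<Longrightarrow> q \<in> dom p0 \<Longrightarrow> act q b \<in> dom p0"
  using residue_act[of b n q] by simp

lemma local_factor_act:
  assumes "b \<in> borel_tuples" "j < n" "q \<in> domain_upto p0 j"
  shows "local_factor p0 (act q b) j = local_factor p0 q j ** b j"
    "coord p0 (act q b) j = coord p0 q j"
proof -
  have q: "q \<in> PP" using assms(3) domain_upto_subset by blast
  show *: "local_factor p0 (act q b) j = local_factor p0 q j ** b j"
    using residue_act[of b j q] assms by (intro local_factor_act_of_residue q) auto
  show "coord p0 (act q b) j = coord p0 q j"
    using residue_in_borel[of j q] assms by (intro coord_act_of_local_factor q *) auto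
qed

lemma base_point: "j \<le> n \<Longrightarrow> p0 \<in> domain_upto p0 j \<and> residue p0 p0 j = mat 1"
proof (induction j)
  case 0
  then show ?case using p0 by (simp add: domain_upto_def)
next
  case (Suc j)
  then have j: "j < n" and IH: "p0 \<in> domain_upto p0 j" "residue p0 p0 j = mat 1" by auto
  have A: "local_factor p0 p0 j = mat 1"
    by (simp add: local_factor_def IH matrix_inv_cancel det_PP[OF p0 j])
  have "coord p0 p0 j = 0" "denom p0 p0 j = 1"
    using lo_less_hi[OF nth_ks[OF j]] by (auto simp: coord_def denom_def A slope_def mat_nth)
  then show ?case
    using IH A by (auto simp: residue_Suc domain_upto_def less_Suc_eq simp del: residue.simps)
qed

lemma base_point_in_dom: "p0 \<in> dom p0"
  using base_point[of n] by simp

lemma base_point_local_factor: "j < n \<Longrightarrow> local_factor p0 p0 j = mat 1"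
  using base_point[of j] by (simp add: local_factor_def matrix_inv_cancel det_PP[OF p0])

lemma X_coord_later:
  assumes "j < l"
  shows "X l (\<lambda>q. coord p0 q j) p = 0"
proof -
  have "coord p0 (move l (dir l) t p) j = coord p0 p j" for t
    using assms by (intro coord_cong) (auto simp: move_def)
  then show ?thesis by (simp add: derivative_along_def)
qed

text \<open>
  At \<open>act p0 b\<close>, moving the \<open>j\<close>-th factor makes the local factor run through \<open>b j ** u j t\<close>. The
  derivative of its slope at \<open>0\<close> is the value of the root \<open>\<alpha>\<^sub>k\<close>, where \<open>k = ks ! j\<close>, at the diagonal part
  of \<open>b j\<close>.
\<close>

lemma X_coord_same:
  assumes b: "b \<in> borel_tuples" and j: "j < n"
  shows "X j (\<lambda>q. coord p0 q j) (act p0 b) =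
    hat (b j) $ lo (ks ! j) $ lo (ks ! j) / hat (b j) $ hi (ks ! j) $ hi (ks ! j)"
proof -
  let ?k = "ks ! j" and ?b = "hat (b j)"
  have bj: "lower ?b" "?b $ hi ?k $ hi ?k \<noteq> 0"
    using borel_tuples_nth[OF b j] borel_diag_nonzero by (auto simp: borel_opp_iff)
  have p0j: "p0 \<in> domain_upto p0 j" using base_point[of j] j by simp
  have "local_factor p0 (move j (dir j) t (act p0 b)) j = local_factor p0 (act p0 b) j ** u j t" for t
    using residue_cong[of j "move j (dir j) t (act p0 b)" "act p0 b" p0]
    by (simp add: local_factor_def move_def matrix_mul_assoc)
  then have "local_factor p0 (move j (dir j) t (act p0 b)) j = b j ** u j t" for t
    by (simp add: local_factor_act[OF b j p0j] base_point_local_factor[OF j])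
  then have "coord p0 (move j (dir j) t (act p0 b)) j = slope ?k (?b ** unip ?k t)" for t
    by (simp add: coord_def hat_mult hat_u[OF j])
  moreover have "slope ?k (?b ** unip ?k t) = t * ?b $ lo ?k $ lo ?k / (?b $ hi ?k $ hi ?k + t * ?b $ hi ?k $ lo ?k)"
    for t
    using nth_ks[OF j] bj(1) unfolding lower_def
    by (elim lo_hi_cases) (simp_all add: slope_def all_4 mult_nth sum_4' unip_nth order_4 algebra_simps)
  moreover have "((\<lambda>t. t * ?b $ lo ?k $ lo ?k / (?b $ hi ?k $ hi ?k + t * ?b $ hi ?k $ lo ?k))
      has_field_derivative ?b $ lo ?k $ lo ?k / ?b $ hi ?k $ hi ?k) (at 0)"
    using bj(2) by (auto intro!: derivative_eq_intros simp: field_simps)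
  ultimately show ?thesis
    by (simp add: derivative_along_def DERIV_imp_deriv)
qed

lemma chart_in_PP: "chart p0 t \<in> PP"
  using minimal_parabolic_mult[OF nth_ks PP_nth[OF p0] u_in_parabolic]
  by (auto simp: parabolic_product_def PiE_iff extensional_def chart_def)

text \<open>
  Undoing all residues moves a tuple, inside its orbit, into the slice \<open>chart p0\<close>. Hence a function on the
  quotient is determined near the class of \<open>p\<^sub>0\<close> by its restriction to this slice.
\<close>

lemma orbit_of_chart_coord:
  assumes q: "q \<in> dom p0"
  shows "orbit_of (chart p0 (coord p0 q)) = orbit_of q"
proof -
  define c where "c = (\<lambda>j\<in>{..<n}. matrix_inv (residue p0 q (Suc j)))"
  have qj: "q \<in> domain_upto p0 j" if "j \<le> n" for j
    using domain_upto_mono[OF that] q by blast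
  have qP: "q \<in> PP" using q domain_upto_subset by blast
  have r: "residue p0 q j \<in> borel_opp g" if "j \<le> n" for j
    using residue_in_borel[OF that qj[OF that]] .
  have rd: "det (residue p0 q j) = 1" if "j \<le> n" for j
    using r[OF that] by (simp add: borel_opp_iff)
  have c: "c \<in> borel_tuples"
    using r by (auto simp: c_def borel_tuples_def intro!: borel_opp_inv simp del: residue.simps)
  have "act q c = chart p0 (coord p0 q)"
  proof (rule tuple_eqI)
    fix j assume j: "j < n"
    have prev: "matrix_inv (prev c j) = residue p0 q j"
    proof (cases j)
      case (Suc i)
      then have "prev c j = matrix_inv (residue p0 q j)" using j by (simp add: prev_def c_def)
      then show ?thesis
        using rd[of j] j by (intro matrix_inv_unique) (simp_all add: matrix_inv_cancel)
    qed (simp add: prev_def)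
    let ?A = "local_factor p0 q j"
    have A: "det ?A = 1"
      using minimal_parabolic_det[OF nth_ks[OF j] local_factor_in_parabolic[OF qP j r]] j by simp
    have eq: "residue p0 q j ** q j = p0 j ** ?A"
      by (simp add: local_factor_def matrix_mul_assoc matrix_inv_cancel det_PP[OF p0 j])
    have "matrix_inv (residue p0 q (Suc j)) = matrix_inv ?A ** matrix_inv (u j (- coord p0 q j))"
      unfolding residue_Suc by (rule matrix_inv_mult) (simp_all add: A det_u[OF j])
    also have "matrix_inv (u j (- coord p0 q j)) = u j (coord p0 q j)"
      by (rule matrix_inv_unique) (simp_all add: det_u[OF j] u_mult[OF j])
    finally have cj: "c j = matrix_inv ?A ** u j (coord p0 q j)"
      using j by (simp add: c_def del: residue.simps)
    have "act q c j = p0 j ** (?A ** (matrix_inv ?A ** u j (coord p0 q j)))"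
      unfolding act_nth[OF j] prev eq cj by (simp only: matrix_mul_assoc)
    then show "act q c j = chart p0 (coord p0 q) j"
      using j by (simp add: matrix_inv_cancel A chart_def)
  qed (use act_in_PP[OF qP c] chart_in_PP in auto)
  then show ?thesis using orbit_of_act[OF qP c] by simp
qed

text \<open>
  Each stage is a rational expression in the previous ones, with denominators that do not vanish on the
  domain of the stage.
\<close>

lemma regular_residue:
  "j \<le> n \<Longrightarrow> openin (topo S) (domain_upto p0 j) \<and> regular_matrix (domain_upto p0 j) (\<lambda>q. residue p0 q j)"
proof (induction j)
  case 0
  have "domain_upto p0 0 = topspace (topo S)" by (auto simp: domain_upto_def)
  then have "openin (topo S) (domain_upto p0 0)" by (metis openin_topspace)
  then show ?case by (simp add: regular_matrix_const)
next
  case (Suc j)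
  let ?V = "domain_upto p0 j" and ?W = "domain_upto p0 (Suc j)"
  have V: "openin (topo S) ?V" and "regular_matrix ?V (\<lambda>q. residue p0 q j)"
    using Suc by auto
  then have A: "regular_matrix ?V (\<lambda>q. local_factor p0 q j)"
    unfolding local_factor_def
    by (intro regular_matrix_mult regular_matrix_const regular_matrix_entry)
  then have den: "(\<lambda>q. denom p0 q j) \<in> regular S ?V"
    using regular_matrix_hat[OF V A] by (simp add: denom_def regular_matrix_def)
  have "?W = {q \<in> ?V. denom p0 q j \<noteq> 0}" by (auto simp: domain_upto_def less_Suc_eq)
  then have W: "openin (topo S) ?W"
    using openin_regular_nonzero[OF den domain_upto_subset] by simp
  have restrict: "\<phi> \<in> regular S ?W" if "\<phi> \<in> regular S ?V" for \<phi>
    using regular_restrict[OF that W] domain_upto_mono[of j "Suc j" p0] domain_upto_subset by simp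
  have A': "regular_matrix ?W (\<lambda>q. local_factor p0 q j)"
    using A restrict by (auto simp: regular_matrix_def)
  have "(\<lambda>q. inverse (denom p0 q j)) \<in> regular S ?W"
    by (rule regular_inverse[OF restrict[OF den] domain_upto_subset]) (simp add: domain_upto_def)
  then have "(\<lambda>q. hat (local_factor p0 q j) $ lo (ks ! j) $ hi (ks ! j) * inverse (denom p0 q j)) \<in> regular S ?W"
    using regular_matrix_hat[OF W A'] domain_upto_subset
    by (intro regular_mult) (auto simp: regular_matrix_def)
  then have "(\<lambda>q. coord p0 q j) \<in> regular S ?W"
    by (simp add: coord_def slope_def denom_def divide_inverse)
  then have "(\<lambda>q. - 1 * coord p0 q j) \<in> regular S ?W"
    by (rule regular_mult[OF regular_polynomial[OF W polynomials.const] _ domain_upto_subset])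
  then have "regular_matrix ?W (\<lambda>q. residue p0 q (Suc j))"
    unfolding residue_Suc using A' by (intro regular_matrix_mult[OF W] regular_matrix_u[OF W]) simp_all
  then show ?case using W by simp
qed

lemma openin_dom: "openin (topo S) (dom p0)"
  using regular_residue[of n] by simp

lemma regular_coord:
  assumes j: "j < n"
  shows "(\<lambda>q. coord p0 q j) \<in> regular S (dom p0)"
proof -
  have restrict: "\<phi> \<in> regular S (dom p0)" if "\<phi> \<in> regular S (domain_upto p0 j)" for \<phi>
    using regular_restrict[OF that openin_dom] domain_upto_mono[of j n p0] domain_upto_subset j by simp
  have "regular_matrix (dom p0) (\<lambda>q. residue p0 q j)"
    using regular_residue[of j] j restrict by (auto simp: regular_matrix_def)
  then have "regular_matrix (dom p0) (\<lambda>q. hat (local_factor p0 q j))"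
    unfolding local_factor_def
    by (intro regular_matrix_mult regular_matrix_const regular_matrix_entry regular_matrix_hat openin_dom)
  then have reg: "(\<lambda>q. hat (local_factor p0 q j) $ a $ b) \<in> regular S (dom p0)" for a b
    by (simp add: regular_matrix_def)
  then have "(\<lambda>q. inverse (denom p0 q j)) \<in> regular S (dom p0)"
    unfolding denom_def
    by (rule regular_inverse) (use j in \<open>auto simp: domain_upto_def denom_def\<close>)
  then have "(\<lambda>q. hat (local_factor p0 q j) $ lo (ks ! j) $ hi (ks ! j) * inverse (denom p0 q j))
      \<in> regular S (dom p0)"
    by (intro regular_mult reg domain_upto_subset)
  then show ?thesis by (simp add: coord_def slope_def denom_def divide_inverse)
qed

end

end

section \<open>Multi-derivations at a point\<close>

text \<open>
  The determinant of the matrix \<open>(M k l)\<close>, \<open>k, l < n\<close>, for a size \<open>n\<close> that is a term.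
\<close>

definition leibniz_det :: "nat \<Rightarrow> (nat \<Rightarrow> nat \<Rightarrow> complex) \<Rightarrow> complex" where
  "leibniz_det n M = (\<Sum>\<pi> | \<pi> permutes {..<n}. of_int (sign \<pi>) * (\<Prod>k<n. M k (\<pi> k)))"

lemma leibniz_det_cong:
  assumes "\<And>k l. k < n \<Longrightarrow> l < n \<Longrightarrow> M k l = N k l"
  shows "leibniz_det n M = leibniz_det n N"
  unfolding leibniz_det_def
proof (intro sum.cong refl arg_cong2[of _ _ _ _ "(*)"] prod.cong)
  fix \<pi> k assume "\<pi> \<in> {\<pi>. \<pi> permutes {..<n}}" "k \<in> {..<n}"
  then show "M k (\<pi> k) = N k (\<pi> k)"
    using permutes_in_image[of \<pi> "{..<n}" k] by (intro assms) auto
qed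

lemma leibniz_det_row_linear:
  assumes "k < n"
  shows "leibniz_det n (M(k := (\<lambda>l. c * a l + d * b l))) =
    c * leibniz_det n (M(k := a)) + d * leibniz_det n (M(k := b))"
proof -
  have row: "(\<Prod>i<n. (M(k := r)) i (\<pi> i)) = r (\<pi> k) * (\<Prod>i\<in>{..<n} - {k}. M i (\<pi> i))" for r \<pi>
    using assms by (subst prod.remove[of "{..<n}" k]) (auto intro!: prod.cong)
  show ?thesis
    unfolding leibniz_det_def row sum_distrib_left sum.distrib[symmetric]
    by (intro sum.cong refl) (simp add: algebra_simps)
qed

text \<open>
  Reindexing the sum by a transposition of the two rows changes every sign and no product, so the
  determinant equals its own negative.
\<close>

lemma leibniz_det_equal_rows:
  assumes jk: "j < k" "k < n" and eq: "\<And>l. l < n \<Longrightarrow> M j l = M k l"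
  shows "leibniz_det n M = 0"
proof -
  let ?\<tau> = "Transposition.transpose j k"
  let ?t = "\<lambda>\<pi>. of_int (sign \<pi>) * (\<Prod>i<n. M i (\<pi> i))"
  have \<tau>: "?\<tau> permutes {..<n}" using jk by (intro permutes_swap_id) auto
  have "leibniz_det n M = (\<Sum>\<pi> | \<pi> permutes {..<n}. ?t (\<pi> \<circ> ?\<tau>))"
    unfolding leibniz_det_def by (rule sum_permutations_compose_right[OF \<tau>])
  also have "\<dots> = (\<Sum>\<pi> | \<pi> permutes {..<n}. - ?t \<pi>)"
  proof (intro sum.cong refl)
    fix \<pi> assume "\<pi> \<in> {\<pi>. \<pi> permutes {..<n}}"
    then have \<pi>: "\<pi> permutes {..<n}" by simp
    have "sign (\<pi> \<circ> ?\<tau>) = - sign \<pi>"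
      using jk \<pi> \<tau> permutation_permutes[of \<pi>] permutes_imp_permutation[OF _ \<pi>]
        permutes_imp_permutation[OF _ \<tau>]
      by (simp add: sign_compose sign_swap_id)
    moreover have "(\<Prod>i<n. M i ((\<pi> \<circ> ?\<tau>) i)) = (\<Prod>i<n. M i (\<pi> i))"
    proof -
      have *: "M i (\<pi> l) = M (?\<tau> i) (\<pi> l)" if "i < n" "l < n" for i l
        using eq[of "\<pi> l"] permutes_in_image[OF \<pi>, of l] that
        by (auto simp: Transposition.transpose_def)
      have "(\<Prod>i<n. M i (\<pi> i)) = (\<Prod>i<n. M (?\<tau> i) (\<pi> (?\<tau> i)))"
        by (rule prod.permute[OF \<tau>, unfolded comp_def])
      also have "\<dots> = (\<Prod>i<n. M i ((\<pi> \<circ> ?\<tau>) i))"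
      proof (intro prod.cong refl)
        fix i assume "i \<in> {..<n}"
        then show "M (?\<tau> i) (\<pi> (?\<tau> i)) = M i ((\<pi> \<circ> ?\<tau>) i)"
          using *[of i "?\<tau> i"] permutes_in_image[OF \<tau>, of i] by simp
      qed
      finally show ?thesis by (rule sym)
    qed
    ultimately show "?t (\<pi> \<circ> ?\<tau>) = - ?t \<pi>" by simp
  qed
  also have "\<dots> = - leibniz_det n M"
    by (simp add: leibniz_det_def sum_negf)
  finally show ?thesis by simp
qed

text \<open>
  A permutation other than the identity moves some \<open>k\<close> upwards.
\<close>

lemma leibniz_det_lower:
  assumes "\<And>k l. k < l \<Longrightarrow> l < n \<Longrightarrow> M k l = 0"
  shows "leibniz_det n M = (\<Prod>k<n. M k k)"
proof -
  have "of_int (sign \<pi>) * (\<Prod>k<n. M k (\<pi> k)) = 0" if \<pi>: "\<pi> permutes {..<n}" "\<pi> \<noteq> id" for \<pi>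
  proof -
    obtain k where "k < n" "k < \<pi> k"
      using permutes_natset_le[OF \<pi>(1)] \<pi>(2) by (meson lessThan_iff linorder_not_less)
    moreover have "\<pi> k < n" using permutes_in_image[OF \<pi>(1), of k] \<open>k < n\<close> by simp
    ultimately have "M k (\<pi> k) = 0" using assms by simp
    then show ?thesis using \<open>k < n\<close> by auto
  qed
  then have "leibniz_det n M = (\<Sum>\<pi>\<in>{id}. of_int (sign \<pi>) * (\<Prod>k<n. M k (\<pi> k)))"
    unfolding leibniz_det_def
    by (intro sum.mono_neutral_right) (auto simp: finite_permutations permutes_id)
  then show ?thesis by (simp add: sign_id)
qed

lemma mult_line_nth: "(A ** line N t) $ a $ b = A $ a $ b + t * (A ** N) $ a $ b"
proof -
  have "(\<Sum>c\<in>UNIV. A $ a $ c * mat 1 $ c $ b) = (A ** mat 1) $ a $ b"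
    by (simp only: mult_nth)
  then show ?thesis
    by (simp add: mult_nth line_def distrib_left sum.distrib sum_distrib_left algebra_simps)
qed

definition point_derivation ::
    "'a function_space \<Rightarrow> 'a \<Rightarrow> (('a \<Rightarrow> complex) \<Rightarrow> complex) \<Rightarrow> bool" where
  "point_derivation S z \<delta> \<longleftrightarrow>
    (\<forall>f\<in>regular_at S z. \<forall>h\<in>regular_at S z. \<forall>c.
      \<delta> (\<lambda>x. f x + h x) = \<delta> f + \<delta> h \<and>
      \<delta> (\<lambda>x. c * f x) = c * \<delta> f \<and>
      \<delta> (\<lambda>x. f x * h x) = f z * \<delta> h + h z * \<delta> f \<and>
      ((\<exists>U. openin (topo S) U \<and> z \<in> U \<and> (\<forall>x\<in>U. f x = h x)) \<longrightarrow> \<delta> f = \<delta> h))"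

lemma point_derivationD:
  assumes "point_derivation S z \<delta>" "f \<in> regular_at S z" "h \<in> regular_at S z"
  shows "\<delta> (\<lambda>x. f x + h x) = \<delta> f + \<delta> h"
    "\<delta> (\<lambda>x. c * f x) = c * \<delta> f"
    "\<delta> (\<lambda>x. f x * h x) = f z * \<delta> h + h z * \<delta> f"
    "openin (topo S) U \<Longrightarrow> z \<in> U \<Longrightarrow> (\<And>x. x \<in> U \<Longrightarrow> f x = h x) \<Longrightarrow> \<delta> f = \<delta> h"
proof -
  note * = assms(1)[unfolded point_derivation_def, THEN bspec, OF assms(2), THEN bspec, OF assms(3),
    THEN spec, of c]
  show "\<delta> (\<lambda>x. f x + h x) = \<delta> f + \<delta> h" "\<delta> (\<lambda>x. c * f x) = c * \<delta> f"
    "\<delta> (\<lambda>x. f x * h x) = f z * \<delta> h + h z * \<delta> f"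
    using * by auto
  show "openin (topo S) U \<Longrightarrow> z \<in> U \<Longrightarrow> (\<And>x. x \<in> U \<Longrightarrow> f x = h x) \<Longrightarrow> \<delta> f = \<delta> h"
    using * by auto
qed

lemma point_derivation_const:
  assumes "point_derivation S z \<delta>" "(\<lambda>_. 1) \<in> regular_at S z"
  shows "\<delta> (\<lambda>_. c) = 0"
proof -
  have "\<delta> (\<lambda>_. 1) = \<delta> (\<lambda>_. 1) + \<delta> (\<lambda>_. 1)"
    using point_derivationD(3)[OF assms(1,2,2)] by simp
  then show ?thesis
    using point_derivationD(2)[OF assms(1,2,2), of c] by simp
qed

context
  fixes S :: "'a function_space" and z :: 'a and n :: nat and D
  assumes D: "D \<in> anticanonical_fibre n S z"
begin

lemma fibre_point_derivation:
  assumes "length fs = n" "set fs \<subseteq> regular_at S z" "k < n"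
  shows "point_derivation S z (\<lambda>f. D (fs[k := f]))"
  unfolding point_derivation_def
proof (intro ballI allI)
  fix f h c assume "f \<in> regular_at S z" "h \<in> regular_at S z"
  then have pre: "length fs = n \<and> set fs \<subseteq> regular_at S z \<and> k < n \<and>
      f \<in> regular_at S z \<and> h \<in> regular_at S z"
    using assms by simp
  show "D (fs[k := \<lambda>x. f x + h x]) = D (fs[k := f]) + D (fs[k := h]) \<and>
      D (fs[k := \<lambda>x. c * f x]) = c * D (fs[k := f]) \<and>
      D (fs[k := \<lambda>x. f x * h x]) = f z * D (fs[k := h]) + h z * D (fs[k := f]) \<and>
      ((\<exists>U. openin (topo S) U \<and> z \<in> U \<and> (\<forall>x\<in>U. f x = h x)) \<longrightarrow> D (fs[k := f]) = D (fs[k := h]))"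
    by (rule conjunct1[OF conjunct2[OF D[unfolded anticanonical_fibre_def mem_Collect_eq]],
          THEN spec, THEN spec, THEN spec, THEN spec, THEN spec, THEN mp, OF pre])
qed

lemma fibre_alternating:
  assumes "length fs = n" "set fs \<subseteq> regular_at S z" "j < k" "k < n" "fs ! j = fs ! k"
  shows "D fs = 0"
  using conjunct2[OF conjunct2[OF D[unfolded anticanonical_fibre_def mem_Collect_eq]]] assms by blast

lemma fibre_outside:
  assumes "\<not> (length fs = n \<and> set fs \<subseteq> regular_at S z)"
  shows "D fs = 0"
  using conjunct1[OF D[unfolded anticanonical_fibre_def mem_Collect_eq]] assms by blast

text \<open>
  Polarisation of the alternating property, with both slots filled by the sum of the two entries.
\<close>

lemma fibre_antisymmetric:
  assumes fs: "length fs = n" "set fs \<subseteq> regular_at S z" and jk: "j < k" "k < n"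
    and add: "(\<lambda>x. (fs ! j) x + (fs ! k) x) \<in> regular_at S z"
  shows "D (fs[j := fs ! k, k := fs ! j]) = - D fs"
proof -
  define a where "a = fs ! j"
  define b where "b = fs ! k"
  have ab: "a \<in> regular_at S z" "b \<in> regular_at S z"
    using fs jk nth_mem by (auto simp: a_def b_def)
  let ?E = "\<lambda>u v. D (fs[j := u, k := v])"
  have set: "set (fs[j := u]) \<subseteq> regular_at S z" if "u \<in> regular_at S z" for u
    using fs that by (meson set_update_subsetI)
  have alt: "?E u u = 0" if "u \<in> regular_at S z" for u
    using jk fs that set set_update_subsetI[OF set[OF that] that]
    by (intro fibre_alternating[OF _ _ jk]) auto
  have right: "?E u (\<lambda>x. a x + b x) = ?E u a + ?E u b" if "u \<in> regular_at S z" for u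
    using point_derivationD(1)[OF fibre_point_derivation[of "fs[j := u]" k] ab] set[OF that] fs jk
    by simp
  have left: "?E (\<lambda>x. a x + b x) v = ?E a v + ?E b v" if "v \<in> regular_at S z" for v
    using point_derivationD(1)[OF fibre_point_derivation[of "fs[k := v]" j] ab]
      set_update_subsetI[OF fs(2) that] fs jk
    by (simp add: list_update_swap)
  have add': "(\<lambda>x. a x + b x) \<in> regular_at S z"
    using add by (simp add: a_def b_def)
  have "0 = ?E (\<lambda>x. a x + b x) (\<lambda>x. a x + b x)"
    using alt[OF add'] by simp
  also have "\<dots> = ?E a a + ?E a b + (?E b a + ?E b b)"
    by (simp only: left[OF add'] right[OF ab(1)] right[OF ab(2)])
  finally have "?E b a = - ?E a b"
    using alt ab by (simp add: eq_neg_iff_add_eq_0 add.commute)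
  then show ?thesis by (simp add: a_def b_def)
qed

end

text \<open>
  If the functions \<open>x\<close> span the cotangent space, a fibre of the anti-canonical bundle has dimension at
  most one: its elements are determined by one value.
\<close>

lemma fibre_eqI:
  fixes S :: "'a function_space" and x :: "nat \<Rightarrow> 'a \<Rightarrow> complex" and c :: "('a \<Rightarrow> complex) \<Rightarrow> nat \<Rightarrow> complex"
  assumes D1: "D1 \<in> anticanonical_fibre n S z" and D2: "D2 \<in> anticanonical_fibre n S z"
    and x: "\<And>l. l < n \<Longrightarrow> x l \<in> regular_at S z"
    and add: "\<And>f h. f \<in> regular_at S z \<Longrightarrow> h \<in> regular_at S z \<Longrightarrow> (\<lambda>y. f y + h y) \<in> regular_at S z"
    and span: "\<And>\<delta> f. point_derivation S z \<delta> \<Longrightarrow> f \<in> regular_at S z \<Longrightarrow> \<delta> f = (\<Sum>l<n. c f l * \<delta> (x l))"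
    and eq: "D1 (map x [0..<n]) = D2 (map x [0..<n])"
  shows "D1 = D2"
proof -
  \<comment> \<open>Lists of coordinates: a repetition gives 0, and otherwise transpositions sort the list.\<close>
  have coords: "D1 (map x is) = D2 (map x is)"
    if "m \<le> n" "length is = n" "set is \<subseteq> {..<n}" "\<And>j. j < m \<Longrightarrow> is ! j = j" for m "is"
    using that
  proof (induction m arbitrary: "is" rule: inc_induct)
    case base
    then have "is = [0..<n]" by (intro nth_equalityI) auto
    then show ?case using eq by simp
  next
    case (step m)
    have R: "set (map x is) \<subseteq> regular_at S z" using step.prems x by auto
    show ?case
    proof (cases "distinct is")
      case False
      then obtain j k where "j < k" "k < n" "is ! j = is ! k"
        using step.prems by (metis distinct_conv_nth linorder_neqE_nat)
      then show ?thesis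
        using fibre_alternating[OF D1 _ R, of j k] fibre_alternating[OF D2 _ R, of j k] step.prems
        by simp
    next
      case True
      then have "card (set is) = n" using step.prems distinct_card by metis
      then have "set is = {..<n}" using step.prems by (intro card_subset_eq) auto
      then obtain k where k: "k < n" "is ! k = m"
        using step.hyps step.prems by (metis in_set_conv_nth lessThan_iff)
      have "\<not> k < m" using step.prems(3)[of k] k by auto
      show ?thesis
      proof (cases "k = m")
        case True
        then show ?thesis
          using step.prems k by (intro step.IH) (auto simp: less_Suc_eq)
      next
        case False
        then have mk: "m < k" using \<open>\<not> k < m\<close> by simp
        define is' where "is' = is[m := is ! k, k := is ! m]"
        have "D1 (map x is') = D2 (map x is')"
        proof (rule step.IH)
          show "set is' \<subseteq> {..<n}"
            unfolding is'_def using step.prems mk k nth_mem[of m "is"] nth_mem[of k "is"]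
            by (intro set_update_subsetI) blast+
          show "is' ! j = j" if "j < Suc m" for j
            using that step.prems mk k by (auto simp: is'_def nth_list_update)
        qed (use step.prems in \<open>simp add: is'_def\<close>)
        moreover have "map x is' = (map x is)[m := map x is ! k, k := map x is ! m]"
          using step.prems mk k by (simp add: is'_def map_update)
        moreover have "(\<lambda>y. (map x is ! m) y + (map x is ! k) y) \<in> regular_at S z"
          using R step.prems mk k by (intro add) (auto simp: subset_iff)
        ultimately show ?thesis
          using fibre_antisymmetric[OF D1 _ R mk k(1)] fibre_antisymmetric[OF D2 _ R mk k(1)] step.prems
          by simp
      qed
    qed
  qed
  \<comment> \<open>Arbitrary lists: the entries are expressed by coordinates, one after the other.\<close>
  have all: "D1 fs = D2 fs"
    if "m \<le> n" "length fs = n" "set fs \<subseteq> regular_at S z" "\<And>j. m \<le> j \<Longrightarrow> j < n \<Longrightarrow> \<exists>i<n. fs ! j = x i"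
    for m fs
    using that
  proof (induction m arbitrary: fs)
    case 0
    have "\<forall>j\<in>{..<n}. \<exists>i. i < n \<and> fs ! j = x i"
      using 0(4)[OF le0] by simp
    from bchoice[OF this] obtain i where i: "\<And>j. j < n \<Longrightarrow> i j < n \<and> fs ! j = x (i j)"
      by auto
    have "fs = map x (map i [0..<n])"
      using 0 i by (intro nth_equalityI) auto
    moreover have "D1 (map x (map i [0..<n])) = D2 (map x (map i [0..<n]))"
      using i by (intro coords[of 0]) auto
    ultimately show ?case by simp
  next
    case (Suc m)
    have fm: "fs ! m \<in> regular_at S z" using Suc.prems by (auto simp: subset_iff)
    have s: "D (fs[m := fs ! m]) = (\<Sum>l<n. c (fs ! m) l * D (fs[m := x l]))"
      if "D \<in> anticanonical_fibre n S z" for D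
      using Suc.prems by (intro span[OF fibre_point_derivation[OF that]] fm) auto
    have "D1 (fs[m := x l]) = D2 (fs[m := x l])" if "l < n" for l
      using Suc.prems x[OF that] that
      by (intro Suc.IH set_update_subsetI) (auto simp: nth_list_update)
    then have "D1 (fs[m := fs ! m]) = D2 (fs[m := fs ! m])"
      unfolding s[OF D1] s[OF D2] by simp
    then show ?case by simp
  qed
  show ?thesis
  proof
    fix fs
    show "D1 fs = D2 fs"
    proof (cases "length fs = n \<and> set fs \<subseteq> regular_at S z")
      case True
      then show ?thesis by (intro all[of n]) auto
    next
      case False
      then show ?thesis using fibre_outside[OF D1] fibre_outside[OF D2] by simp
    qed
  qed
qed

text \<open>
  The polyvector \<open>c \<cdot> \<delta>\<^sub>0 \<and> \<dots> \<and> \<delta>\<^sub>n\<^sub>-\<^sub>1\<close>.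
\<close>

lemma det_of_derivations_in_fibre:
  fixes S :: "'a function_space" and \<delta> :: "nat \<Rightarrow> ('a \<Rightarrow> complex) \<Rightarrow> complex"
  assumes \<delta>: "\<And>l. l < n \<Longrightarrow> point_derivation S z (\<delta> l)"
    and closed: "\<And>f h. f \<in> regular_at S z \<Longrightarrow> h \<in> regular_at S z \<Longrightarrow>
      (\<lambda>x. f x + h x) \<in> regular_at S z \<and> (\<lambda>x. f x * h x) \<in> regular_at S z"
    and const: "\<And>a. (\<lambda>_. a) \<in> regular_at S z"
  shows "(\<lambda>fs. if length fs = n \<and> set fs \<subseteq> regular_at S z
      then c * leibniz_det n (\<lambda>k l. \<delta> l (fs ! k)) else 0) \<in> anticanonical_fibre n S z"
    (is "?D \<in> _")
proof -
  have row: "?D (fs[k := f]) = c * leibniz_det n ((\<lambda>i l. \<delta> l (fs ! i))(k := (\<lambda>l. \<delta> l f)))"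
    if "length fs = n" "set fs \<subseteq> regular_at S z" "k < n" "f \<in> regular_at S z" for fs k f
  proof -
    have "leibniz_det n (\<lambda>i l. \<delta> l (fs[k := f] ! i)) =
        leibniz_det n ((\<lambda>i l. \<delta> l (fs ! i))(k := (\<lambda>l. \<delta> l f)))"
      using that by (intro leibniz_det_cong) (auto simp: nth_list_update)
    then show ?thesis
      using that set_update_subsetI[OF that(2,4), of k] by simp
  qed
  have lin: "leibniz_det n (M(k := (\<lambda>l. \<delta> l e))) =
      a * leibniz_det n (M(k := (\<lambda>l. \<delta> l f))) + b * leibniz_det n (M(k := (\<lambda>l. \<delta> l h)))"
    if "\<And>l. l < n \<Longrightarrow> \<delta> l e = a * \<delta> l f + b * \<delta> l h" "k < n" for M k e f h a b
  proof -
    have "leibniz_det n (M(k := (\<lambda>l. \<delta> l e))) = leibniz_det n (M(k := (\<lambda>l. a * \<delta> l f + b * \<delta> l h)))"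
      using that by (intro leibniz_det_cong) auto
    then show ?thesis using leibniz_det_row_linear[OF that(2)] by simp
  qed
  have multi: "?D (fs[k := (\<lambda>x. f x + h x)]) = ?D (fs[k := f]) + ?D (fs[k := h]) \<and>
      ?D (fs[k := (\<lambda>x. d * f x)]) = d * ?D (fs[k := f]) \<and>
      ?D (fs[k := (\<lambda>x. f x * h x)]) = f z * ?D (fs[k := h]) + h z * ?D (fs[k := f]) \<and>
      ((\<exists>U. openin (topo S) U \<and> z \<in> U \<and> (\<forall>x\<in>U. f x = h x)) \<longrightarrow> ?D (fs[k := f]) = ?D (fs[k := h]))"
    if pre: "length fs = n \<and> set fs \<subseteq> regular_at S z \<and> k < n \<and>
        f \<in> regular_at S z \<and> h \<in> regular_at S z" for fs k f h d
  proof -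
    from pre have fs: "length fs = n" "set fs \<subseteq> regular_at S z" "k < n"
      and f: "f \<in> regular_at S z" and h: "h \<in> regular_at S z" by auto
    note pd = point_derivationD[OF \<delta> f h]
    let ?M = "\<lambda>i l. \<delta> l (fs ! i)"
    have add: "leibniz_det n (?M(k := (\<lambda>l. \<delta> l (\<lambda>x. f x + h x)))) =
        1 * leibniz_det n (?M(k := (\<lambda>l. \<delta> l f))) + 1 * leibniz_det n (?M(k := (\<lambda>l. \<delta> l h)))"
      by (rule lin[OF _ fs(3)]) (simp add: pd(1))
    have scale: "leibniz_det n (?M(k := (\<lambda>l. \<delta> l (\<lambda>x. d * f x)))) =
        d * leibniz_det n (?M(k := (\<lambda>l. \<delta> l f))) + 0 * leibniz_det n (?M(k := (\<lambda>l. \<delta> l f)))"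
      by (rule lin[OF _ fs(3)]) (simp add: pd(2))
    have mult: "leibniz_det n (?M(k := (\<lambda>l. \<delta> l (\<lambda>x. f x * h x)))) =
        f z * leibniz_det n (?M(k := (\<lambda>l. \<delta> l h))) + h z * leibniz_det n (?M(k := (\<lambda>l. \<delta> l f)))"
      by (rule lin[OF _ fs(3)]) (simp add: pd(3))
    have loc: "leibniz_det n (?M(k := (\<lambda>l. \<delta> l f))) = leibniz_det n (?M(k := (\<lambda>l. \<delta> l h)))"
      if "openin (topo S) U" "z \<in> U" "\<forall>x\<in>U. f x = h x" for U
      using pd(4)[OF _ that(1,2)] that(3) by (intro leibniz_det_cong) simp
    have df: "(\<lambda>x. d * f x) \<in> regular_at S z"
      using closed[OF const[of d] f] by simp
    show ?thesis
      unfolding row[OF fs f] row[OF fs h] row[OF fs df]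
        row[OF fs conjunct1[OF closed[OF f h]]] row[OF fs conjunct2[OF closed[OF f h]]]
        add scale mult
      using loc by (auto simp: algebra_simps)
  qed
  have alt: "?D fs = 0"
    if "j < k \<and> k < n \<and> length fs = n \<and> set fs \<subseteq> regular_at S z \<and> fs ! j = fs ! k" for fs j k
  proof -
    have "leibniz_det n (\<lambda>k l. \<delta> l (fs ! k)) = 0"
      using that by (intro leibniz_det_equal_rows[of j k]) auto
    then show ?thesis by simp
  qed
  show ?thesis
    unfolding anticanonical_fibre_def mem_Collect_eq
  proof ((rule conjI[OF _ conjI]; intro allI impI), goal_cases)
    case (1 fs)
    then show ?case by (rule if_not_P)
  next
    case (2 fs k f h d)
    then show ?case by (rule multi)
  next
    case (3 fs j k)
    then show ?case by (rule alt)
  qed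
qed

section \<open>Sections from semi-invariant functions\<close>

context bsdh_word
begin

text \<open>
  Open sets of the quotient are the same as saturated open sets of tuples.
\<close>

lemma saturated_openin:
  assumes W: "openin (topo S) W" and sat: "\<And>q b. q \<in> W \<Longrightarrow> b \<in> borel_tuples \<Longrightarrow> act q b \<in> W"
  shows "openin (topo Z) (orbit_of ` W)" "pre (orbit_of ` W) = W"
proof -
  have WP: "W \<subseteq> PP" using openin_subset[OF W] by simp
  show pre: "pre (orbit_of ` W) = W"
  proof (intro subset_antisym subsetI)
    fix q assume "q \<in> pre (orbit_of ` W)"
    then obtain w where w: "q \<in> PP" "w \<in> W" "orbit_of q = orbit_of w" by (auto simp: pre_def)
    then obtain b where "b \<in> borel_tuples" "q = act w b"
      using in_orbit_of[OF w(1)] orbit_of_eq[of w] WP by auto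
    then show "q \<in> W" using sat w(2) by simp
  next
    fix q assume "q \<in> W"
    then show "q \<in> pre (orbit_of ` W)" using WP by (auto simp: pre_def)
  qed
  show "openin (topo Z) (orbit_of ` W)"
    unfolding openin_Z pre using W WP by blast
qed

lemma openin_pre: "openin (topo Z) U \<Longrightarrow> openin (topo S) (pre U)"
  by (simp add: openin_Z)

lemma regular_at_ZE:
  assumes "f \<in> regular_at Z z" "h \<in> regular_at Z z"
  obtains U where "openin (topo Z) U" "z \<in> U"
    "(\<lambda>q. f (orbit_of q)) \<in> regular S (pre U)" "(\<lambda>q. h (orbit_of q)) \<in> regular S (pre U)"
proof -
  obtain U where U: "openin (topo Z) U" "z \<in> U" "f \<in> regular Z U"
    using assms(1) by (auto simp: regular_at_def)
  obtain V where V: "openin (topo Z) V" "z \<in> V" "h \<in> regular Z V"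
    using assms(2) by (auto simp: regular_at_def)
  have I: "openin (topo Z) (U \<inter> V)" using U V by (intro openin_Int)
  have sub: "pre (U \<inter> V) \<subseteq> pre U" "pre (U \<inter> V) \<subseteq> pre V" by (auto simp: pre_def)
  have "(\<lambda>q. f (orbit_of q)) \<in> regular S (pre (U \<inter> V))"
    using U(3) by (intro regular_restrict[OF _ openin_pre[OF I] sub(1) pre_subset]) (simp add: regular_Z)
  moreover have "(\<lambda>q. h (orbit_of q)) \<in> regular S (pre (U \<inter> V))"
    using V(3) by (intro regular_restrict[OF _ openin_pre[OF I] sub(2) pre_subset]) (simp add: regular_Z)
  ultimately show ?thesis using that[OF I] U(2) V(2) by blast
qed

lemma regular_at_ZI:
  "openin (topo Z) U \<Longrightarrow> z \<in> U \<Longrightarrow> (\<lambda>q. f (orbit_of q)) \<in> regular S (pre U) \<Longrightarrow> f \<in> regular_at Z z"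
  by (auto simp: regular_at_def regular_Z)

lemma regular_at_Z_closed:
  assumes "f \<in> regular_at Z z" "h \<in> regular_at Z z"
  shows "(\<lambda>x. f x + h x) \<in> regular_at Z z" "(\<lambda>x. f x * h x) \<in> regular_at Z z"
proof -
  obtain U where U: "openin (topo Z) U" "z \<in> U"
    "(\<lambda>q. f (orbit_of q)) \<in> regular S (pre U)" "(\<lambda>q. h (orbit_of q)) \<in> regular S (pre U)"
    using regular_at_ZE[OF assms] by blast
  show "(\<lambda>x. f x + h x) \<in> regular_at Z z"
    by (rule regular_at_ZI[OF U(1,2)]) (rule regular_add[OF U(3,4) pre_subset])
  show "(\<lambda>x. f x * h x) \<in> regular_at Z z"
    by (rule regular_at_ZI[OF U(1,2)]) (rule regular_mult[OF U(3,4) pre_subset])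
qed

lemma regular_at_Z_const:
  assumes "p \<in> PP"
  shows "(\<lambda>_. c) \<in> regular_at Z (orbit_of p)"
proof (rule regular_at_ZI)
  show "openin (topo Z) (topspace (topo Z))" by simp
  show "orbit_of p \<in> topspace (topo Z)" using assms by (simp add: topspace_Z)
  show "(\<lambda>q. c) \<in> regular S (pre (topspace (topo Z)))"
    by (intro regular_polynomial openin_pre polynomials.const) simp
qed

lemma X_point_derivation:
  assumes p: "p \<in> PP" and l: "l < n"
  shows "point_derivation Z (orbit_of p) (\<lambda>f. X l (\<lambda>q. f (orbit_of q)) p)"
  unfolding point_derivation_def
proof (intro ballI allI conjI impI)
  fix f h :: "(nat \<Rightarrow> mat4) set \<Rightarrow> complex" and c assume fh: "f \<in> regular_at Z (orbit_of p)" "h \<in> regular_at Z (orbit_of p)"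
  obtain U where U: "openin (topo Z) U" "orbit_of p \<in> U"
    "(\<lambda>q. f (orbit_of q)) \<in> regular S (pre U)" "(\<lambda>q. h (orbit_of q)) \<in> regular S (pre U)"
    using regular_at_ZE[OF fh] by blast
  have pU: "p \<in> pre U" using p U(2) by (simp add: pre_def)
  note rules = derivative_along_rules[OF move_in_PP[OF l] U(3,4) pre_subset pU]
  show "X l (\<lambda>q. f (orbit_of q) + h (orbit_of q)) p = X l (\<lambda>q. f (orbit_of q)) p + X l (\<lambda>q. h (orbit_of q)) p"
    by (rule rules(1))
  show "X l (\<lambda>q. f (orbit_of q) * h (orbit_of q)) p = f (orbit_of p) * X l (\<lambda>q. h (orbit_of q)) p + h (orbit_of p) * X l (\<lambda>q. f (orbit_of q)) p"
    by (rule rules(2))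
  show "X l (\<lambda>q. c * f (orbit_of q)) p = c * X l (\<lambda>q. f (orbit_of q)) p"
    by (rule rules(3))
next
  fix f h :: "(nat \<Rightarrow> mat4) set \<Rightarrow> complex" assume "\<exists>U. openin (topo Z) U \<and> orbit_of p \<in> U \<and> (\<forall>x\<in>U. f x = h x)"
  then obtain U where U: "openin (topo Z) U" "orbit_of p \<in> U" "\<forall>x\<in>U. f x = h x" by blast
  show "X l (\<lambda>q. f (orbit_of q)) p = X l (\<lambda>q. h (orbit_of q)) p"
    by (rule derivative_along_cong[OF move_in_PP[OF l] openin_pre[OF U(1)]])
      (use U p in \<open>auto simp: pre_def\<close>)
qed

text \<open>
  The image at the class of \<open>p\<close> of the polyvector \<open>c \<cdot> X\<^sub>0 \<and> \<dots> \<and> X\<^sub>n\<^sub>-\<^sub>1\<close> at \<open>p\<close>, where \<open>X\<^sub>l\<close> is the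
  left-invariant vector field of the root vector \<open>dir l\<close> in the \<open>l\<close>-th factor.
\<close>

definition det_form :: "complex \<Rightarrow> (nat \<Rightarrow> mat4) \<Rightarrow> ((nat \<Rightarrow> mat4) set \<Rightarrow> complex) list \<Rightarrow> complex" where
  "det_form c p fs = (if length fs = n \<and> set fs \<subseteq> regular_at Z (orbit_of p)
     then c * leibniz_det n (\<lambda>k l. X l (\<lambda>q. (fs ! k) (orbit_of q)) p) else 0)"

lemma det_form_in_fibre:
  assumes "p \<in> PP"
  shows "det_form c p \<in> anticanonical_fibre n Z (orbit_of p)"
  unfolding det_form_def
  by (rule det_of_derivations_in_fibre[OF X_point_derivation[OF assms]])
    (simp_all add: regular_at_Z_closed regular_at_Z_const[OF assms])

lemma rep_orbit_of_act:
  assumes "q \<in> PP"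
  obtains b where "b \<in> borel_tuples" "rep (orbit_of q) = act q b"
  using rep_orbit_of(1)[OF assms] orbit_of_eq[OF assms] by auto

definition zcoord :: "(nat \<Rightarrow> mat4) \<Rightarrow> nat \<Rightarrow> (nat \<Rightarrow> mat4) set \<Rightarrow> complex" where
  "zcoord p0 j z = coord p0 (rep z) j"

definition on_chart :: "(nat \<Rightarrow> mat4) \<Rightarrow> ((nat \<Rightarrow> mat4) \<Rightarrow> complex) \<Rightarrow> (nat \<Rightarrow> mat4) set \<Rightarrow> complex"
  where "on_chart p0 G z = G (chart p0 (coord p0 (rep z)))"

text \<open>
  The character of the \<open>n\<close>-th power of the Borel subgroup that takes the inverse of the simple root of
  \<open>ks ! j\<close> on the \<open>j\<close>-th factor.
\<close>

definition weight :: "(nat \<Rightarrow> mat4) \<Rightarrow> complex" where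
  "weight b = (\<Prod>j<n. hat (b j) $ hi (ks ! j) $ hi (ks ! j) / hat (b j) $ lo (ks ! j) $ lo (ks ! j))"

context
  fixes p0 assumes p0: "p0 \<in> PP"
begin

lemma coord_rep:
  assumes q: "q \<in> dom p0" and j: "j < n"
  shows "coord p0 (rep (orbit_of q)) j = coord p0 q j"
proof -
  have "q \<in> PP" using q domain_upto_subset by blast
  then obtain b where b: "b \<in> borel_tuples" "rep (orbit_of q) = act q b" by (rule rep_orbit_of_act)
  have "q \<in> domain_upto p0 j" using domain_upto_mono[of j n p0] q j by auto
  then show ?thesis using local_factor_act(2)[OF p0 b(1) j] b(2) by simp
qed

lemma chart_coord_rep:
  "q \<in> dom p0 \<Longrightarrow> chart p0 (coord p0 (rep (orbit_of q))) = chart p0 (coord p0 q)"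
  unfolding chart_def by (intro restrict_ext) (simp add: coord_rep)

text \<open>
  A regular function on the domain of the coordinates that is constant on orbits is a germ on the
  quotient.
\<close>

lemma regular_at_descend:
  assumes \<phi>: "\<phi> \<in> regular S (dom p0)" and inv: "\<And>q. q \<in> dom p0 \<Longrightarrow> f (orbit_of q) = \<phi> q"
  shows "f \<in> regular_at Z (orbit_of p0)"
proof (rule regular_at_ZI)
  note sat = saturated_openin[OF openin_dom[OF p0] act_in_dom[OF p0]]
  show "openin (topo Z) (orbit_of ` dom p0)" by (rule sat)
  show "orbit_of p0 \<in> orbit_of ` dom p0" using base_point_in_dom[OF p0] by blast
  show "(\<lambda>q. f (orbit_of q)) \<in> regular S (pre (orbit_of ` dom p0))"
    by (subst sat(2)) (auto intro: regular_cong[OF _ \<phi>] simp: inv)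
qed

lemma zcoord_regular: "j < n \<Longrightarrow> zcoord p0 j \<in> regular_at Z (orbit_of p0)"
  by (rule regular_at_descend[OF regular_coord[OF p0]]) (simp_all add: zcoord_def coord_rep)

lemma chart_nth: "chart p0 t k $ a $ b =
    (if k < n then p0 k $ a $ b + t k * (p0 k ** dir k) $ a $ b else undefined $ a $ b)"
  by (simp add: chart_def mult_line_nth)

lemma regular_polynomial_chart:
  assumes "G \<in> polynomials"
  shows "(\<lambda>q. G (chart p0 (coord p0 q))) \<in> regular S (dom p0)"
  using assms
proof induction
  case (const c)
  then show ?case by (intro regular_polynomial openin_dom p0 polynomials.const)
next
  case (entry k a b)
  note const = regular_polynomial[OF openin_dom[OF p0] polynomials.const]
  show ?case
    by (cases "k < n")
      (simp_all add: chart_nth const regular_add[OF const regular_mult[OF regular_coord[OF p0] const]]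
        domain_upto_subset)
next
  case (add f h)
  then show ?case by (intro regular_add domain_upto_subset)
next
  case (mult f h)
  then show ?case by (intro regular_mult domain_upto_subset)
qed

lemma on_chart_orbit_of: "q \<in> dom p0 \<Longrightarrow> on_chart p0 G (orbit_of q) = G (chart p0 (coord p0 q))"
  by (simp add: on_chart_def chart_coord_rep)

lemma on_chart_regular: "G \<in> polynomials \<Longrightarrow> on_chart p0 G \<in> regular_at Z (orbit_of p0)"
  by (rule regular_at_descend[OF regular_polynomial_chart]) (simp_all add: on_chart_orbit_of)

lemma coord_base_point: "j < n \<Longrightarrow> coord p0 p0 j = 0"
  using base_point_local_factor[OF p0, of j] lo_less_hi[OF nth_ks, of j]
  by (auto simp: coord_def slope_def mat_nth)

lemma chart_base_point: "chart p0 (coord p0 p0) = p0"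
  by (rule tuple_eqI[OF chart_in_PP[OF p0] p0]) (simp add: chart_def coord_base_point)

lemma X_entry:
  assumes "l < n"
  shows "X l (\<lambda>p. p k $ a $ b) p0 = (if l = k then (p0 k ** dir k) $ a $ b else 0)"
proof (cases "l = k")
  case True
  have "((\<lambda>t. p0 k $ a $ b + t * (p0 k ** dir k) $ a $ b) has_field_derivative (p0 k ** dir k) $ a $ b) (at 0)"
    by (auto intro!: derivative_eq_intros)
  then show ?thesis
    using True by (simp add: derivative_along_def move_def mult_line_nth DERIV_imp_deriv)
qed (simp add: derivative_along_def move_def)

context
  fixes \<delta> assumes \<delta>: "point_derivation Z (orbit_of p0) \<delta>"
begin

text \<open>
  The function \<open>on_chart p0 G\<close> is a polynomial in the coordinates, so the chain rule computes \<open>\<delta>\<close> on it;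
  the partial derivatives are the \<open>X l G p0\<close>. The induction runs over the polynomials \<open>G\<close>.
\<close>

lemma derivation_on_chart:
  assumes "G \<in> polynomials"
  shows "\<delta> (on_chart p0 G) = (\<Sum>l<n. X l G p0 * \<delta> (zcoord p0 l))"
  using assms
proof induction
  case (const c)
  have "\<delta> (on_chart p0 (\<lambda>_. c)) = 0"
    using point_derivation_const[OF \<delta> regular_at_Z_const[OF p0]] by (simp add: on_chart_def[abs_def])
  then show ?case by (simp add: derivative_along_def)
next
  case (entry k a b)
  show ?case
  proof (cases "k < n")
    case True
    let ?c = "p0 k $ a $ b" and ?d = "(p0 k ** dir k) $ a $ b"
    have dx: "(\<lambda>z. ?d * zcoord p0 k z) \<in> regular_at Z (orbit_of p0)"
      using regular_at_Z_closed(2)[OF regular_at_Z_const[OF p0] zcoord_regular[OF True]] .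
    have eq: "on_chart p0 (\<lambda>p. p k $ a $ b) = (\<lambda>z. ?c + ?d * zcoord p0 k z)"
      using True by (simp add: on_chart_def[abs_def] chart_nth zcoord_def mult.commute)
    have "\<delta> (on_chart p0 (\<lambda>p. p k $ a $ b)) = ?d * \<delta> (zcoord p0 k)"
      unfolding eq point_derivationD(1)[OF \<delta> regular_at_Z_const[OF p0] dx]
        point_derivation_const[OF \<delta> regular_at_Z_const[OF p0]]
        point_derivationD(2)[OF \<delta> zcoord_regular[OF True] zcoord_regular[OF True]]
      by simp
    also have "\<dots> = (\<Sum>l<n. (if l = k then ?d else 0) * \<delta> (zcoord p0 l))"
      using True by (subst sum.remove[of "{..<n}" k]) (auto intro!: sum.neutral[symmetric])
    also have "\<dots> = (\<Sum>l<n. X l (\<lambda>p. p k $ a $ b) p0 * \<delta> (zcoord p0 l))"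
      by (intro sum.cong refl) (simp add: X_entry)
    finally show ?thesis .
  next
    case False
    have "\<delta> (on_chart p0 (\<lambda>p. p k $ a $ b)) = 0"
      using False point_derivation_const[OF \<delta> regular_at_Z_const[OF p0]]
      by (simp add: on_chart_def[abs_def] chart_nth)
    moreover have "X l (\<lambda>p. p k $ a $ b) p0 = 0" if "l < n" for l
      using False that by (auto simp: X_entry)
    ultimately show ?thesis by simp
  qed
next
  case (add f h)
  note PPopen = openin_topspace[of "topo S", unfolded topspace_subvariety]
  have "X l (\<lambda>p. f p + h p) p0 = X l f p0 + X l h p0" if "l < n" for l
    by (rule derivative_along_add[OF move_in_PP[OF that] regular_polynomial[OF PPopen]
          regular_polynomial[OF PPopen] subset_refl p0]) (use add in auto)
  moreover have "\<delta> (on_chart p0 (\<lambda>p. f p + h p)) = \<delta> (on_chart p0 f) + \<delta> (on_chart p0 h)"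
    using point_derivationD(1)[OF \<delta> on_chart_regular[OF add(1)] on_chart_regular[OF add(2)]]
    by (simp add: on_chart_def[abs_def])
  ultimately show ?case
    using add.IH by (simp add: distrib_right sum.distrib)
next
  case (mult f h)
  note PPopen = openin_topspace[of "topo S", unfolded topspace_subvariety]
  have "X l (\<lambda>p. f p * h p) p0 = f p0 * X l h p0 + h p0 * X l f p0" if "l < n" for l
    by (rule derivative_along_mult[OF move_in_PP[OF that] regular_polynomial[OF PPopen]
          regular_polynomial[OF PPopen] subset_refl p0]) (use mult in auto)
  moreover have "\<delta> (on_chart p0 (\<lambda>p. f p * h p)) = f p0 * \<delta> (on_chart p0 h) + h p0 * \<delta> (on_chart p0 f)"
    using point_derivationD(3)[OF \<delta> on_chart_regular[OF mult(1)] on_chart_regular[OF mult(2)]]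
      on_chart_orbit_of[OF base_point_in_dom[OF p0]] chart_base_point
    by (simp add: on_chart_def[abs_def])
  ultimately show ?case
    using mult.IH by (simp add: distrib_right sum.distrib sum_distrib_left mult.assoc)
qed

text \<open>
  The coordinates span the cotangent space. Near the class of \<open>p\<^sub>0\<close> a germ \<open>f\<close> is a quotient of two
  polynomials in the coordinates, and the Leibniz rule for \<open>f \<cdot> H = G\<close> determines \<open>\<delta> f\<close>.
\<close>

lemma derivation_eq_sum:
  assumes f: "f \<in> regular_at Z (orbit_of p0)"
  shows "\<delta> f = (\<Sum>l<n. X l (\<lambda>q. f (orbit_of q)) p0 * \<delta> (zcoord p0 l))"
proof -
  obtain U where U: "openin (topo Z) U" "orbit_of p0 \<in> U" "(\<lambda>q. f (orbit_of q)) \<in> regular S (pre U)"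
    using regular_at_ZE[OF f f] by blast
  have p0U: "p0 \<in> pre U" using p0 U(2) by (simp add: pre_def)
  obtain G H where GH: "G \<in> polynomials" "H \<in> polynomials" "H p0 \<noteq> 0"
    and eq: "\<And>y. y \<in> PP \<Longrightarrow> H y \<noteq> 0 \<Longrightarrow> y \<in> pre U \<and> f (orbit_of y) = G y / H y"
    using regular_subvarietyE[OF U(3) pre_subset p0U] by blast
  define W where "W = {q \<in> dom p0. H (chart p0 (coord p0 q)) \<noteq> 0}"
  have Wopen: "openin (topo S) W"
    unfolding W_def by (rule openin_regular_nonzero[OF regular_polynomial_chart[OF GH(2)] domain_upto_subset])
  have Wsat: "act q b \<in> W" if "q \<in> W" "b \<in> borel_tuples" for q b
  proof -
    have q: "q \<in> dom p0" "q \<in> domain_upto p0 j" if "j < n" for j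
      using \<open>q \<in> W\<close> domain_upto_mono[of j n p0] that by (auto simp: W_def)
    have "chart p0 (coord p0 (act q b)) = chart p0 (coord p0 q)"
      unfolding chart_def using local_factor_act(2)[OF p0 that(2)] q
      by (intro restrict_ext) simp
    then show ?thesis
      using that act_in_dom[OF p0 that(2)] by (simp add: W_def)
  qed
  have p0W: "p0 \<in> W"
    using base_point_in_dom[OF p0] chart_base_point GH(3) by (simp add: W_def)
  \<comment> \<open>A tuple in this neighbourhood and its image in the slice have the same orbit, where the fraction can be evaluated.\<close>
  have "f z * on_chart p0 H z = on_chart p0 G z" if "z \<in> orbit_of ` W" for z
  proof -
    obtain q where q: "q \<in> dom p0" "H (chart p0 (coord p0 q)) \<noteq> 0" "z = orbit_of q"
      using \<open>z \<in> orbit_of ` W\<close> by (auto simp: W_def)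
    have "f z = f (orbit_of (chart p0 (coord p0 q)))"
      using orbit_of_chart_coord[OF p0 q(1)] q(3) by simp
    then show ?thesis
      using eq[OF chart_in_PP[OF p0] q(2)] q by (simp add: on_chart_orbit_of)
  qed
  then have "\<delta> (\<lambda>z. f z * on_chart p0 H z) = \<delta> (on_chart p0 G)"
    by (intro point_derivationD(4)[OF \<delta> regular_at_Z_closed(2)[OF f on_chart_regular[OF GH(2)]]
          on_chart_regular[OF GH(1)] saturated_openin(1)[OF Wopen Wsat]]) (use p0W in auto)
  then have 1: "f (orbit_of p0) * \<delta> (on_chart p0 H) + H p0 * \<delta> f = \<delta> (on_chart p0 G)"
    using point_derivationD(3)[OF \<delta> f on_chart_regular[OF GH(2)]]
      on_chart_orbit_of[OF base_point_in_dom[OF p0]] chart_base_point by simp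
  have 2: "X l G p0 = f (orbit_of p0) * X l H p0 + H p0 * X l (\<lambda>q. f (orbit_of q)) p0" if l: "l < n" for l
  proof -
    let ?V = "{q \<in> pre U. H q \<noteq> 0}"
    have HU: "H \<in> regular S (pre U)" by (rule regular_polynomial[OF openin_pre[OF U(1)] GH(2)])
    have "X l G p0 = X l (\<lambda>q. f (orbit_of q) * H q) p0"
      by (rule derivative_along_cong[OF move_in_PP[OF l] openin_regular_nonzero[OF HU pre_subset]])
        (use p0U GH(3) eq pre_subset[of U] in auto)
    then show ?thesis
      using derivative_along_mult[OF move_in_PP[OF l] U(3) HU pre_subset p0U] by simp
  qed
  have "H p0 * \<delta> f = (\<Sum>l<n. X l G p0 * \<delta> (zcoord p0 l)) - f (orbit_of p0) * (\<Sum>l<n. X l H p0 * \<delta> (zcoord p0 l))"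
    using 1 derivation_on_chart[OF GH(1)] derivation_on_chart[OF GH(2)] by (simp add: algebra_simps)
  also have "\<dots> = (\<Sum>l<n. (X l G p0 - f (orbit_of p0) * X l H p0) * \<delta> (zcoord p0 l))"
    by (simp add: sum_distrib_left sum_subtractf algebra_simps)
  also have "\<dots> = (\<Sum>l<n. H p0 * (X l (\<lambda>q. f (orbit_of q)) p0 * \<delta> (zcoord p0 l)))"
    by (intro sum.cong refl) (simp add: 2 algebra_simps)
  also have "\<dots> = H p0 * (\<Sum>l<n. X l (\<lambda>q. f (orbit_of q)) p0 * \<delta> (zcoord p0 l))"
    by (simp add: sum_distrib_left)
  finally show ?thesis using GH(3) by simp
qed

end

lemma fibre_determined_by_coords:
  assumes "D1 \<in> anticanonical_fibre n Z (orbit_of p0)" "D2 \<in> anticanonical_fibre n Z (orbit_of p0)"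
    and "D1 (map (zcoord p0) [0..<n]) = D2 (map (zcoord p0) [0..<n])"
  shows "D1 = D2"
  by (rule fibre_eqI[OF assms(1,2) zcoord_regular regular_at_Z_closed(1) derivation_eq_sum assms(3)])

text \<open>
  By the order in which the factors enter the coordinates the Jacobian matrix is triangular, and its
  diagonal consists of the values of the simple roots, which \<open>weight\<close> cancels.
\<close>

lemma det_form_coords:
  assumes b: "b \<in> borel_tuples"
  shows "det_form (weight b * c) (act p0 b) (map (zcoord p0) [0..<n]) = c"
proof -
  have act: "act p0 b \<in> PP" "act p0 b \<in> dom p0" "orbit_of (act p0 b) = orbit_of p0"
    using act_in_PP[OF p0 b] act_in_dom[OF p0 b base_point_in_dom[OF p0]] orbit_of_act[OF p0 b] .
  let ?d = "\<lambda>j. hat (b j) $ lo (ks ! j) $ lo (ks ! j) / hat (b j) $ hi (ks ! j) $ hi (ks ! j)"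
  have X: "X l (\<lambda>q. zcoord p0 k (orbit_of q)) (act p0 b) = X l (\<lambda>q. coord p0 q k) (act p0 b)"
    if "l < n" "k < n" for l k
    by (rule derivative_along_cong[OF move_in_PP[OF that(1)] openin_dom[OF p0] act(2)])
      (simp_all add: zcoord_def coord_rep that)
  have "leibniz_det n (\<lambda>k l. X l (\<lambda>q. (map (zcoord p0) [0..<n] ! k) (orbit_of q)) (act p0 b)) =
      leibniz_det n (\<lambda>k l. X l (\<lambda>q. coord p0 q k) (act p0 b))"
    by (intro leibniz_det_cong) (simp add: X)
  also have "\<dots> = (\<Prod>k<n. ?d k)"
    by (subst leibniz_det_lower) (simp_all add: X_coord_later[OF p0] X_coord_same[OF p0 b])
  finally have "leibniz_det n (\<lambda>k l. X l (\<lambda>q. (map (zcoord p0) [0..<n] ! k) (orbit_of q)) (act p0 b)) =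
      (\<Prod>k<n. ?d k)" .
  moreover have "weight b * (\<Prod>k<n. ?d k) = 1"
    unfolding weight_def prod.distrib[symmetric]
    by (rule prod.neutral) (use borel_diag_nonzero[OF borel_tuples_nth[OF b]] in auto)
  moreover have "set (map (zcoord p0) [0..<n]) \<subseteq> regular_at Z (orbit_of (act p0 b))"
    using zcoord_regular act(3) by auto
  ultimately show ?thesis
    by (simp add: det_form_def mult.assoc mult.left_commute[of _ c])
qed

lemma det_form_base_coords: "det_form c p0 (map (zcoord p0) [0..<n]) = c"
proof -
  have "weight (\<lambda>j\<in>{..<n}. mat 1) = 1"
    by (auto simp: weight_def mat_nth intro!: prod.neutral)
  then show ?thesis
    using det_form_coords[OF act_one(1)[OF p0], of c] act_one(2)[OF p0] by simp
qed

text \<open>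
  Both sides lie in the same fibre, so it suffices to compare them on the coordinates.
\<close>

lemma det_form_act:
  assumes b: "b \<in> borel_tuples"
  shows "det_form (weight b * c) (act p0 b) = det_form c p0"
proof (rule fibre_determined_by_coords)
  show "det_form (weight b * c) (act p0 b) \<in> anticanonical_fibre n Z (orbit_of p0)"
    using det_form_in_fibre[OF act_in_PP[OF p0 b]] orbit_of_act[OF p0 b] by simp
qed (simp_all add: det_form_in_fibre[OF p0] det_form_coords[OF b] det_form_base_coords)

end

definition semi_invariant :: "((nat \<Rightarrow> mat4) \<Rightarrow> complex) \<Rightarrow> ((nat \<Rightarrow> mat4) \<Rightarrow> complex) \<Rightarrow> bool" where
  "semi_invariant w F \<longleftrightarrow> F \<in> regular S PP \<and> (\<forall>p\<in>PP. \<forall>b\<in>borel_tuples. F (act p b) = w b * F p)"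

text \<open>
  The image of \<open>F \<cdot> X\<^sub>0 \<and> \<dots> \<and> X\<^sub>n\<^sub>-\<^sub>1\<close> on the quotient. For a semi-invariant \<open>F\<close> of the right weight
  the choice of representatives is immaterial.
\<close>

definition section_of :: "((nat \<Rightarrow> mat4) \<Rightarrow> complex) \<Rightarrow> (nat \<Rightarrow> mat4) set \<Rightarrow>
    ((nat \<Rightarrow> mat4) set \<Rightarrow> complex) list \<Rightarrow> complex" where
  "section_of F z = det_form (F (rep z)) (rep z)"

lemma section_of_orbit_of:
  assumes F: "semi_invariant weight F" and p: "p \<in> PP"
  shows "section_of F (orbit_of p) = det_form (F p) p"
proof -
  obtain b where b: "b \<in> borel_tuples" "rep (orbit_of p) = act p b"
    using rep_orbit_of_act[OF p] .
  then have "F (rep (orbit_of p)) = weight b * F p"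
    using F p by (simp add: semi_invariant_def)
  then show ?thesis
    using det_form_act[OF p b(1)] b(2) by (simp add: section_of_def)
qed

text \<open>
  Pulled back to tuples, the values of the section are polynomial expressions in \<open>F\<close> and in the
  derivatives \<open>X l f\<close>, all of which are regular.
\<close>

lemma section_of_global:
  assumes F: "semi_invariant weight F"
  shows "section_of F \<in> global_sections (anticanonical_bundle n Z)"
proof -
  have "section_of F z \<in> anticanonical_fibre n Z z" if "z \<in> topspace (topo Z)" for z
    using det_form_in_fibre[OF rep_topspace(1)[OF that]] rep_topspace(2)[OF that]
    by (simp add: section_of_def)
  moreover have "(\<lambda>z. section_of F z fs) \<in> regular Z U"
    if U: "openin (topo Z) U" and fs: "length fs = n" "set fs \<subseteq> regular Z U" for U fs
    unfolding regular_Z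
  proof -
    note V = openin_pre[OF U]
    have reg: "(\<lambda>q. (fs ! k) (orbit_of q)) \<in> regular S (pre U)" if "k < n" for k
    proof -
      have "fs ! k \<in> regular Z U" using fs that nth_mem[of k fs] by auto
      then show ?thesis by (simp add: regular_Z)
    qed
    have "F \<in> regular S (pre U)"
      using F regular_restrict[OF _ V pre_subset subset_refl] by (simp add: semi_invariant_def)
    moreover have "(\<lambda>p. leibniz_det n (\<lambda>k l. X l (\<lambda>q. (fs ! k) (orbit_of q)) p)) \<in> regular S (pre U)"
      unfolding leibniz_det_def
    proof (intro regular_sum[OF V] regular_mult regular_prod[OF V] pre_subset
        regular_polynomial[OF V polynomials.const])
      fix \<pi> k assume "\<pi> \<in> {\<pi>. \<pi> permutes {..<n}}" "k \<in> {..<n}"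
      then have "k < n" "\<pi> k < n" using permutes_in_image[of \<pi> "{..<n}" k] by auto
      then show "X (\<pi> k) (\<lambda>q. (fs ! k) (orbit_of q)) \<in> regular S (pre U)"
        by (intro regular_derivative_along[OF move_in_PP] reg pre_subset)
    qed
    ultimately have main: "(\<lambda>p. F p * leibniz_det n (\<lambda>k l. X l (\<lambda>q. (fs ! k) (orbit_of q)) p)) \<in> regular S (pre U)"
      by (rule regular_mult[OF _ _ pre_subset])
    have eq: "F p * leibniz_det n (\<lambda>k l. X l (\<lambda>q. (fs ! k) (orbit_of q)) p) = section_of F (orbit_of p) fs"
      if p: "p \<in> pre U" for p
    proof -
      have "set fs \<subseteq> regular_at Z (orbit_of p)"
        using p fs U by (auto simp: regular_at_def pre_def)
      then show ?thesis
        using p fs by (simp add: section_of_orbit_of[OF F] det_form_def pre_def)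
    qed
    show "(\<lambda>p. section_of F (orbit_of p) fs) \<in> regular S (pre U)"
      by (rule regular_cong[OF eq main])
  qed
  ultimately show ?thesis by (simp add: anticanonical_bundle_def)
qed

text \<open>
  A section that does not vanish at a point spans the one-dimensional fibre there.
\<close>

lemma globally_generated_if_semi_invariants:
  assumes "\<And>p. p \<in> PP \<Longrightarrow> \<exists>F. semi_invariant weight F \<and> F p \<noteq> 0"
  shows "globally_generated (anticanonical_bundle n Z)"
  unfolding globally_generated_def
proof (intro ballI)
  fix z D
  assume "z \<in> base (anticanonical_bundle n Z)" and D: "D \<in> fibre (anticanonical_bundle n Z) z"
  then obtain p where p: "p \<in> PP" "z = orbit_of p"
    by (auto simp: anticanonical_bundle_def topspace_Z)
  obtain F where F: "semi_invariant weight F" "F p \<noteq> 0" using assms p by blast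
  define c where "c = D (map (zcoord p) [0..<n]) / F p"
  have "semi_invariant weight (\<lambda>q. c * F q)"
    using F(1) regular_mult[OF regular_polynomial[OF _ polynomials.const], of PP PP F c]
      openin_topspace[of "topo S"]
    by (simp add: semi_invariant_def)
  moreover have "section_of (\<lambda>q. c * F q) z = D"
  proof (rule fibre_determined_by_coords[OF p(1)])
    show "D \<in> anticanonical_fibre n Z (orbit_of p)"
      using D p(2) by (simp add: anticanonical_bundle_def)
    show "section_of (\<lambda>q. c * F q) z \<in> anticanonical_fibre n Z (orbit_of p)"
      using section_of_global[OF calculation] p by (auto simp: anticanonical_bundle_def topspace_Z)
    show "section_of (\<lambda>q. c * F q) z (map (zcoord p) [0..<n]) = D (map (zcoord p) [0..<n])"
      unfolding p(2) section_of_orbit_of[OF calculation p(1)] det_form_base_coords[OF p(1)]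
      using F(2) by (simp add: c_def)
  qed
  ultimately show "\<exists>s\<in>global_sections (anticanonical_bundle n Z). s z = D"
    using section_of_global by blast
qed

end

section \<open>Semi-invariant functions from minors\<close>

text \<open>
  For a fixed \<open>C\<close>, a linear combination of the maximal minors of the columns \<open>k,\<dots>,3\<close> of \<open>M\<close>, that is, a
  vector of the dual of the exterior power applied to the extremal vector. Taking \<open>C\<close> equal to a given
  invertible \<open>M\<close> produces a combination that does not vanish at this \<open>M\<close>.
\<close>

definition mixed_det :: "nat \<Rightarrow> mat4 \<Rightarrow> mat4 \<Rightarrow> complex" where
  "mixed_det k C M = det (\<chi> a c. if c < hi k then C $ a $ c else M $ a $ c)"

definition block_lower :: "nat \<Rightarrow> mat4 \<Rightarrow> bool" where
  "block_lower k M \<longleftrightarrow> (\<forall>a c. a < hi k \<and> hi k \<le> c \<longrightarrow> M $ a $ c = 0)"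

text \<open>
  The minor of the rows and columns \<open>hi k,\<dots>,3\<close>. On lower triangular matrices it is the character of
  the negative of the \<open>k\<close>-th fundamental weight.
\<close>

definition fund :: "nat \<Rightarrow> mat4 \<Rightarrow> complex" where
  "fund k M = mixed_det k (mat 1) M"

lemma mixed_det_self: "mixed_det k M M = det M"
  by (simp add: mixed_det_def)

lemma fund_one [simp]: "fund k (mat 1) = 1"
  by (simp add: fund_def mixed_det_self)

text \<open>
  Multiplying by \<open>M\<close> on the right recombines the last columns among themselves.
\<close>

lemma mixed_det_mult:
  assumes "block_lower k M"
  shows "mixed_det k C (Q ** M) = mixed_det k C Q * fund k M"
proof -
  let ?N = "\<lambda>C M. (\<chi> a c. if c < hi k then C $ a $ c else M $ a $ c) :: mat4"
  have "?N C (Q ** M) $ a $ c = (?N C Q ** ?N (mat 1) M) $ a $ c" for a c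
  proof (cases "c < hi k")
    case True
    have "(?N C Q ** ?N (mat 1) M) $ a $ c = (?N C Q ** mat 1) $ a $ c"
      unfolding mult_nth using True by simp
    then show ?thesis using True by simp
  next
    case False
    have "(\<Sum>d\<in>UNIV. Q $ a $ d * M $ d $ c) = (\<Sum>d\<in>UNIV. ?N C Q $ a $ d * ?N (mat 1) M $ d $ c)"
      using assms False by (intro sum.cong) (auto simp: block_lower_def)
    then show ?thesis
      using False by (simp add: mult_nth)
  qed
  then have "?N C (Q ** M) = ?N C Q ** ?N (mat 1) M"
    by (simp add: vec_eq_iff)
  then show ?thesis
    by (simp add: mixed_det_def fund_def det_mul)
qed

lemma fund_mult: "block_lower k M \<Longrightarrow> fund k (L ** M) = fund k L * fund k M"
  unfolding fund_def[of k "L ** M"] by (simp add: mixed_det_mult fund_def)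

lemma lower_imp_block_lower: "lower M \<Longrightarrow> block_lower k M"
  by (auto simp: lower_def block_lower_def)

text \<open>
  The fundamental character of \<open>k\<close> extends to the minimal parabolics of the other simple roots.
\<close>

lemma almost_lower_imp_block_lower:
  assumes "k \<in> {1,2,3}" "l \<in> {1,2,3}" "k \<noteq> l" "almost_lower l M"
  shows "block_lower k M"
  unfolding block_lower_def
proof (intro allI impI)
  fix a c assume ac: "a < hi k \<and> hi k \<le> c"
  have "\<not> (a = lo l \<and> c = hi l)"
    using assms(1-3) ac
    by (elim lo_hi_cases) (auto simp: order_4 linorder_not_less[symmetric])
  then show "M $ a $ c = 0"
    using assms(4) ac by (auto simp: almost_lower_def)
qed

text \<open>
  \<open>y\<close> raised to the entry of the Cartan matrix at \<open>k\<close> and \<open>x\<close>.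
\<close>

definition cartan_factor :: "nat \<Rightarrow> nat \<Rightarrow> complex \<Rightarrow> complex" where
  "cartan_factor k x y =
    (if x = k then y\<^sup>2 else if k = x + 1 \<or> x = k + 1 then inverse y else 1)"

lemma fund_lower:
  assumes "lower b"
  shows "fund k b = (\<Prod>a\<in>UNIV. if a < hi k then 1 else b $ a $ a)"
proof -
  have "lower (\<chi> a c. if c < hi k then mat 1 $ a $ c else b $ a $ c)"
    using assms by (auto simp: lower_def mat_nth)
  then show ?thesis
    unfolding fund_def mixed_det_def
    by (subst det_lower) (auto simp: mat_nth intro!: prod.cong)
qed

text \<open>
  The expansion of a simple root in fundamental weights, with negative signs on both sides.
\<close>

lemma prod_cartan_factor:
  assumes b: "lower b" "det b = 1" and x: "x \<in> {1,2,3}"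
  shows "(\<Prod>k\<in>{1,2,3}. cartan_factor k x (fund k b)) = b $ hi x $ hi x / b $ lo x $ lo x"
proof -
  have det: "b $ 0 $ 0 * b $ 1 $ 1 * b $ 2 $ 2 * b $ 3 $ 3 = 1"
    using det_lower[OF b(1)] b(2) by (simp add: prod_4')
  then have nz: "b $ 0 $ 0 \<noteq> 0" "b $ 1 $ 1 \<noteq> 0" "b $ 2 $ 2 \<noteq> 0" "b $ 3 $ 3 \<noteq> 0" by auto
  \<comment> \<open>For \<open>x = 1\<close> there is no neighbour on the left in the Dynkin diagram; the determinant takes its place.\<close>
  have b0: "b $ 0 $ 0 = inverse (b $ 1 $ 1 * b $ 2 $ 2 * b $ 3 $ 3)"
    using det by (intro inverse_unique[symmetric]) (simp add: ac_simps)
  show ?thesis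
    using x nz(2-4)
    by (elim lo_hi_cases)
      (simp_all add: cartan_factor_def fund_lower[OF b(1)] prod_4' order_4 b0 power2_eq_square field_simps)
qed

context bsdh_word
begin

primrec partial_product :: "(nat \<Rightarrow> mat4) \<Rightarrow> nat \<Rightarrow> mat4" where
  "partial_product p 0 = mat 1"
| "partial_product p (Suc j) = partial_product p j ** p j"

lemma det_partial_product: "p \<in> PP \<Longrightarrow> j \<le> n \<Longrightarrow> det (partial_product p j) = 1"
  by (induction j) (simp_all add: det_mul det_PP)

text \<open>
  Partial products map the variety to \<open>G/B\<close>; line bundles on \<open>G/B\<close> are pulled back along these maps.
\<close>

lemma partial_product_act:
  assumes "b \<in> borel_tuples"
  shows "j \<le> n \<Longrightarrow> partial_product (act p b) j = partial_product p j ** prev b j"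
proof (induction j)
  case 0
  then show ?case by (simp add: prev_def)
next
  case (Suc j)
  then have j: "j < n" by simp
  have "partial_product (act p b) (Suc j) =
      partial_product p j ** (prev b j ** (matrix_inv (prev b j) ** (p j ** b j)))"
    using Suc j by (simp add: act_nth matrix_mul_assoc)
  also have "\<dots> = partial_product p j ** (p j ** b j)"
    unfolding matrix_inv_cancel(4)[OF det_prev[OF assms j]] ..
  finally show ?case by (simp add: prev_def matrix_mul_assoc)
qed

definition polynomial_matrix :: "((nat \<Rightarrow> mat4) \<Rightarrow> mat4) \<Rightarrow> bool" where
  "polynomial_matrix M \<longleftrightarrow> (\<forall>a b. (\<lambda>p. M p $ a $ b) \<in> polynomials)"

lemma polynomial_matrix_mult:
  "polynomial_matrix M \<Longrightarrow> polynomial_matrix N \<Longrightarrow> polynomial_matrix (\<lambda>p. M p ** N p)"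
  by (auto simp: polynomial_matrix_def mult_nth intro!: polynomials_sum polynomials.mult)

lemma polynomial_matrix_const: "polynomial_matrix (\<lambda>p. M)"
  by (simp add: polynomial_matrix_def polynomials.const)

lemma polynomial_matrix_entry: "polynomial_matrix (\<lambda>p. p j)"
  by (simp add: polynomial_matrix_def polynomials.entry)

lemma polynomial_matrix_hat: "polynomial_matrix M \<Longrightarrow> polynomial_matrix (\<lambda>p. hat (M p))"
  unfolding hat_def by (intro polynomial_matrix_mult polynomial_matrix_const)

lemma polynomial_matrix_partial_product: "polynomial_matrix (\<lambda>p. partial_product p j)"
  by (induction j)
    (simp_all add: polynomial_matrix_const polynomial_matrix_mult polynomial_matrix_entry)

lemma polynomial_mixed_det:
  assumes "polynomial_matrix M"
  shows "(\<lambda>p. mixed_det k C (M p)) \<in> polynomials"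
proof -
  have entry: "(\<lambda>p. if c < hi k then C $ a $ c else M p $ a $ c) \<in> polynomials" for a c
    using assms by (cases "c < hi k") (simp_all add: polynomial_matrix_def polynomials.const)
  show ?thesis
    unfolding mixed_det_def det_def vec_lambda_beta
    by (intro polynomials_sum polynomials.mult[OF polynomials.const] polynomials_prod entry)
qed

lemma openin_PP: "openin (topo S) PP"
  using openin_topspace[of "topo S"] by simp

lemma regular_PP: "f \<in> polynomials \<Longrightarrow> f \<in> regular S PP"
  by (rule regular_polynomial[OF openin_PP])

text \<open>
  The line bundle of the character \<open>w\<close> has a global section that does not vanish at the class of \<open>p\<close>.
\<close>

definition weight_nonvanishing :: "(nat \<Rightarrow> mat4) \<Rightarrow> ((nat \<Rightarrow> mat4) \<Rightarrow> complex) \<Rightarrow> bool" where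
  "weight_nonvanishing p w \<longleftrightarrow> (\<exists>F. semi_invariant w F \<and> F p \<noteq> 0)"

lemma weight_nonvanishing_cong:
  "weight_nonvanishing p w \<Longrightarrow> (\<And>b. b \<in> borel_tuples \<Longrightarrow> w b = w' b) \<Longrightarrow> weight_nonvanishing p w'"
  by (auto simp: weight_nonvanishing_def semi_invariant_def)

lemma weight_nonvanishing_one: "weight_nonvanishing p (\<lambda>_. 1)"
  unfolding weight_nonvanishing_def semi_invariant_def
  by (intro exI[of _ "\<lambda>_. 1"]) (simp add: regular_PP polynomials.const)

lemma weight_nonvanishing_mult:
  assumes "weight_nonvanishing p v" "weight_nonvanishing p w"
  shows "weight_nonvanishing p (\<lambda>b. v b * w b)"
proof -
  obtain F H where "semi_invariant v F" "F p \<noteq> 0" "semi_invariant w H" "H p \<noteq> 0"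
    using assms by (auto simp: weight_nonvanishing_def)
  then have "semi_invariant (\<lambda>b. v b * w b) (\<lambda>q. F q * H q)" "F p * H p \<noteq> 0"
    by (auto simp: semi_invariant_def intro: regular_mult)
  then show ?thesis
    unfolding weight_nonvanishing_def by (intro exI[of _ "\<lambda>q. F q * H q"]) simp
qed

lemma weight_nonvanishing_power:
  "weight_nonvanishing p w \<Longrightarrow> weight_nonvanishing p (\<lambda>b. w b ^ m)"
  by (induction m) (simp_all add: weight_nonvanishing_one weight_nonvanishing_mult)

context
  fixes p assumes p: "p \<in> PP"
begin

text \<open>
  The pull-back of the globally generated line bundle of a fundamental weight under the map of a partial
  product to \<open>G/B\<close>.
\<close>

lemma weight_nonvanishing_fund:
  assumes j: "j < n"
  shows "weight_nonvanishing p (\<lambda>b. fund k (hat (b j)))"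
proof -
  define F where "F q = mixed_det k (hat (partial_product p (Suc j))) (hat (partial_product q (Suc j)))" for q
  have "F (act q b) = fund k (hat (b j)) * F q" if "b \<in> borel_tuples" for q b
  proof -
    have "partial_product (act q b) (Suc j) = partial_product q (Suc j) ** b j"
      using partial_product_act[OF that, of "Suc j" q] j by (simp add: prev_def)
    moreover have "block_lower k (hat (b j))"
      using borel_tuples_nth[OF that j] by (intro lower_imp_block_lower) (simp add: borel_opp_iff)
    ultimately show ?thesis
      by (simp only: F_def hat_mult mixed_det_mult mult.commute)
  qed
  moreover have "F \<in> regular S PP"
    unfolding F_def[abs_def]
    by (intro regular_PP polynomial_mixed_det polynomial_matrix_hat polynomial_matrix_partial_product)
  ultimately have "semi_invariant (\<lambda>b. fund k (hat (b j))) F"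
    by (simp add: semi_invariant_def)
  moreover have "F p = 1"
    using det_partial_product[OF p, of "Suc j"] j by (simp add: F_def mixed_det_self del: partial_product.simps)
  ultimately show ?thesis
    unfolding weight_nonvanishing_def by (intro exI[of _ F]) simp
qed

text \<open>
  For \<open>k\<close> different from the letter at \<open>j\<close>, the fundamental character of \<open>k\<close> is defined and invertible on
  the whole \<open>j\<close>-th factor. So the line bundles of \<open>k\<close> at the positions \<open>j - 1\<close> and \<open>j\<close> are isomorphic,
  and the one at position \<open>-1\<close> is trivial.
\<close>

lemma weight_nonvanishing_ratio:
  assumes j: "j < n" and k: "k \<in> {1,2,3}" "k \<noteq> ks ! j"
  shows "weight_nonvanishing p (\<lambda>b. fund k (hat (prev b j)) / fund k (hat (b j)))"
proof -
  have block: "block_lower k (hat x)" if "x \<in> minimal_parabolic g (ks ! j)" for x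
    using almost_lower_imp_block_lower[OF k(1) nth_ks[OF j] k(2)]
      minimal_parabolic_almost_lower[OF nth_ks[OF j] that] by blast
  have inv: "fund k (hat (matrix_inv x)) * fund k (hat x) = 1" if "x \<in> minimal_parabolic g (ks ! j)" for x
    using fund_mult[OF block[OF that], of "hat (matrix_inv x)"]
      minimal_parabolic_det[OF nth_ks[OF j] that]
    by (simp add: hat_mult[symmetric] matrix_inv_cancel)
  define F where "F q = inverse (fund k (hat (q j)))" for q :: "nat \<Rightarrow> mat4"
  have nz: "fund k (hat (q j)) \<noteq> 0" if "q \<in> PP" for q
    using inv[OF PP_nth[OF that j]] by auto
  have "F (act q b) = fund k (hat (prev b j)) / fund k (hat (b j)) * F q"
    if q: "q \<in> PP" and b: "b \<in> borel_tuples" for q b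
  proof -
    have P: "b j \<in> minimal_parabolic g (ks ! j)" "prev b j \<in> minimal_parabolic g (ks ! j)"
      "q j \<in> minimal_parabolic g (ks ! j)"
      using borel_opp_subset_minimal_parabolic[OF nth_ks[OF j]] borel_tuples_nth[OF b j]
        prev_in_borel[OF b, of j] PP_nth[OF q j] j by auto
    have "fund k (hat (act q b j)) =
        fund k (hat (matrix_inv (prev b j))) * fund k (hat (q j)) * fund k (hat (b j))"
      unfolding act_nth[OF j] hat_mult by (simp add: fund_mult block P)
    moreover have "fund k (hat (matrix_inv (prev b j))) = inverse (fund k (hat (prev b j)))"
      using inv[OF P(2)] by (metis inverse_unique mult.commute)
    ultimately show ?thesis
      by (simp add: F_def field_simps)
  qed
  moreover have "F \<in> regular S PP"
    unfolding F_def[abs_def]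
  proof (rule regular_inverse[OF regular_PP])
    show "(\<lambda>q. fund k (hat (q j))) \<in> polynomials"
      unfolding fund_def by (intro polynomial_mixed_det polynomial_matrix_hat polynomial_matrix_entry)
  qed (use nz in auto)
  ultimately have "semi_invariant (\<lambda>b. fund k (hat (prev b j)) / fund k (hat (b j))) F"
    by (simp add: semi_invariant_def)
  moreover have "F p \<noteq> 0" using nz[OF p] by (simp add: F_def)
  ultimately show ?thesis
    unfolding weight_nonvanishing_def by (intro exI[of _ F]) simp
qed

lemma fund_borel_nonzero: "b \<in> borel_tuples \<Longrightarrow> j < n \<Longrightarrow> fund k (hat (b j)) \<noteq> 0"
  using borel_tuples_nth[of b j] borel_diag_nonzero[of "b j"]
  by (auto simp: fund_lower borel_opp_iff)

text \<open>
  The contributions of one fundamental weight are collected from the right. Every letter adjacent to \<open>k\<close>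
  contributes its inverse, and these inverses are carried to the left, by means of the isomorphisms
  above, until they meet a letter \<open>k\<close>. This letter contributes a square, and the remaining exponent is
  nonnegative because at most two inverses have been collected. In the formula, the power of
  \<open>prev b l\<close> is what still has to be compensated; at \<open>l = 0\<close> it is trivial.
\<close>

lemma weight_nonvanishing_cartan:
  assumes k: "k \<in> {1,2,3}"
    and few: "\<And>l. l < n \<Longrightarrow> neighbours_before (ks ! l) (drop (Suc l) ks) \<le> 2"
  shows "weight_nonvanishing p (\<lambda>b. \<Prod>j<n. cartan_factor k (ks ! j) (fund k (hat (b j))))"
proof -
  let ?y = "\<lambda>j b. fund k (hat (b j))" and ?e = "\<lambda>l b. fund k (hat (prev b l))"
  let ?P = "\<lambda>l b. \<Prod>j\<in>{l..<n}. cartan_factor k (ks ! j) (?y j b)"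
  have "weight_nonvanishing p (\<lambda>b. ?P l b * ?e l b ^ neighbours_before k (drop l ks))" if "l \<le> n" for l
    using that
  proof (induction l rule: inc_induct)
    case base
    then show ?case by (simp add: weight_nonvanishing_one)
  next
    case (step l)
    define m where "m = neighbours_before k (drop (Suc l) ks)"
    have drop: "drop l ks = ks ! l # drop (Suc l) ks"
      using step.hyps by (simp add: Cons_nth_drop_Suc)
    have P: "?P l b = cartan_factor k (ks ! l) (?y l b) * ?P (Suc l) b" for b
      using step.hyps by (simp add: prod.atLeast_Suc_lessThan)
    have IH: "weight_nonvanishing p (\<lambda>b. ?P (Suc l) b * ?y l b ^ m)"
      using step.IH by (simp add: m_def prev_def)
    show ?case
    proof (cases "ks ! l = k")
      case True
      then have "m \<le> 2" using few[of l] step.hyps by (simp add: m_def)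
      then have "?P (Suc l) b * ?y l b ^ m * ?y l b ^ (2 - m) = ?P l b" for b
        unfolding P using True
        by (simp add: cartan_factor_def mult.assoc power_add[symmetric] mult.commute)
      then show ?thesis
        using weight_nonvanishing_mult[OF IH
            weight_nonvanishing_power[OF weight_nonvanishing_fund[OF step.hyps(2)], of k "2 - m"]] True
        by (simp add: drop)
    next
      case False
      define r where "r = neighbours_before k (drop l ks)"
      have eq: "?P (Suc l) b * ?y l b ^ m * (?e l b / ?y l b) ^ r = ?P l b * ?e l b ^ r"
        if "b \<in> borel_tuples" for b
      proof -
        have "?y l b \<noteq> 0" using fund_borel_nonzero[OF that step.hyps(2)] .
        then have "?y l b ^ m * (1 / ?y l b) ^ r = cartan_factor k (ks ! l) (?y l b)"
          using False by (simp add: r_def drop m_def cartan_factor_def field_simps)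
        then have "?P (Suc l) b * ?y l b ^ m * (1 / ?y l b) ^ r = ?P l b"
          unfolding P by (simp add: mult.assoc mult.commute)
        moreover have "(?e l b / ?y l b) ^ r = (1 / ?y l b) ^ r * ?e l b ^ r"
          by (simp add: power_divide)
        ultimately show ?thesis by (simp add: mult.assoc)
      qed
      have "weight_nonvanishing p (\<lambda>b. ?P (Suc l) b * ?y l b ^ m * (?e l b / ?y l b) ^ r)"
        using False
        by (intro weight_nonvanishing_mult[OF IH] weight_nonvanishing_power
            weight_nonvanishing_ratio[OF step.hyps(2) k]) auto
      then show ?thesis
        unfolding r_def[symmetric] by (rule weight_nonvanishing_cong) (rule eq)
    qed
  qed
  from this[of 0] show ?thesis
    by (simp add: prev_def atLeast0LessThan)
qed

text \<open>
  Expansion of the simple roots in the three fundamental weights and exchange of the two products.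
\<close>

lemma weight_nonvanishing_weight:
  assumes "\<And>l. l < n \<Longrightarrow> neighbours_before (ks ! l) (drop (Suc l) ks) \<le> 2"
  shows "weight_nonvanishing p weight"
proof -
  let ?w = "\<lambda>k b. \<Prod>j<n. cartan_factor k (ks ! j) (fund k (hat (b j)))"
  have "weight_nonvanishing p (?w k)" if "k \<in> {1,2,3}" for k
    by (rule weight_nonvanishing_cartan[OF that assms])
  then have "weight_nonvanishing p (\<lambda>b. ?w 1 b * (?w 2 b * ?w 3 b))"
    by (intro weight_nonvanishing_mult) auto
  then show ?thesis
  proof (rule weight_nonvanishing_cong)
    fix b assume b: "b \<in> borel_tuples"
    have "?w 1 b * (?w 2 b * ?w 3 b) = (\<Prod>j<n. \<Prod>k\<in>{1,2,3}. cartan_factor k (ks ! j) (fund k (hat (b j))))"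
      by (simp add: prod.distrib)
    also have "\<dots> = weight b"
      unfolding weight_def
    proof (rule prod.cong[OF refl])
      fix j assume "j \<in> {..<n}"
      then have j: "j < n" by simp
      show "(\<Prod>k\<in>{1,2,3}. cartan_factor k (ks ! j) (fund k (hat (b j)))) =
          hat (b j) $ hi (ks ! j) $ hi (ks ! j) / hat (b j) $ lo (ks ! j) $ lo (ks ! j)"
        using borel_tuples_nth[OF b j] by (intro prod_cartan_factor nth_ks[OF j]) (auto simp: borel_opp_iff)
    qed
    finally show "?w 1 b * (?w 2 b * ?w 3 b) = weight b" .
  qed
qed

end

lemma anticanonical_bundle_globally_generated:
  assumes "\<And>l. l < n \<Longrightarrow> neighbours_before (ks ! l) (drop (Suc l) ks) \<le> 2"
  shows "globally_generated (anticanonical_bundle n Z)"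
  using weight_nonvanishing_weight[OF _ assms]
  by (intro globally_generated_if_semi_invariants) (auto simp: weight_nonvanishing_def)

end

theorem proposition1p6:
  fixes g :: "complex^4^4" and w0 :: "(complex^4^4) set" and i :: "nat list"
  assumes "g \<in> carrier SL4"
    and "longest_element g w0"
    and "length i = 6"
    and "reduced_expression g i w0"
  shows "globally_generated (anticanonical_bundle (length i) (BSDH g i))"
proof -
  have set: "set i \<subseteq> {1,2,3}"
    using assms(4) by (simp add: reduced_expression_def)
  interpret bsdh_word g i
    using assms(1) set by unfold_locales
  show ?thesis
  proof (rule anticanonical_bundle_globally_generated)
    fix l assume l: "l < length i"
    have "\<not> sublist u (drop (Suc l) i)"
      if "u \<in> {[1,1], [2,2], [3,3], [1,3,1], [3,1,3], [2,3,2,3,2], [2,1,2,1,2]}" for u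
      using reduced_expression_avoids[OF assms(1,4) that] sublist_drop[of "Suc l" i]
      by (meson sublist_order.order.trans)
    then show "neighbours_before (i ! l) (drop (Suc l) i) \<le> 2"
      using set nth_ks[OF l] set_drop_subset[of "Suc l" i]
      by (intro neighbours_before_le_2) auto
  qed
qed

end
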